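(* Let $k$ be an algebraically closed field of characteristic $p>0$ and let $X$ be a variety over $k$. Suppose that $X$ is F-pure. Then for every integer $e\ge 0$ and every closed point $Z\in\mathrm{FB}_{e+1}(X)$, identified with a $0$-dimensional closed subscheme of $X_{e+1}$, the scheme-theoretic image $\bar Z\subset X_e$ of $Z$ by the natural morphism $X_{e+1}\to X_e$ belongs to $\mathrm{FB}_e(X)$.
   Context: A variety over $k$ is a separated integral scheme of finite type over $k$; points of varieties are closed points. For $e\ge 0$, let $F_e:X_e\to X$ be the $e$-times iterated $k$-linear Frobenius: concretely $X_e=\mathcal{S}pec_X\,\mathcal{O}_X^{1/p^e}$, where $\mathcal{O}_X^{1/p^e}$ is the sheaf of $p^e$-th roots of local sections of $\mathcal{O}_X$ (in an algebraic closure of the function field of $X$), $F_e$ corresponds to the inclusion $\mathcal{O}_X\hookrightarrow\mathcal{O}_X^{1/p^e}$, and $X_e$ is a $k$-scheme via $F_e$ and $X\to\operatorname{Spec}k$. The natural morphism $X_{e+1}\to X_e$ is the one corresponding to the inclusion $\mathcal{O}_X^{1/p^e}\hookrightarrow\mathcal{O}_X^{1/p^{e+1}}$. $X$ is F-pure if the natural morphism $\mathcal{O}_X\to\mathcal{O}_X^{1/p}$ locally splits as a morphism of $\mathcal{O}_X$-modules. F-blowup: let $d=\dim X$. For each smooth closed point $x\in X$, the scheme-theoretic fiber $F_e^{-1}(x)$ is a closed subscheme of $X_e$ of length $p^{ed}$ supported at one point (a fat point), hence a closed point of the Hilbert scheme $\mathrm{Hilb}_{p^{ed}}(X_e)$ of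 $0$-dimensional subschemes of $X_e$ of length $p^{ed}$. The $e$-th F-blowup $\mathrm{FB}_e(X)$ is the closure (with reduced structure) in $\mathrm{Hilb}_{p^{ed}}(X_e)$ of the set $\{F_e^{-1}(x)\mid x\in X(k)\text{ smooth}\}$. It is a variety, projective and birational over $X$. A closed subscheme of $X_e$ "belongs to $\mathrm{FB}_e(X)$" if it has length $p^{ed}$ and the corresponding point of $\mathrm{Hilb}_{p^{ed}}(X_e)$ lies in $\mathrm{FB}_e(X)$. *)

theory Defs
  imports
    "HOL-Analysis.Abstract_Topology"
    "HOL-Algebra.QuotRing"
    "HOL-Algebra.Generated_Rings"
    "HOL-Algebra.Algebraic_Closure_Type"
begin

(* HOL-Algebra reserves closure_of for an operator unrelated to topology, and X. *)
no_notation eq_closure_of (\<open>closure'_of\<index>\<close>)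
no_notation var (\<open>X\<index>\<close>)

section \<open>Schemes over a field\<close>

text \<open>
  A space with a presheaf of rings and a map from the ground field to the global sections.
  The ground field is a type \<^typ>\<open>'k\<close>, the rings of sections are
  HOL-Algebra rings with elements in \<^typ>\<open>'a\<close>.
\<close>

record ('x, 'a, 'k) kspace =
  pts :: "'x topology"
  sec :: "'x set \<Rightarrow> 'a ring"
  res :: "'x set \<Rightarrow> 'x set \<Rightarrow> 'a \<Rightarrow> 'a"
  scal :: "'k \<Rightarrow> 'a"

definition ringed_kspace :: "('x, 'a, 'k::field) kspace \<Rightarrow> bool" where
  "ringed_kspace X \<longleftrightarrow>
     (\<forall>U. openin (pts X) U \<longrightarrow> cring (sec X U)) \<and>
     (\<forall>U V. openin (pts X) U \<and> openin (pts X) V \<and> V \<subseteq> U \<longrightarrow>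
        res X U V \<in> ring_hom (sec X U) (sec X V)) \<and>
     (\<forall>U. openin (pts X) U \<longrightarrow> (\<forall>s\<in>carrier (sec X U). res X U U s = s)) \<and>
     (\<forall>U V W. openin (pts X) U \<and> openin (pts X) V \<and> openin (pts X) W \<and> W \<subseteq> V \<and> V \<subseteq> U \<longrightarrow>
        (\<forall>s\<in>carrier (sec X U). res X V W (res X U V s) = res X U W s)) \<and>
     (\<forall>\<U>. (\<forall>V\<in>\<U>. openin (pts X) V) \<longrightarrow>
        (\<forall>s\<in>carrier (sec X (\<Union>\<U>)). \<forall>t\<in>carrier (sec X (\<Union>\<U>)).
           (\<forall>V\<in>\<U>. res X (\<Union>\<U>) V s = res X (\<Union>\<U>) V t) \<longrightarrow> s = t)) \<and>
     (\<forall>\<U> t. (\<forall>V\<in>\<U>. openin (pts X) V \<and> t V \<in> carrier (sec X V)) \<and>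
        (\<forall>V\<in>\<U>. \<forall>W\<in>\<U>. res X V (V \<inter> W) (t V) = res X W (V \<inter> W) (t W)) \<longrightarrow>
        (\<exists>s\<in>carrier (sec X (\<Union>\<U>)). \<forall>V\<in>\<U>. res X (\<Union>\<U>) V s = t V)) \<and>
     scal X \<in> ring_hom ring_of_type_algebra (sec X (topspace (pts X)))"

text \<open>
  The set of points of \<open>U\<close> at which the germ of \<open>f\<close> is a unit.  On a scheme this is the
  distinguished open set \<open>D(f)\<close>, and its complement in \<open>U\<close> consists of the points at which
  the germ of \<open>f\<close> lies in the maximal ideal of the stalk.
\<close>

definition unit_locus :: "('x, 'a, 'k) kspace \<Rightarrow> 'x set \<Rightarrow> 'a \<Rightarrow> 'x set" where
  "unit_locus X U f =
     {x. \<exists>V. openin (pts X) V \<and> x \<in> V \<and> V \<subseteq> U \<and> res X U V f \<in> Units (sec X V)}"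

definition ideal_of_point :: "('x, 'a, 'k) kspace \<Rightarrow> 'x \<Rightarrow> 'x set \<Rightarrow> 'a set" where
  "ideal_of_point X x U = {f \<in> carrier (sec X U). x \<notin> unit_locus X U f}"

text \<open>
  \<open>(U, \<O>|\<^sub>U)\<close> is the spectrum of \<open>A = \<O>(U)\<close>: the canonical map from \<open>U\<close> to the prime ideals of
  \<open>A\<close> is bijective and a homeomorphism (the sets \<open>D(f)\<close> are a base of \<open>U\<close>), and for all \<open>f\<close>
  the restriction from \<open>A\<close> to \<open>\<O>(D(f))\<close> is the localization of \<open>A\<close> at \<open>f\<close>.
\<close>

definition affine_open :: "('x, 'a, 'k) kspace \<Rightarrow> 'x set \<Rightarrow> bool" where
  "affine_open X U \<longleftrightarrow>
     openin (pts X) U \<and>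
     bij_betw (\<lambda>x. ideal_of_point X x U) U {P. primeideal P (sec X U)} \<and>
     (\<forall>V x. openin (pts X) V \<and> V \<subseteq> U \<and> x \<in> V \<longrightarrow>
        (\<exists>f\<in>carrier (sec X U). x \<in> unit_locus X U f \<and> unit_locus X U f \<subseteq> V)) \<and>
     (\<forall>f\<in>carrier (sec X U).
        (let D = unit_locus X U f; r = res X U D in
           r f \<in> Units (sec X D) \<and>
           (\<forall>s\<in>carrier (sec X U). r s = \<zero>\<^bsub>sec X D\<^esub> \<longrightarrow>
              (\<exists>n::nat. f [^]\<^bsub>sec X U\<^esub> n \<otimes>\<^bsub>sec X U\<^esub> s = \<zero>\<^bsub>sec X U\<^esub>)) \<and>
           (\<forall>t\<in>carrier (sec X D). \<exists>n::nat. \<exists>s\<in>carrier (sec X U).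
              r s = r f [^]\<^bsub>sec X D\<^esub> n \<otimes>\<^bsub>sec X D\<^esub> t)))"

definition kscheme :: "('x, 'a, 'k::field) kspace \<Rightarrow> bool" where
  "kscheme X \<longleftrightarrow> ringed_kspace X \<and> (\<forall>x\<in>topspace (pts X). \<exists>U. affine_open X U \<and> x \<in> U)"

definition integral_scheme :: "('x, 'a, 'k) kspace \<Rightarrow> bool" where
  "integral_scheme X \<longleftrightarrow> topspace (pts X) \<noteq> {} \<and>
     (\<forall>U. openin (pts X) U \<and> U \<noteq> {} \<longrightarrow> domain (sec X U))"

definition finite_type :: "('x, 'a, 'k) kspace \<Rightarrow> bool" where
  "finite_type X \<longleftrightarrow>
     (\<exists>\<U>. finite \<U> \<and> \<Union>\<U> = topspace (pts X) \<and>
        (\<forall>U\<in>\<U>. affine_open X U \<and>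
           (\<exists>G. finite G \<and> G \<subseteq> carrier (sec X U) \<and>
              carrier (sec X U) =
                generate_ring (sec X U) (res X (topspace (pts X)) U ` range (scal X) \<union> G))))"

text \<open>
  The diagonal of \<open>X \<times>\<^sub>k X\<close> is a closed immersion.  The products \<open>U \<times>\<^sub>k V\<close> of affine open sets
  are an affine open cover of \<open>X \<times>\<^sub>k X\<close>, the preimage of \<open>U \<times>\<^sub>k V\<close> under the diagonal is
  \<open>U \<inter> V\<close>, and the map on sections is \<open>\<O>(U) \<otimes>\<^sub>k \<O>(V) \<rightarrow> \<O>(U \<inter> V)\<close>; the condition is that these
  preimages are affine and these maps are surjective.
\<close>

definition separated :: "('x, 'a, 'k) kspace \<Rightarrow> bool" where
  "separated X \<longleftrightarrow>
     (\<forall>U V. affine_open X U \<and> affine_open X V \<longrightarrow>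
        affine_open X (U \<inter> V) \<and>
        carrier (sec X (U \<inter> V)) =
          generate_ring (sec X (U \<inter> V))
            (res X U (U \<inter> V) ` carrier (sec X U) \<union> res X V (U \<inter> V) ` carrier (sec X V)))"

definition variety :: "('x, 'a, 'k::field) kspace \<Rightarrow> bool" where
  "variety X \<longleftrightarrow> kscheme X \<and> separated X \<and> integral_scheme X \<and> finite_type X"


section \<open>Dimension and smooth points\<close>

definition irreducible_closed :: "'x topology \<Rightarrow> 'x set \<Rightarrow> bool" where
  "irreducible_closed T C \<longleftrightarrow> closedin T C \<and> C \<noteq> {} \<and>
     (\<forall>A B. closedin T A \<and> closedin T B \<and> C = A \<union> B \<longrightarrow> C = A \<or> C = B)"

definition krull_dim :: "'x topology \<Rightarrow> nat" where
  "krull_dim T =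
     Sup {n. \<exists>C. (\<forall>i\<le>n. irreducible_closed T (C i)) \<and> (\<forall>i<n. C i \<subset> C (Suc i))}"

text \<open>
  Over an algebraically closed field a closed point \<open>x\<close> of a variety \<open>X\<close> is smooth iff the stalk
  at \<open>x\<close> is a regular local ring; as this ring has dimension \<open>dim X\<close>, this says that its maximal
  ideal is generated by \<open>dim X\<close> elements.  Here these are germs of the elements of \<open>T\<close>, and the
  elements of the stalk are written as germs of sections.
\<close>

definition smooth_closed_point :: "('x, 'a, 'k) kspace \<Rightarrow> 'x \<Rightarrow> bool" where
  "smooth_closed_point X x \<longleftrightarrow>
     closedin (pts X) {x} \<and>
     (\<exists>U T. openin (pts X) U \<and> x \<in> U \<and>
        T \<subseteq> ideal_of_point X x U \<and> finite T \<and> card T = krull_dim (pts X) \<and>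
        (\<forall>V s. openin (pts X) V \<and> x \<in> V \<and> s \<in> ideal_of_point X x V \<longrightarrow>
           (\<exists>W. openin (pts X) W \<and> x \<in> W \<and> W \<subseteq> U \<inter> V \<and>
              res X V W s \<in> Idl\<^bsub>sec X W\<^esub> (res X U W ` T))))"


section \<open>Closed subschemes\<close>

text \<open>
  A closed subscheme is represented by its quasi-coherent ideal sheaf \<open>I\<close>.  Quasi-coherence is
  the condition \<open>I(D(f)) = I(U)\<^sub>f\<close> for all affine open \<open>U\<close> and \<open>f\<close> in \<open>\<O>(U)\<close>.  To make the
  representation unique, \<open>I\<close> is empty on sets that are not open.
\<close>

definition closed_subscheme :: "('x, 'a, 'k) kspace \<Rightarrow> ('x set \<Rightarrow> 'a set) \<Rightarrow> bool" where
  "closed_subscheme Y I \<longleftrightarrow>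
     (\<forall>U. \<not> openin (pts Y) U \<longrightarrow> I U = {}) \<and>
     (\<forall>U. openin (pts Y) U \<longrightarrow> ideal (I U) (sec Y U)) \<and>
     (\<forall>U V. openin (pts Y) U \<and> openin (pts Y) V \<and> V \<subseteq> U \<longrightarrow> (\<forall>s\<in>I U. res Y U V s \<in> I V)) \<and>
     (\<forall>\<U>. (\<forall>V\<in>\<U>. openin (pts Y) V) \<longrightarrow>
        (\<forall>s\<in>carrier (sec Y (\<Union>\<U>)). (\<forall>V\<in>\<U>. res Y (\<Union>\<U>) V s \<in> I V) \<longrightarrow> s \<in> I (\<Union>\<U>))) \<and>
     (\<forall>U. affine_open Y U \<longrightarrow> (\<forall>f\<in>carrier (sec Y U).
        (let D = unit_locus Y U f; r = res Y U D in
           \<forall>t\<in>I D. \<exists>n::nat. \<exists>s\<in>I U. r s = r f [^]\<^bsub>sec Y D\<^esub> n \<otimes>\<^bsub>sec Y D\<^esub> t)))"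

definition supported_in :: "('x, 'a, 'k) kspace \<Rightarrow> ('x set \<Rightarrow> 'a set) \<Rightarrow> 'x set \<Rightarrow> bool" where
  "supported_in Y I U \<longleftrightarrow>
     (\<forall>x\<in>topspace (pts Y) - U. \<exists>V. openin (pts Y) V \<and> x \<in> V \<and> \<one>\<^bsub>sec Y V\<^esub> \<in> I V)"

text \<open>
  The next two definitions concern a morphism \<open>Y' \<rightarrow> Y\<close> that is the identity on points; it is
  given by the maps \<open>h U\<close> from the sections of \<open>Y\<close> to those of \<open>Y'\<close>.  The fibre over a closed
  point is the inverse image of the ideal sheaf of the point, that is, the ideal sheaf locally
  generated by its image.  The scheme-theoretic image of a closed subscheme \<open>Z\<close> of \<open>Y'\<close> is given
  by the kernel of \<open>\<O>\<^sub>Y \<rightarrow> \<O>\<^sub>Z\<close>.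
\<close>

definition scheme_fibre ::
    "('x, 'a, 'k) kspace \<Rightarrow> ('x, 'b, 'k) kspace \<Rightarrow> ('x set \<Rightarrow> 'a \<Rightarrow> 'b) \<Rightarrow> 'x \<Rightarrow> 'x set \<Rightarrow> 'b set" where
  "scheme_fibre Y Y' h x V =
     (if openin (pts Y') V
      then {s \<in> carrier (sec Y' V). \<forall>y\<in>V. \<exists>W. openin (pts Y') W \<and> y \<in> W \<and> W \<subseteq> V \<and>
              res Y' V W s \<in> Idl\<^bsub>sec Y' W\<^esub> (h W ` ideal_of_point Y x W)}
      else {})"

definition scheme_image ::
    "('x, 'a, 'k) kspace \<Rightarrow> ('x set \<Rightarrow> 'a \<Rightarrow> 'b) \<Rightarrow> ('x set \<Rightarrow> 'b set) \<Rightarrow> 'x set \<Rightarrow> 'a set" where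
  "scheme_image Y h I V =
     (if openin (pts Y) V then {s \<in> carrier (sec Y V). h V s \<in> I V} else {})"


section \<open>The Hilbert scheme of points\<close>

definition lincomb ::
    "('x, 'a, 'k) kspace \<Rightarrow> 'x set \<Rightarrow> 'k list \<Rightarrow> 'a list \<Rightarrow> 'a" where
  "lincomb Y U cs b =
     (\<Oplus>\<^bsub>sec Y U\<^esub>i\<in>{..<length b}. res Y (topspace (pts Y)) U (scal Y (cs ! i)) \<otimes>\<^bsub>sec Y U\<^esub> (b ! i))"

text \<open>
  The Hilbert scheme of length \<open>n\<close> subschemes of \<open>Y\<close> is glued from the following affine charts.
  For an affine open \<open>U\<close> and \<open>b\<^sub>1, \<dots>, b\<^sub>n\<close> in \<open>A = \<O>(U)\<close>, the chart consists of the closed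
  subschemes \<open>Z \<subseteq> U\<close> such that \<open>b\<^sub>1, \<dots>, b\<^sub>n\<close> is a basis of the \<open>k\<close>-vector space
  \<open>\<Gamma>(Z, \<O>\<^sub>Z) = A / I\<^sub>Z(U)\<close>; in particular \<open>Z\<close> has length \<open>n\<close>.
  Its coordinate ring is generated by the functions that send \<open>Z\<close> to the coordinates, with
  respect to this basis, of the class of \<open>s\<close> in \<open>A / I\<^sub>Z(U)\<close>, for \<open>s\<close> in \<open>A\<close>.
\<close>

definition hilb_chart :: "('x, 'a, 'k) kspace \<Rightarrow> 'x set \<Rightarrow> 'a list \<Rightarrow> ('x set \<Rightarrow> 'a set) set" where
  "hilb_chart Y U b =
     {I. closed_subscheme Y I \<and> supported_in Y I U \<and>
         (\<forall>s\<in>carrier (sec Y U).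
            \<exists>!cs. length cs = length b \<and> s \<ominus>\<^bsub>sec Y U\<^esub> lincomb Y U cs b \<in> I U)}"

definition hilb_coord ::
    "('x, 'a, 'k) kspace \<Rightarrow> 'x set \<Rightarrow> 'a list \<Rightarrow> 'a \<Rightarrow> nat \<Rightarrow> ('x set \<Rightarrow> 'a set) \<Rightarrow> 'k" where
  "hilb_coord Y U b s i I =
     (THE cs. length cs = length b \<and> s \<ominus>\<^bsub>sec Y U\<^esub> lincomb Y U cs b \<in> I U) ! i"

inductive_set hilb_functions ::
    "('x, 'a, 'k::comm_ring_1) kspace \<Rightarrow> 'x set \<Rightarrow> 'a list \<Rightarrow> (('x set \<Rightarrow> 'a set) \<Rightarrow> 'k) set"
  for Y U b where
  const: "(\<lambda>I. c) \<in> hilb_functions Y U b"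
| coord: "s \<in> carrier (sec Y U) \<Longrightarrow> i < length b \<Longrightarrow> hilb_coord Y U b s i \<in> hilb_functions Y U b"
| add: "f \<in> hilb_functions Y U b \<Longrightarrow> g \<in> hilb_functions Y U b \<Longrightarrow>
          (\<lambda>I. f I + g I) \<in> hilb_functions Y U b"
| mult: "f \<in> hilb_functions Y U b \<Longrightarrow> g \<in> hilb_functions Y U b \<Longrightarrow>
          (\<lambda>I. f I * g I) \<in> hilb_functions Y U b"

text \<open>
  The closed points of the Hilbert scheme, for an algebraically closed ground field, with the
  Zariski topology: the charts are open and carry the Zariski topology defined by their coordinate
  rings.  The points are the length \<open>n\<close> subschemes contained in some affine open set.  For
  quasi-projective \<open>Y\<close> these are all of them.  Otherwise the Hilbert functor is represented by an
  algebraic space and this is an open subspace of it, which contains the subschemes supported at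
  one point.  As the latter are a closed set, the closure of a set of fat points is the same in
  both spaces.
\<close>

definition hilb_topology ::
    "('x, 'a, 'k::comm_ring_1) kspace \<Rightarrow> nat \<Rightarrow> ('x set \<Rightarrow> 'a set) topology" where
  "hilb_topology Y n =
     topology_generated_by
       {{I \<in> hilb_chart Y U b. f I \<noteq> 0} | U b f.
          affine_open Y U \<and> set b \<subseteq> carrier (sec Y U) \<and> length b = n \<and> f \<in> hilb_functions Y U b}"


section \<open>Iterated Frobenius and F-blowups\<close>

text \<open>
  The field \<^typ>\<open>'l\<close> is an algebraic closure of the function field of the integral scheme \<open>X\<close>.
  The function field is the stalk at the generic point, i.e. the colimit of \<open>\<O>(U)\<close> over the
  nonempty open sets \<open>U\<close>; the maps \<open>\<iota> U\<close> are the induced embeddings.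
\<close>

definition function_field_closure ::
    "('x, 'a, 'k) kspace \<Rightarrow> ('x set \<Rightarrow> 'a \<Rightarrow> 'l::alg_closed_field) \<Rightarrow> bool" where
  "function_field_closure X \<iota> \<longleftrightarrow>
     (\<forall>U. openin (pts X) U \<and> U \<noteq> {} \<longrightarrow>
        \<iota> U \<in> ring_hom (sec X U) ring_of_type_algebra \<and> inj_on (\<iota> U) (carrier (sec X U))) \<and>
     (\<forall>U V. openin (pts X) U \<and> openin (pts X) V \<and> V \<noteq> {} \<and> V \<subseteq> U \<longrightarrow>
        (\<forall>s\<in>carrier (sec X U). \<iota> V (res X U V s) = \<iota> U s)) \<and>
     (\<forall>z. \<exists>q. q \<noteq> 0 \<and> poly q z = 0 \<and>
        (\<forall>i. coeff q i \<in> (\<Union>U\<in>{U. openin (pts X) U \<and> U \<noteq> {}}. \<iota> U ` carrier (sec X U))))"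

text \<open>
  \<open>X\<^sub>e\<close> is the relative spectrum of the sheaf of \<open>p\<^sup>e\<close>-th roots of sections of \<open>\<O>\<^sub>X\<close>.  Its
  underlying space is that of \<open>X\<close> since \<open>F\<^sub>e\<close> is a homeomorphism.  The value on the empty set is
  the zero ring, on which \<open>\<iota>\<close> is not specified.
\<close>

definition frob_root ::
    "('x, 'a, 'k::field) kspace \<Rightarrow> ('x set \<Rightarrow> 'a \<Rightarrow> 'l::field) \<Rightarrow> nat \<Rightarrow> ('x, 'l, 'k) kspace" where
  "frob_root X \<iota> e =
     \<lparr> pts = pts X,
       sec = (\<lambda>U. if U = {} then ring_of_type_algebra\<lparr>carrier := {0}, one := 0\<rparr>
                  else ring_of_type_algebra
                         \<lparr>carrier := {z. z ^ (CHAR('k) ^ e) \<in> \<iota> U ` carrier (sec X U)}\<rparr>),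
       res = (\<lambda>U V z. if V = {} then 0 else z),
       scal = (\<lambda>c. \<iota> (topspace (pts X)) (scal X c)) \<rparr>"

text \<open>The inclusion of \<open>\<O>\<^sub>X\<close> in the sheaf of roots, i.e. the morphism \<open>F\<^sub>e : X\<^sub>e \<rightarrow> X\<close>.\<close>

definition frob_map :: "('x set \<Rightarrow> 'a \<Rightarrow> 'l::field) \<Rightarrow> 'x set \<Rightarrow> 'a \<Rightarrow> 'l" where
  "frob_map \<iota> U s = (if U = {} then 0 else \<iota> U s)"

definition F_pure ::
    "('x, 'a, 'k::field) kspace \<Rightarrow> ('x set \<Rightarrow> 'a \<Rightarrow> 'l::field) \<Rightarrow> bool" where
  "F_pure X \<iota> \<longleftrightarrow>
     (let X1 = frob_root X \<iota> 1 in
      \<forall>x\<in>topspace (pts X). \<exists>U \<phi>. openin (pts X) U \<and> x \<in> U \<and>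
        (\<forall>V. openin (pts X) V \<and> V \<subseteq> U \<longrightarrow>
           \<phi> V \<in> carrier (sec X1 V) \<rightarrow> carrier (sec X V) \<and>
           (\<forall>s\<in>carrier (sec X1 V). \<forall>t\<in>carrier (sec X1 V).
              \<phi> V (s \<oplus>\<^bsub>sec X1 V\<^esub> t) = \<phi> V s \<oplus>\<^bsub>sec X V\<^esub> \<phi> V t) \<and>
           (\<forall>a\<in>carrier (sec X V). \<forall>s\<in>carrier (sec X1 V).
              \<phi> V (frob_map \<iota> V a \<otimes>\<^bsub>sec X1 V\<^esub> s) = a \<otimes>\<^bsub>sec X V\<^esub> \<phi> V s) \<and>
           (\<forall>a\<in>carrier (sec X V). \<phi> V (frob_map \<iota> V a) = a)) \<and>
        (\<forall>V W. openin (pts X) V \<and> openin (pts X) W \<and> W \<subseteq> V \<and> V \<subseteq> U \<longrightarrow>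
           (\<forall>s\<in>carrier (sec X1 V). res X V W (\<phi> V s) = \<phi> W (res X1 V W s))))"

definition frob_fibre ::
    "('x, 'a, 'k::field) kspace \<Rightarrow> ('x set \<Rightarrow> 'a \<Rightarrow> 'l::field) \<Rightarrow> nat \<Rightarrow> 'x \<Rightarrow> 'x set \<Rightarrow> 'l set" where
  "frob_fibre X \<iota> e x = scheme_fibre X (frob_root X \<iota> e) (frob_map \<iota>) x"

text \<open>The set of closed points of the F-blowup.\<close>

definition F_blowup ::
    "('x, 'a, 'k::field) kspace \<Rightarrow> ('x set \<Rightarrow> 'a \<Rightarrow> 'l::field) \<Rightarrow> nat \<Rightarrow> ('x set \<Rightarrow> 'l set) set" where
  "F_blowup X \<iota> e =
     hilb_topology (frob_root X \<iota> e) (CHAR('k) ^ (e * krull_dim (pts X))) closure_of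
       {frob_fibre X \<iota> e x | x. smooth_closed_point X x}"

end

theory Submission
  imports Defs
begin

text \<open>
  All rings of sections are regarded as subrings of the algebraically closed field \<open>'l\<close>.

  If \<open>x\<close> is a smooth point, the ideal of its fibre at level \<open>e\<close> is generated by the maximal ideal
  of \<open>x\<close>.  A splitting \<open>\<psi>\<close> of \<open>\<O>\<^sup>1\<^sup>/\<^sup>q \<rightarrow> \<O>\<^sup>1\<^sup>/\<^sup>p\<^sup>q\<close>, which exists locally as \<open>X\<close> is F-pure, therefore maps
  the ideal of the fibre at level \<open>e + 1\<close> to that of the fibre at level \<open>e\<close>; in particular the
  second fibre is the image of the first.

  Let \<open>Z\<close> be a limit of fibres at level \<open>e + 1\<close>.  It is supported at one point, since every
  \<open>p\<^sup>e\<^sup>+\<^sup>1\<close>-th power is constant on a fibre, and this is a closed condition.  A basis of the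
  coordinate ring of the image of \<open>Z\<close> extends to a basis of the coordinate ring of \<open>Z\<close> by elements
  of the kernel of \<open>\<psi>\<close>.  On a nearby fibre this remains a basis, and by applying \<open>\<psi>\<close> one sees that
  the first part of it is a basis of the coordinate ring of the image.  So the image of \<open>Z\<close> has the
  right length, and passing to images is continuous at \<open>Z\<close>.
\<close>

section \<open>Subrings of a field and their ideals\<close>

text \<open>In a family of subschemes the length of the image can jump, so taking images is not
  continuous on the whole Hilbert scheme, and the image of \<open>Z\<close> is not even a point of
  the lower Hilbert scheme until its length is known. What can be proved is continuity at
  \<open>Z\<close> along the fibres, and that is enough for a closure; the length is read off from
  one fibre close to \<open>Z\<close>. The chart prescribes an affine set \<open>U\<close>, whereas
  the splitting lives only on a smaller \<open>D(f)\<close> around the support of \<open>Z\<close>.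
  Powers of \<open>f\<close> clear the denominators. They are replaced by powers of
  \<open>g = f ^ (p ^ (e + 1))\<close>, which is a nonzero scalar modulo \<open>Z\<close>, so that
  multiplying by \<open>g\<close> loses nothing; on a fibre over a zero of \<open>f\<close> it is 0.
  The splitting at level \<open>e\<close> is the given one conjugated by the bijective map
  \<open>z \<mapsto> z ^ (p ^ e)\<close> of the field. That a power is constant on a subscheme means
  that its coordinate vector is proportional to that of 1, i.e. that the 2 by 2 minors vanish; this
  makes the condition closed.\<close>

definition is_subring :: "'a::field set \<Rightarrow> bool" where
  "is_subring A \<longleftrightarrow> 1 \<in> A \<and> (\<forall>x\<in>A. \<forall>y\<in>A. x - y \<in> A \<and> x * y \<in> A)"

abbreviation ring_on :: "'a::field set \<Rightarrow> 'a ring" where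
  "ring_on A \<equiv> ring_of_type_algebra\<lparr>carrier := A\<rparr>"

lemma ring_on_simps [simp]:
  "carrier (ring_on A) = A" "\<one>\<^bsub>ring_on A\<^esub> = 1" "\<zero>\<^bsub>ring_on A\<^esub> = 0"
  "x \<otimes>\<^bsub>ring_on A\<^esub> y = x * y" "x \<oplus>\<^bsub>ring_on A\<^esub> y = x + y"
  by (simp_all add: ring_of_type_algebra_def)

lemma type_algebra_simps [simp]:
  "carrier (ring_of_type_algebra :: 'a::field ring) = UNIV" "\<one>\<^bsub>ring_of_type_algebra\<^esub> = (1::'a)"
  "\<zero>\<^bsub>ring_of_type_algebra\<^esub> = (0::'a)"
  "x \<otimes>\<^bsub>ring_of_type_algebra\<^esub> y = x * (y::'a)" "x \<oplus>\<^bsub>ring_of_type_algebra\<^esub> y = x + (y::'a)"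
  by (simp_all add: ring_of_type_algebra_def)

lemma is_subringD:
  assumes "is_subring A"
  shows "1 \<in> A" "0 \<in> A" "x \<in> A \<Longrightarrow> y \<in> A \<Longrightarrow> x - y \<in> A" "x \<in> A \<Longrightarrow> y \<in> A \<Longrightarrow> x * y \<in> A"
    "x \<in> A \<Longrightarrow> - x \<in> A" "x \<in> A \<Longrightarrow> y \<in> A \<Longrightarrow> x + y \<in> A" "x \<in> A \<Longrightarrow> x ^ n \<in> A"
proof -
  show 1: "1 \<in> A" and d: "x \<in> A \<Longrightarrow> y \<in> A \<Longrightarrow> x - y \<in> A" for x y
    using assms by (auto simp: is_subring_def)
  show m: "x \<in> A \<Longrightarrow> y \<in> A \<Longrightarrow> x * y \<in> A" for x y
    using assms by (auto simp: is_subring_def)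
  show 0: "0 \<in> A" using d[OF 1 1] by simp
  show n: "x \<in> A \<Longrightarrow> - x \<in> A" for x using d[OF 0] by simp
  show "x \<in> A \<Longrightarrow> y \<in> A \<Longrightarrow> x + y \<in> A" using d[of x "- y"] n[of y] by simp
  show "x \<in> A \<Longrightarrow> x ^ n \<in> A" by (induction n) (auto simp: 1 m)
qed

lemma cring_ring_on:
  assumes "is_subring A"
  shows "cring (ring_on A)"
proof (rule cringI)
  show "abelian_group (ring_on A)"
    by (rule abelian_groupI) (use is_subringD[OF assms] in \<open>auto simp: add_ac intro!: bexI[of _ "- _"]\<close>)
  show "comm_monoid (ring_on A)"
    by (rule comm_monoidI) (use is_subringD[OF assms] in \<open>auto simp: mult_ac\<close>)
qed (auto simp: distrib_right)

lemma
  assumes "is_subring A"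
  shows a_minus_ring_on: "x \<in> A \<Longrightarrow> y \<in> A \<Longrightarrow> x \<ominus>\<^bsub>ring_on A\<^esub> y = x - y"
    and finsum_ring_on: "(\<And>i. i \<in> S \<Longrightarrow> f i \<in> A) \<Longrightarrow> (\<Oplus>\<^bsub>ring_on A\<^esub>i\<in>S. f i) = sum f S"
    and nat_pow_ring_on: "x [^]\<^bsub>ring_on A\<^esub> (n::nat) = x ^ n"
    and Units_ring_on: "Units (ring_on A) = {x \<in> A. x \<noteq> 0 \<and> inverse x \<in> A}"
proof -
  interpret cring "ring_on A" by (rule cring_ring_on[OF assms])
  have "\<ominus>\<^bsub>ring_on A\<^esub> y = - y" if "y \<in> A" for y
    by (rule minus_equality) (use that is_subringD[OF assms] in auto)
  then show "x \<in> A \<Longrightarrow> y \<in> A \<Longrightarrow> x \<ominus>\<^bsub>ring_on A\<^esub> y = x - y"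
    by (simp add: a_minus_def)
  show "(\<And>i. i \<in> S \<Longrightarrow> f i \<in> A) \<Longrightarrow> (\<Oplus>\<^bsub>ring_on A\<^esub>i\<in>S. f i) = sum f S"
  proof (induction S rule: infinite_finite_induct)
    case (infinite S)
    then show ?case using finsum_infinite[of S f] by simp
  next
    case empty
    then show ?case using finsum_empty[of f] by simp
  next
    case (insert i S)
    then show ?case using finsum_insert[of S i f] by (simp add: Pi_def)
  qed
  show "x [^]\<^bsub>ring_on A\<^esub> n = x ^ n"
    by (induction n) (simp_all add: mult.commute)
  show "Units (ring_on A) = {x \<in> A. x \<noteq> 0 \<and> inverse x \<in> A}"
  proof (intro equalityI subsetI)
    fix x assume "x \<in> Units (ring_on A)"
    then obtain y where "x \<in> A" "y \<in> A" "x * y = 1"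
      by (auto simp: Units_def mult.commute)
    moreover from this have "inverse x = y" by (simp add: inverse_unique)
    ultimately show "x \<in> {x \<in> A. x \<noteq> 0 \<and> inverse x \<in> A}" by auto
  next
    fix x assume "x \<in> {x \<in> A. x \<noteq> 0 \<and> inverse x \<in> A}"
    then show "x \<in> Units (ring_on A)"
      by (auto simp: Units_def intro!: bexI[of _ "inverse x"])
  qed
qed

section \<open>Ideals of a subring\<close>

definition ideal_in :: "'a::field set \<Rightarrow> 'a set \<Rightarrow> bool" where
  "ideal_in A I \<longleftrightarrow> I \<subseteq> A \<and> 0 \<in> I \<and> (\<forall>x\<in>I. \<forall>y\<in>I. x + y \<in> I) \<and> (\<forall>a\<in>A. \<forall>x\<in>I. a * x \<in> I)"

lemma ideal_inD:
  assumes "ideal_in A I"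
  shows "x \<in> I \<Longrightarrow> x \<in> A" "0 \<in> I" "x \<in> I \<Longrightarrow> y \<in> I \<Longrightarrow> x + y \<in> I"
    "a \<in> A \<Longrightarrow> x \<in> I \<Longrightarrow> a * x \<in> I" "a \<in> A \<Longrightarrow> x \<in> I \<Longrightarrow> x * a \<in> I"
  using assms by (auto simp: ideal_in_def mult.commute)

lemma ideal_in_diff:
  assumes "ideal_in A I" "is_subring A" "x \<in> I" "y \<in> I"
  shows "x - y \<in> I"
  using ideal_inD(3)[OF assms(1,3), of "-1 * y"] ideal_inD(4)[OF assms(1) _ assms(4), of "-1"]
    is_subringD[OF assms(2)] by simp

lemma ideal_in_sum:
  assumes "ideal_in A I" "\<And>i. i \<in> S \<Longrightarrow> f i \<in> I"
  shows "sum f S \<in> I"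
  using assms(2) by (induction S rule: infinite_finite_induct) (auto intro: ideal_inD[OF assms(1)])

lemma ideal_ring_on_iff:
  assumes "is_subring A"
  shows "ideal I (ring_on A) \<longleftrightarrow> ideal_in A I"
proof
  assume "ideal I (ring_on A)"
  then interpret I: ideal I "ring_on A" .
  have "I \<subseteq> A" using I.a_subset by simp
  moreover have "0 \<in> I" using additive_subgroup.zero_closed[OF I.is_additive_subgroup] by simp
  moreover have "x + y \<in> I" if "x \<in> I" "y \<in> I" for x y
    using additive_subgroup.a_closed[OF I.is_additive_subgroup that] by simp
  moreover have "a * x \<in> I" if "a \<in> A" "x \<in> I" for a x
    using I.I_l_closed[of x a] that by simp
  ultimately show "ideal_in A I" by (simp add: ideal_in_def)
next
  assume I: "ideal_in A I"
  interpret cring "ring_on A" by (rule cring_ring_on[OF assms])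
  show "ideal I (ring_on A)"
  proof (rule idealI)
    show "ring (ring_on A)" by (rule ring_axioms)
    show "subgroup I (add_monoid (ring_on A))"
    proof (rule add.subgroupI)
      fix a assume a: "a \<in> I"
      then have "a \<in> A" using ideal_inD(1)[OF I] by simp
      then have "\<ominus>\<^bsub>ring_on A\<^esub> a = 0 - a"
        using a_minus_ring_on[OF assms, of 0 a] is_subringD(2)[OF assms] by (simp add: a_minus_def)
      then show "\<ominus>\<^bsub>ring_on A\<^esub> a \<in> I"
        using ideal_in_diff[OF I assms ideal_inD(2)[OF I] a] by simp
    qed (use ideal_inD[OF I] in auto)
  qed (use ideal_inD[OF I] in auto)
qed

definition ideal_gen :: "'a::field set \<Rightarrow> 'a set \<Rightarrow> 'a set" where
  "ideal_gen A S = \<Inter>{I. ideal_in A I \<and> S \<subseteq> I}"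

lemma genideal_ring_on:
  "is_subring A \<Longrightarrow> Idl\<^bsub>ring_on A\<^esub> S = ideal_gen A S"
  by (simp add: genideal_def ideal_gen_def ideal_ring_on_iff)

lemma ideal_gen_minimal: "ideal_in A I \<Longrightarrow> S \<subseteq> I \<Longrightarrow> ideal_gen A S \<subseteq> I"
  by (auto simp: ideal_gen_def)

lemma ideal_gen_superset: "S \<subseteq> ideal_gen A S"
  by (auto simp: ideal_gen_def)

lemma ideal_in_self: "is_subring A \<Longrightarrow> ideal_in A A"
  using is_subringD[of A] by (auto simp: ideal_in_def)

lemma ideal_in_ideal_gen:
  assumes "is_subring A" "S \<subseteq> A"
  shows "ideal_in A (ideal_gen A S)"
proof -
  have "ideal_gen A S \<subseteq> A"
    using ideal_gen_minimal[OF ideal_in_self] assms by blast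
  then show ?thesis by (auto simp: ideal_in_def ideal_gen_def)
qed

lemma ideal_gen_mono:
  assumes "is_subring A" "is_subring B" "A \<subseteq> B" "S \<subseteq> A" "S \<subseteq> T" "T \<subseteq> B"
  shows "ideal_gen A S \<subseteq> ideal_gen B T"
proof -
  have T: "ideal_in B (ideal_gen B T)" by (rule ideal_in_ideal_gen[OF assms(2,6)])
  have "ideal_in A (A \<inter> ideal_gen B T)"
    using is_subringD[OF assms(1)] ideal_inD[OF T] assms(3) by (auto simp: ideal_in_def)
  moreover have "S \<subseteq> A \<inter> ideal_gen B T"
    using assms(4,5) ideal_gen_superset[of T B] by blast
  ultimately show ?thesis using ideal_gen_minimal by blast
qed

lemma ideal_gen_finite:
  assumes A: "is_subring A" and T: "finite T" "T \<subseteq> A" and s: "s \<in> ideal_gen A T"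
  shows "\<exists>r. (\<forall>t\<in>T. r t \<in> A) \<and> s = (\<Sum>t\<in>T. r t * t)"
proof -
  define Q where "Q = {s. \<exists>r. (\<forall>t\<in>T. r t \<in> A) \<and> s = (\<Sum>t\<in>T. r t * t)}"
  have "ideal_in A Q"
    unfolding ideal_in_def
  proof (intro conjI ballI)
    have "(\<Sum>t\<in>T. r t * t) \<in> A" if "\<forall>t\<in>T. r t \<in> A" for r
      using that T is_subringD[OF A] by (intro ideal_in_sum[OF ideal_in_self[OF A]]) auto
    then show "Q \<subseteq> A" by (auto simp: Q_def)
    show "0 \<in> Q"
      using is_subringD(2)[OF A] by (auto simp: Q_def intro!: exI[of _ "\<lambda>_. 0"])
  next
    fix x y assume "x \<in> Q" "y \<in> Q"
    then obtain r r' where "\<forall>t\<in>T. r t \<in> A" "x = (\<Sum>t\<in>T. r t * t)" "\<forall>t\<in>T. r' t \<in> A" "y = (\<Sum>t\<in>T. r' t * t)"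
      by (auto simp: Q_def)
    then show "x + y \<in> Q"
      using is_subringD(6)[OF A] by (auto simp: Q_def distrib_right sum.distrib intro!: exI[of _ "\<lambda>t. r t + r' t"])
  next
    fix a x assume "a \<in> A" "x \<in> Q"
    then obtain r where "\<forall>t\<in>T. r t \<in> A" "x = (\<Sum>t\<in>T. r t * t)" by (auto simp: Q_def)
    then show "a * x \<in> Q"
      using is_subringD(4)[OF A \<open>a \<in> A\<close>]
      by (auto simp: Q_def sum_distrib_left mult.assoc intro!: exI[of _ "\<lambda>t. a * r t"])
  qed
  moreover have "T \<subseteq> Q"
  proof
    fix u assume "u \<in> T"
    then have "(\<Sum>t\<in>T. (if t = u then 1 else 0) * t) = u"
      using T by (simp add: if_distrib[of "\<lambda>c. c * _"] cong: if_cong)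
    then show "u \<in> Q"
      using is_subringD(1,2)[OF A] by (auto simp: Q_def intro!: exI[of _ "\<lambda>t. if t = u then 1 else 0"])
  qed
  ultimately show ?thesis using ideal_gen_minimal s unfolding Q_def by blast
qed

lemma ideal_in_power:
  assumes "ideal_in B I" "is_subring B" "x \<in> I" "n > 0"
  shows "x ^ n \<in> I"
proof -
  have "x ^ (n - 1) * x \<in> I"
    using ideal_inD(1,4)[OF assms(1)] is_subringD(7)[OF assms(2)] assms(3) by blast
  then show ?thesis using assms(4) by (simp add: power_eq_if mult.commute)
qed

lemma ideal_in_power_minus_one:
  assumes I: "ideal_in B I" and B: "is_subring B" and x: "x \<in> B" "x - 1 \<in> I"
  shows "x ^ n - 1 \<in> I"
proof (induction n)
  case (Suc n)
  have "x * (x ^ n - 1) + (x - 1) \<in> I"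
    using ideal_inD[OF I] Suc x by blast
  then show ?case by (simp add: algebra_simps)
qed (simp add: ideal_inD(2)[OF I])

lemma is_subring_prod:
  assumes "is_subring B" "\<And>i. i \<in> S \<Longrightarrow> f i \<in> B"
  shows "prod f S \<in> B"
  using assms(2) is_subringD(1,4)[OF assms(1)]
  by (induction S rule: infinite_finite_induct) auto

section \<open>Linear algebra modulo a subspace\<close>

locale field_embedding =
  fixes \<kappa> :: "'k::field \<Rightarrow> 'l::field"
  assumes emb_one [simp]: "\<kappa> 1 = 1"
    and emb_add: "\<kappa> (a + b) = \<kappa> a + \<kappa> b"
    and emb_mult: "\<kappa> (a * b) = \<kappa> a * \<kappa> b"
begin

sublocale vs: vector_space "\<lambda>c z. \<kappa> c * z"
  by unfold_locales (simp_all add: algebra_simps emb_add emb_mult)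

lemma emb_zero [simp]: "\<kappa> 0 = 0"
  using emb_add[of 0 0] by (metis add_cancel_right_left add_0)

lemma emb_minus: "\<kappa> (- a) = - \<kappa> a"
  using emb_add[of a "- a"] by (simp add: eq_neg_iff_add_eq_0 add.commute)

lemma emb_diff: "\<kappa> (a - b) = \<kappa> a - \<kappa> b"
  using emb_add[of a "- b"] by (simp add: emb_minus)

lemma emb_eq_0_iff [simp]: "\<kappa> a = 0 \<longleftrightarrow> a = 0"
  using emb_mult[of a "inverse a"] by (cases "a = 0") auto

lemma emb_power: "\<kappa> (a ^ n) = \<kappa> a ^ n"
  by (induction n) (simp_all add: emb_mult)

lemma emb_inverse: "\<kappa> (inverse a) = inverse (\<kappa> a)"
proof (cases "a = 0")
  case False
  then have "\<kappa> a * \<kappa> (inverse a) = 1"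
    by (simp flip: emb_mult)
  then show ?thesis by (rule inverse_unique[symmetric])
qed simp

lemma emb_of_nat: "\<kappa> (of_nat n) = of_nat n"
  by (induction n) (simp_all add: emb_add)

lemma emb_CHAR: "CHAR('l) = CHAR('k)"
proof (rule CHAR_eqI)
  show "of_nat CHAR('k) = (0::'l)"
    using emb_of_nat[of "CHAR('k)"] by simp
next
  fix n assume "of_nat n = (0::'l)"
  then have "of_nat n = (0::'k)"
    using emb_of_nat[of n] by (metis emb_eq_0_iff)
  then show "CHAR('k) dvd n" by (simp add: of_nat_eq_0_iff_char_dvd)
qed

definition lc :: "'k list \<Rightarrow> 'l list \<Rightarrow> 'l" where
  "lc cs b = (\<Sum>i<length b. \<kappa> (cs ! i) * b ! i)"

text \<open>Quotient spaces are never formed. Independence and spanning are stated modulo a subspace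
  \<open>J\<close> of the field, so that one list of elements can be tested against the ideals of
  several rings.\<close>

definition indep_mod :: "'l set \<Rightarrow> 'l list \<Rightarrow> bool" where
  "indep_mod J b \<longleftrightarrow> (\<forall>cs. length cs = length b \<and> lc cs b \<in> J \<longrightarrow> (\<forall>i<length b. cs ! i = 0))"

definition spans_mod :: "'l set \<Rightarrow> 'l set \<Rightarrow> 'l list \<Rightarrow> bool" where
  "spans_mod R J b \<longleftrightarrow> (\<forall>s\<in>R. \<exists>cs. length cs = length b \<and> s - lc cs b \<in> J)"

definition basis_mod :: "'l set \<Rightarrow> 'l set \<Rightarrow> 'l list \<Rightarrow> bool" where
  "basis_mod R J b \<longleftrightarrow> set b \<subseteq> R \<and> indep_mod J b \<and> spans_mod R J b"

lemma lc_closed: "vs.subspace V \<Longrightarrow> set b \<subseteq> V \<Longrightarrow> lc cs b \<in> V"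
  unfolding lc_def by (intro vs.subspace_sum vs.subspace_scale) auto

lemma lc_in_span: "lc cs b \<in> vs.span (set b)"
  by (rule lc_closed) (auto simp: vs.span_superset)

lemma lc_diff:
  "length as = length b \<Longrightarrow> length cs = length b \<Longrightarrow>
     lc as b - lc cs b = lc (map2 (-) as cs) b"
  by (simp add: lc_def sum_subtractf emb_diff left_diff_distrib)

lemma lc_add:
  "length as = length b \<Longrightarrow> length cs = length b \<Longrightarrow>
     lc as b + lc cs b = lc (map2 (+) as cs) b"
  by (simp add: lc_def sum.distrib emb_add distrib_right)

lemma lc_scale: "length cs = length b \<Longrightarrow> \<kappa> c * lc cs b = lc (map ((*) c) cs) b"
  by (simp add: lc_def sum_distrib_left emb_mult mult_ac)

lemma lc_Cons [simp]: "lc (c # cs) (x # b) = \<kappa> c * x + lc cs b"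
  by (simp add: lc_def sum.lessThan_Suc_shift del: sum.lessThan_Suc)

lemma lc_Nil [simp]: "lc cs [] = 0"
  by (simp add: lc_def)

lemma lc_append: "length as = length b \<Longrightarrow> lc (as @ cs) (b @ b') = lc as b + lc cs b'"
  by (induction as b rule: list_induct2) (auto simp: add_ac)

lemma lc_snoc: "length cs = length b \<Longrightarrow> lc (cs @ [c]) (b @ [x]) = lc cs b + \<kappa> c * x"
  by (subst lc_append) auto

lemma lc_replicate_0: "lc (replicate (length b) 0) b = 0"
  by (simp add: lc_def)

lemma lc_unit: "i < length b \<Longrightarrow> lc ((replicate (length b) 0)[i := 1]) b = b ! i"
proof -
  assume i: "i < length b"
  have "lc ((replicate (length b) 0)[i := 1]) b = (\<Sum>j<length b. if j = i then b ! j else 0)"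
    unfolding lc_def by (rule sum.cong) (auto simp: nth_list_update i)
  then show ?thesis using i by simp
qed

lemma span_set_eq_lc: "vs.span (set b) = {lc cs b | cs. length cs = length b}"
proof (intro equalityI subsetI)
  fix v assume "v \<in> vs.span (set b)"
  then show "v \<in> {lc cs b | cs. length cs = length b}"
  proof (induction rule: vs.span_induct_alt)
    case base
    then show ?case using lc_replicate_0[of b] length_replicate by (metis (mono_tags, lifting) mem_Collect_eq)
  next
    case (step c x y)
    then obtain cs where cs: "length cs = length b" "y = lc cs b" by auto
    obtain i where i: "i < length b" "x = b ! i" using step by (metis in_set_conv_nth)
    have "\<kappa> c * x + y = lc (map2 (+) (map ((*) c) ((replicate (length b) 0)[i := 1])) cs) b"
      using cs i by (simp add: lc_unit flip: lc_add lc_scale)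
    then show ?case using cs by (auto intro!: exI)
  qed
qed (auto simp: lc_in_span)

text \<open>Replace every member of \<open>c\<close> by a representative in the span of
  \<open>S\<close>. A linear relation between the representatives is a relation between the members
  of \<open>c\<close> modulo \<open>J\<close>, so the representatives are independent and the
  exchange bound applies.\<close>

lemma indep_mod_bound:
  assumes c: "indep_mod J c" and J: "vs.subspace J" and S: "finite S"
    and sp: "\<And>x. x \<in> set c \<Longrightarrow> \<exists>v\<in>vs.span S. x - v \<in> J"
  shows "length c \<le> card S"
proof -
  have "\<exists>v. \<forall>x\<in>set c. v x \<in> vs.span S \<and> x - v x \<in> J"
    using sp by metis
  then obtain f where f: "\<And>x. x \<in> set c \<Longrightarrow> f x \<in> vs.span S" "\<And>x. x \<in> set c \<Longrightarrow> x - f x \<in> J"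
    by metis
  define n where "n = length c"
  have key: "\<forall>i<n. u i = 0" if "(\<Sum>i<n. \<kappa> (u i) * f (c ! i)) \<in> J" for u
  proof -
    have "(\<Sum>i<n. \<kappa> (u i) * (c ! i - f (c ! i))) \<in> J"
      by (intro vs.subspace_sum[OF J] vs.subspace_scale[OF J] f) (auto simp: n_def)
    then have "(\<Sum>i<n. \<kappa> (u i) * (c ! i - f (c ! i))) + (\<Sum>i<n. \<kappa> (u i) * f (c ! i)) \<in> J"
      using that vs.subspace_add[OF J] by blast
    then have "lc (map u [0..<n]) c \<in> J"
      by (simp add: lc_def n_def flip: sum.distrib distrib_left)
    then show ?thesis using c unfolding indep_mod_def
      by (metis diff_zero length_map length_upt n_def nth_map nth_upt add_0)
  qed
  define g where "g i = f (c ! i)" for i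
  have z: "0 \<in> J" using J by (rule vs.subspace_0)
  \<comment> \<open>Independence in the library concerns a set, so equal representatives must be
    excluded: they would satisfy a relation with coefficients 1 and -1.\<close>
  have inj: "inj_on g {..<n}"
  proof (rule inj_onI, rule ccontr)
    fix i j assume ij: "i \<in> {..<n}" "j \<in> {..<n}" "g i = g j" "i \<noteq> j"
    define u where "u k = (if k = i then 1 else if k = j then - 1 else (0::'k))" for k
    have "(\<Sum>k<n. \<kappa> (u k) * g k) = (\<Sum>k\<in>{i,j}. \<kappa> (u k) * g k)"
      using ij by (intro sum.mono_neutral_right) (auto simp: u_def)
    also have "\<dots> = 0" using ij by (simp add: u_def emb_minus)
    finally have "u i = 0" using key[of u] z ij by (simp add: g_def)
    then show False by (simp add: u_def)
  qed
  have "vs.independent (g ` {..<n})"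
  proof (rule vs.independent_if_scalars_zero)
    fix h x assume h: "(\<Sum>x\<in>g ` {..<n}. \<kappa> (h x) * x) = 0" and x: "x \<in> g ` {..<n}"
    have "(\<Sum>i<n. \<kappa> (h (g i)) * g i) = 0"
      using h by (simp add: sum.reindex[OF inj])
    then have "\<forall>i<n. h (g i) = 0" using key[of "\<lambda>i. h (g i)"] z by (simp add: g_def)
    then show "h x = 0" using x by auto
  qed simp
  moreover have "g ` {..<n} \<subseteq> vs.span S" using f by (auto simp: g_def n_def)
  ultimately have "card (g ` {..<n}) \<le> card S"
    using vs.independent_span_bound[OF S] by blast
  then show ?thesis using inj by (simp add: card_image n_def)
qed

lemma indep_mod_length_le:
  assumes "indep_mod J c" "vs.subspace J" "set c \<subseteq> R" "spans_mod R J b"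
  shows "length c \<le> length b"
proof -
  have "length c \<le> card (set b)"
    using assms by (intro indep_mod_bound[of J c "set b"])
      (auto simp: spans_mod_def span_set_eq_lc, blast)
  then show ?thesis using card_length le_trans by blast
qed

lemma basis_mod_length_eq:
  "basis_mod R J b \<Longrightarrow> basis_mod R J c \<Longrightarrow> vs.subspace J \<Longrightarrow> length b = length c"
  unfolding basis_mod_def using indep_mod_length_le by (metis antisym)

text \<open>Take an extension of maximal length; lengths are bounded by that of \<open>b0\<close>.
  Appending a further \<open>s\<close> from \<open>G\<close> must create a relation, its coefficient
  at \<open>s\<close> is nonzero because \<open>c @ b\<close> is independent, and the relation can
  be solved for \<open>s\<close>.\<close>

lemma indep_mod_extend:
  assumes R: "spans_mod R J b0" and J: "vs.subspace J"
    and c: "indep_mod J c" "set c \<subseteq> R" and G: "G \<subseteq> R"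
  shows "\<exists>b. set b \<subseteq> G \<and> indep_mod J (c @ b) \<and> spans_mod G J (c @ b)"
proof -
  define P where "P n \<longleftrightarrow> (\<exists>b. length b = n \<and> set b \<subseteq> G \<and> indep_mod J (c @ b))" for n
  have P0: "P 0" using c by (simp add: P_def)
  have bd: "n \<le> length b0" if P: "P n" for n
  proof -
    from P[unfolded P_def] obtain b where "length b = n" "set b \<subseteq> G" "indep_mod J (c @ b)" by blast
    then have "length (c @ b) \<le> length b0"
      using indep_mod_length_le[OF _ J _ R, of "c @ b"] G c by auto
    then show ?thesis using \<open>length b = n\<close> by simp
  qed
  define n where "n = (GREATEST n. P n)"
  have n: "P n" "P m \<Longrightarrow> m \<le> n" for m
    unfolding n_def using GreatestI_nat[of P, OF P0 bd] Greatest_le_nat[of P, OF _ bd] by auto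
  from n(1) obtain b where b: "length b = n" "set b \<subseteq> G" "indep_mod J (c @ b)"
    unfolding P_def by blast
  have "spans_mod G J (c @ b)"
    unfolding spans_mod_def
  proof
    fix s assume s: "s \<in> G"
    have "\<not> indep_mod J ((c @ b) @ [s])"
    proof
      assume "indep_mod J ((c @ b) @ [s])"
      then have "P (Suc n)" using b s unfolding P_def by (intro exI[of _ "b @ [s]"]) auto
      then show False using n(2) by fastforce
    qed
    then obtain ds where ds: "length ds = Suc (length (c @ b))" "lc ds ((c @ b) @ [s]) \<in> J"
       "\<exists>i<Suc (length (c @ b)). ds ! i \<noteq> 0"
      unfolding indep_mod_def by auto
    obtain cs d where cd: "ds = cs @ [d]" "length cs = length (c @ b)"
      using ds(1) by (metis length_Suc_conv_rev)
    have l: "lc cs (c @ b) + \<kappa> d * s \<in> J" using ds(2) cd by (simp add: lc_snoc del: append_assoc)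
    have d: "d \<noteq> 0"
    proof
      assume "d = 0"
      then have "\<forall>i<length (c @ b). cs ! i = 0"
        using b(3) l cd by (simp add: indep_mod_def)
      then show False using ds(3) cd \<open>d = 0\<close> by (auto simp: nth_append less_Suc_eq)
    qed
    have "\<kappa> (inverse d) * (lc cs (c @ b) + \<kappa> d * s) \<in> J"
      using J l by (rule vs.subspace_scale)
    moreover have "\<kappa> (inverse d) * (lc cs (c @ b) + \<kappa> d * s) =
        s - lc (map ((*) (- inverse d)) cs) (c @ b)"
      using d cd by (simp add: emb_minus emb_inverse distrib_left flip: lc_scale)
    ultimately show "\<exists>cs. length cs = length (c @ b) \<and> s - lc cs (c @ b) \<in> J"
      using cd by (metis length_map)
  qed
  then show ?thesis using b by blast
qed

lemma spans_mod_trans: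
  assumes J: "vs.subspace J" and G: "spans_mod G J b"
    and R: "\<And>s. s \<in> R \<Longrightarrow> \<exists>v\<in>vs.span G. s - v \<in> J"
  shows "spans_mod R J b"
proof -
  define V where "V = {v. \<exists>cs. length cs = length b \<and> v - lc cs b \<in> J}"
  have "vs.subspace V"
  proof (rule vs.subspaceI)
    have "length (replicate (length b) (0::'k)) = length b \<and> 0 - lc (replicate (length b) 0) b \<in> J"
      using lc_replicate_0[of b] vs.subspace_0[OF J] by simp
    then show "0 \<in> V" unfolding V_def by blast
  next
    fix v w assume "v \<in> V" "w \<in> V"
    then obtain as cs
      where *: "v - lc as b \<in> J" "length as = length b" "w - lc cs b \<in> J" "length cs = length b"
      by (auto simp: V_def)
    then have "v + w - lc (map2 (+) as cs) b \<in> J"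
      using vs.subspace_add[OF J, of "v - lc as b" "w - lc cs b"]
      by (simp add: algebra_simps flip: lc_add)
    then show "v + w \<in> V" unfolding V_def using * by (auto intro!: exI[of _ "map2 (+) as cs"])
  next
    fix c v assume "v \<in> V"
    then obtain cs where *: "v - lc cs b \<in> J" "length cs = length b"
      by (auto simp: V_def)
    then have "\<kappa> c * v - lc (map ((*) c) cs) b \<in> J"
      using vs.subspace_scale[OF J, of "v - lc cs b" c]
      by (simp add: algebra_simps flip: lc_scale)
    then show "\<kappa> c * v \<in> V" unfolding V_def using * by (auto intro!: exI[of _ "map ((*) c) cs"])
  qed
  moreover have "G \<subseteq> V"
    using G by (auto simp: spans_mod_def V_def)
  ultimately have sp: "vs.span G \<subseteq> V"
    by (rule vs.span_minimal[rotated])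
  show ?thesis unfolding spans_mod_def
  proof
    fix s assume "s \<in> R"
    then obtain v cs where "s - v \<in> J" "length cs = length b" "v - lc cs b \<in> J"
      using R sp unfolding V_def by blast
    then show "\<exists>cs. length cs = length b \<and> s - lc cs b \<in> J"
      using vs.subspace_add[OF J, of "s - v" "v - lc cs b"] by auto
  qed
qed

lemma spans_mod_iff:
  "vs.subspace J \<Longrightarrow> spans_mod R J b \<longleftrightarrow> (\<forall>s\<in>R. \<exists>v\<in>vs.span (set b). s - v \<in> J)"
  by (auto simp: spans_mod_def span_set_eq_lc) blast

text \<open>Hilbert charts are defined by unique coordinates. Subtracting two coordinate vectors of
  one element shows that independence gives uniqueness, and uniqueness for the element 0 gives
  independence back.\<close>

lemma basis_mod_iff:
  assumes J: "vs.subspace J" and R: "vs.subspace R" and "set b \<subseteq> R"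
  shows "basis_mod R J b \<longleftrightarrow> (\<forall>s\<in>R. \<exists>!cs. length cs = length b \<and> s - lc cs b \<in> J)"
proof
  assume B: "basis_mod R J b"
  show "\<forall>s\<in>R. \<exists>!cs. length cs = length b \<and> s - lc cs b \<in> J"
  proof (intro ballI ex_ex1I)
    fix s assume "s \<in> R"
    then show "\<exists>cs. length cs = length b \<and> s - lc cs b \<in> J"
      using B by (auto simp: basis_mod_def spans_mod_def)
  next
    fix s as cs assume a: "length as = length b \<and> s - lc as b \<in> J" "length cs = length b \<and> s - lc cs b \<in> J"
    have "lc (map2 (-) as cs) b \<in> J"
      using vs.subspace_diff[OF J, of "s - lc cs b" "s - lc as b"] a by (simp add: lc_diff[symmetric])
    then have "\<forall>i<length b. map2 (-) as cs ! i = 0"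
      using B a by (simp add: basis_mod_def indep_mod_def)
    then show "as = cs" using a by (auto intro!: nth_equalityI)
  qed
next
  assume u: "\<forall>s\<in>R. \<exists>!cs. length cs = length b \<and> s - lc cs b \<in> J"
  have "indep_mod J b" unfolding indep_mod_def
  proof (intro allI impI)
    fix cs i assume cs: "length cs = length b \<and> lc cs b \<in> J" and i: "i < length b"
    have "0 \<in> R" using R by (rule vs.subspace_0)
    moreover have "0 - lc cs b \<in> J" using cs vs.subspace_neg[OF J] by simp
    moreover have "0 - lc (replicate (length b) 0) b \<in> J" by (simp add: lc_replicate_0 vs.subspace_0[OF J])
    ultimately have "cs = replicate (length b) 0" using u cs by (metis length_replicate)
    then show "cs ! i = 0" using i by simp
  qed
  then show "basis_mod R J b" using u assms by (auto simp: basis_mod_def spans_mod_def)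
qed

text \<open>This excludes the empty subscheme from every chart with a nonempty list
  \<open>b\<close>: its ideal would contain all of \<open>b\<close>, and a unit vector would be a
  relation.\<close>

lemma unit_ideal_not_indep_mod:
  assumes "indep_mod I b" "set b \<subseteq> I" shows "b = []"
proof (rule ccontr)
  assume b: "b \<noteq> []"
  have *: "lc ((replicate (length b) 0)[0 := 1]) b \<in> I"
    using assms(2) b nth_mem[of 0 b] by (auto simp: lc_unit)
  show False
    using assms(1)[unfolded indep_mod_def, rule_format, OF conjI[OF _ *], of 0] b by simp
qed

lemma span_mod_trans:
  assumes J: "vs.subspace J" and S: "\<And>x. x \<in> S \<Longrightarrow> \<exists>w\<in>vs.span G. x - w \<in> J" and v: "v \<in> vs.span S"
  shows "\<exists>w\<in>vs.span G. v - w \<in> J"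
proof -
  define V where "V = {v. \<exists>w\<in>vs.span G. v - w \<in> J}"
  have "vs.subspace V"
  proof (rule vs.subspaceI)
    show "0 \<in> V" unfolding V_def using vs.subspace_0[OF J] vs.span_zero[of G] by force
  next
    fix a b assume "a \<in> V" "b \<in> V"
    then obtain c d where cd: "c \<in> vs.span G" "a - c \<in> J" "d \<in> vs.span G" "b - d \<in> J" by (auto simp: V_def)
    then have "(a - c) + (b - d) \<in> J" using vs.subspace_add[OF J] by blast
    then have "a + b - (c + d) \<in> J" by (simp add: algebra_simps)
    then show "a + b \<in> V" unfolding V_def using vs.span_add[OF cd(1,3)] by blast
  next
    fix k a assume "a \<in> V"
    then obtain c where c: "c \<in> vs.span G" "a - c \<in> J" by (auto simp: V_def)
    then have "\<kappa> k * (a - c) \<in> J" using vs.subspace_scale[OF J] by blast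
    then have "\<kappa> k * a - \<kappa> k * c \<in> J" by (simp add: algebra_simps)
    then show "\<kappa> k * a \<in> V" unfolding V_def using vs.span_scale[OF c(1)] by blast
  qed
  moreover have "S \<subseteq> V" using S by (auto simp: V_def)
  ultimately show ?thesis using vs.span_minimal v unfolding V_def by blast
qed

lemma span_mult:
  assumes "v \<in> vs.span S" "\<And>x. x \<in> S \<Longrightarrow> y * x \<in> vs.span G"
  shows "y * v \<in> vs.span G"
proof -
  have "vs.subspace {v. y * v \<in> vs.span G}"
  proof (rule vs.subspaceI)
    show "0 \<in> {v. y * v \<in> vs.span G}" by (simp add: vs.span_zero)
    show "a + b \<in> {v. y * v \<in> vs.span G}" if "a \<in> {v. y * v \<in> vs.span G}" "b \<in> {v. y * v \<in> vs.span G}" for a b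
      using that by (simp add: distrib_left vs.span_add)
    show "\<kappa> c * a \<in> {v. y * v \<in> vs.span G}" if "a \<in> {v. y * v \<in> vs.span G}" for a c
      using that vs.span_scale[of "y * a" G c] by (simp add: mult.left_commute)
  qed
  then have "vs.span S \<subseteq> {v. y * v \<in> vs.span G}" using assms(2) by (intro vs.span_minimal) auto
  then show ?thesis using assms(1) by blast
qed

section \<open>Spanning by monomials with bounded exponents\<close>

definition monomials :: "('t \<Rightarrow> 'l) \<Rightarrow> 't set \<Rightarrow> nat \<Rightarrow> 'l set" where
  "monomials y S q = (\<lambda>a. \<Prod>t\<in>S. y t ^ a t) ` (PiE S (\<lambda>_. {..<q}))"

text \<open>
  The variables are adjoined one at a time: modulo the remaining variables, \<open>s\<close> can be expanded
  repeatedly in powers of \<open>y t\<close>, and the expansion stops since \<open>y t ^ q\<close> lies in \<open>N\<close>.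
\<close>

lemma monomials_span_mod:
  fixes y :: "'t \<Rightarrow> 'l"
  assumes R: "is_subring R" and \<kappa>R: "\<And>c. \<kappa> c \<in> R" and N: "ideal_in R N"
    and T: "finite T" and y: "\<And>t. t \<in> T \<Longrightarrow> y t \<in> R" "\<And>t. t \<in> T \<Longrightarrow> y t ^ q \<in> N"
    and gen: "\<And>s. s \<in> R \<Longrightarrow> \<exists>c r. (\<forall>t\<in>T. r t \<in> R) \<and> s - \<kappa> c - (\<Sum>t\<in>T. r t * y t) \<in> N"
    and s: "s \<in> R"
  shows "\<exists>v\<in>vs.span (monomials y T q). s - v \<in> N"
proof -
  note R' = is_subringD[OF R] and N' = ideal_inD[OF N]
  \<comment> \<open>\<open>K S\<close> is the ideal generated by \<open>N\<close> and the variables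
    outside \<open>S\<close>. It shrinks from the ideal of all variables, for \<open>S = {}\<close>,
    where the hypothesis \<open>gen\<close> starts the induction, to \<open>N\<close> itself, for
    \<open>S = T\<close>.\<close>
  define K where "K S = {s. \<exists>r n. (\<forall>t\<in>T. r t \<in> R) \<and> n \<in> N \<and> s = (\<Sum>t\<in>T - S. r t * y t) + n}" for S
  have K_N: "n \<in> K S" if "n \<in> N" for n S
    unfolding K_def using that R'(2) by (auto intro!: exI[of _ "\<lambda>_. 0"] exI[of _ n])
  have K_add: "a + b \<in> K S" if ab: "a \<in> K S" "b \<in> K S" for a b S
  proof -
    obtain r n where 1: "\<forall>t\<in>T. r t \<in> R" "n \<in> N" "a = (\<Sum>t\<in>T - S. r t * y t) + n"
      using ab(1) by (auto simp: K_def)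
    obtain r' n' where 2: "\<forall>t\<in>T. r' t \<in> R" "n' \<in> N" "b = (\<Sum>t\<in>T - S. r' t * y t) + n'"
      using ab(2) by (auto simp: K_def)
    have "a + b = (\<Sum>t\<in>T - S. (r t + r' t) * y t) + (n + n')"
      using 1 2 by (simp add: distrib_right sum.distrib)
    then show ?thesis unfolding K_def using 1 2 R'(6) N'(3)
      by (auto intro!: exI[of _ "\<lambda>t. r t + r' t"] exI[of _ "n + n'"])
  qed
  have K_mult: "c * a \<in> K S" if ca: "c \<in> R" "a \<in> K S" for a c S
  proof -
    obtain r n where 1: "\<forall>t\<in>T. r t \<in> R" "n \<in> N" "a = (\<Sum>t\<in>T - S. r t * y t) + n"
      using ca(2) by (auto simp: K_def)
    have "c * a = (\<Sum>t\<in>T - S. (c * r t) * y t) + c * n"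
      using 1 by (simp add: distrib_left sum_distrib_left mult.assoc)
    then show ?thesis unfolding K_def using 1 ca(1) R'(4) N'(4)
      by (auto intro!: exI[of _ "\<lambda>t. c * r t"] exI[of _ "c * n"])
  qed
  have "\<forall>s\<in>R. \<exists>v\<in>vs.span (monomials y S q). s - v \<in> K S" if "finite S" "S \<subseteq> T" for S
    using that
  proof (induction S rule: finite_induct)
    case empty
    show ?case
    proof
      fix s assume "s \<in> R"
      then obtain c r where cr: "\<forall>t\<in>T. r t \<in> R" "s - \<kappa> c - (\<Sum>t\<in>T. r t * y t) \<in> N" using gen by blast
      have "s - \<kappa> c = (\<Sum>t\<in>T - {}. r t * y t) + (s - \<kappa> c - (\<Sum>t\<in>T. r t * y t))" by simp
      then have "s - \<kappa> c \<in> K {}" unfolding K_def using cr by blast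
      moreover have "\<kappa> c * 1 \<in> vs.span (monomials y {} q)"
        by (intro vs.span_scale vs.span_base) (simp add: monomials_def)
      ultimately show "\<exists>v\<in>vs.span (monomials y {} q). s - v \<in> K {}" by force
    qed
  next
    case (insert t S)
    then have t: "t \<in> T" "y t \<in> R" "t \<notin> S" "finite S" using y by auto
    have IH: "\<forall>s\<in>R. \<exists>v\<in>vs.span (monomials y S q). s - v \<in> K S" using insert by auto
    show ?case
    proof
      fix s assume s: "s \<in> R"
      \<comment> \<open>This is the expansion in powers of \<open>y t\<close> up to order
        \<open>i\<close>. The next coefficient comes from the induction hypothesis for
        \<open>S\<close> applied to the remainder \<open>r\<close>; what is left over is a multiple
        of \<open>y t\<close> modulo the smaller ideal.\<close>
      have "\<exists>v\<in>vs.span (monomials y (insert t S) q). \<exists>r\<in>R. s - v - y t ^ i * r \<in> K (insert t S)"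
        if "i \<le> q" for i using that
      proof (induction i)
        case 0
        show ?case using s vs.span_zero K_N[OF N'(2)] by (intro bexI[of _ 0] bexI[of _ s]) auto
      next
        case (Suc i)
        then obtain v r where v: "v \<in> vs.span (monomials y (insert t S) q)" and r: "r \<in> R"
          and vr: "s - v - y t ^ i * r \<in> K (insert t S)" by auto
        obtain v' where v': "v' \<in> vs.span (monomials y S q)" "r - v' \<in> K S" using IH r by blast
        then obtain r' n where r': "\<forall>t\<in>T. r' t \<in> R" "n \<in> N" "r - v' = (\<Sum>t\<in>T - S. r' t * y t) + n"
          by (auto simp: K_def)
        have "(\<Sum>u\<in>T - S. r' u * y u) = r' t * y t + (\<Sum>u\<in>T - insert t S. r' u * y u)"
          using sum.remove[of "T - S" t "\<lambda>u. r' u * y u"] T t(1,3)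
          unfolding Diff_insert[symmetric] by blast
        then have k: "r - v' - r' t * y t = (\<Sum>t\<in>T - insert t S. r' t * y t) + n"
          using r'(3) by simp
        then have "r - v' - r' t * y t \<in> K (insert t S)"
          unfolding K_def using r' by blast
        then have "y t ^ i * (r - v' - r' t * y t) \<in> K (insert t S)"
          using K_mult R'(7)[OF t(2)] by blast
        then have "(s - v - y t ^ i * r) + y t ^ i * (r - v' - r' t * y t) \<in> K (insert t S)"
          using K_add vr by blast
        then have "s - (v + y t ^ i * v') - y t ^ Suc i * r' t \<in> K (insert t S)"
          by (simp add: algebra_simps)
        moreover have "y t ^ i * v' \<in> vs.span (monomials y (insert t S) q)"
          using v'(1)
        proof (rule span_mult)
          fix m assume "m \<in> monomials y S q"
          then obtain a where a: "a \<in> PiE S (\<lambda>_. {..<q})" "m = (\<Prod>t\<in>S. y t ^ a t)"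
            by (auto simp: monomials_def)
          have "(\<Prod>u\<in>insert t S. y u ^ (a(t := i)) u) = y t ^ i * m"
          proof -
            have "(\<Prod>u\<in>S. y u ^ (a(t := i)) u) = m"
              unfolding a(2) using t(3) by (intro prod.cong) auto
            then show ?thesis using t(3,4) by simp
          qed
          moreover have "a(t := i) \<in> PiE (insert t S) (\<lambda>_. {..<q})"
            using a(1) Suc.prems by (intro PiE_fun_upd) auto
          ultimately have "y t ^ i * m \<in> monomials y (insert t S) q"
            unfolding monomials_def by (intro image_eqI[where x = "a(t := i)"]) (rule sym)
          then show "y t ^ i * m \<in> vs.span (monomials y (insert t S) q)" by (rule vs.span_base)
        qed
        then have "v + y t ^ i * v' \<in> vs.span (monomials y (insert t S) q)"
          using v by (intro vs.span_add)
        ultimately show ?case using r' t(1) by blast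
      qed
      then obtain v r where v: "v \<in> vs.span (monomials y (insert t S) q)" and r: "r \<in> R"
          and vr: "s - v - y t ^ q * r \<in> K (insert t S)" by blast
      have "y t ^ q * r \<in> K (insert t S)" using K_N N'(5)[OF r y(2)[OF t(1)]] by blast
      then have "(s - v - y t ^ q * r) + y t ^ q * r \<in> K (insert t S)" using K_add vr by blast
      then show "\<exists>v\<in>vs.span (monomials y (insert t S) q). s - v \<in> K (insert t S)" using v by auto
    qed
  qed
  from this[OF T order_refl] obtain v where v: "v \<in> vs.span (monomials y T q)" "s - v \<in> K T" using s by blast
  then have "s - v \<in> N" by (auto simp: K_def)
  then show ?thesis using v by blast
qed

lemma card_monomials: "finite T \<Longrightarrow> card (monomials y T q) \<le> q ^ card T"
  unfolding monomials_def using card_image_le[of "PiE T (\<lambda>_. {..<q})"]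
  by (simp add: finite_PiE card_PiE)

lemma finite_monomials: "finite T \<Longrightarrow> finite (monomials y T q)"
  unfolding monomials_def by (simp add: finite_PiE)

end

section \<open>Isomorphisms and affine open sets\<close>

lemma ring_hom_Units:
  assumes "h \<in> ring_hom R S" "f \<in> Units R"
  shows "h f \<in> Units S"
proof -
  obtain g where g: "f \<in> carrier R" "g \<in> carrier R" "g \<otimes>\<^bsub>R\<^esub> f = \<one>\<^bsub>R\<^esub>" "f \<otimes>\<^bsub>R\<^esub> g = \<one>\<^bsub>R\<^esub>"
    using assms(2) by (auto simp: Units_def)
  then have "h f \<in> carrier S" "h g \<in> carrier S" "h g \<otimes>\<^bsub>S\<^esub> h f = \<one>\<^bsub>S\<^esub>" "h f \<otimes>\<^bsub>S\<^esub> h g = \<one>\<^bsub>S\<^esub>"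
    using assms(1) by (auto simp: ring_hom_def Pi_def) (metis, metis)
  then show ?thesis by (auto simp: Units_def)
qed

lemma primeideal_subset: "primeideal P R \<Longrightarrow> P \<subseteq> carrier R"
  using primeideal.axioms(1) ideal.axioms(1) additive_subgroup.a_subset by blast

text \<open>The image under an isomorphism is the preimage under its inverse, and preimages of prime
  ideals are prime.\<close>

lemma primeideal_iso_image:
  assumes h: "h \<in> ring_hom R S" and g: "g \<in> ring_hom S R" and R: "cring R" and S: "cring S"
    and gh: "\<And>s. s \<in> carrier R \<Longrightarrow> g (h s) = s" and hg: "\<And>s. s \<in> carrier S \<Longrightarrow> h (g s) = s"
    and P: "primeideal P R"
  shows "primeideal (h ` P) S"
proof -
  interpret ring_hom_ring S R g
    using g cring.axioms(1)[OF R] cring.axioms(1)[OF S] by (intro ring_hom_ringI2)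
  have "h ` P = {s \<in> carrier S. g s \<in> P}"
  proof (intro equalityI subsetI)
    fix t assume "t \<in> h ` P"
    then obtain s where s: "s \<in> P" "t = h s" by blast
    then have "s \<in> carrier R" using primeideal_subset[OF P] by blast
    then show "t \<in> {s \<in> carrier S. g s \<in> P}" using s gh ring_hom_closed[OF h] by simp
  next
    fix t assume "t \<in> {s \<in> carrier S. g s \<in> P}"
    then show "t \<in> h ` P" using hg by force
  qed
  then show ?thesis using primeideal_vimage[OF S P] by simp
qed

lemma affine_open_base:
  assumes "affine_open Y U" "openin (pts Y) V" "V \<subseteq> U" "x \<in> V"
  obtains f where "f \<in> carrier (sec Y U)" "x \<in> unit_locus Y U f" "unit_locus Y U f \<subseteq> V"
  using assms unfolding affine_open_def by blast

text \<open>Quasi-coherence is imposed on affine open sets only, so the levels can be compared only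
  if they have the same ones. The \<open>p\<close>-th power map between levels is not linear over
  the ground field, but \<open>affine_open\<close> refers only to points, rings and restrictions and
  is therefore invariant under isomorphisms of sheaves of rings.\<close>

lemma affine_open_transfer:
  assumes pts: "pts Y' = pts Y"
    and ring: "\<And>V. openin (pts Y) V \<Longrightarrow> cring (sec Y V)" "\<And>V. openin (pts Y) V \<Longrightarrow> cring (sec Y' V)"
    and iso: "\<And>V. openin (pts Y) V \<Longrightarrow> h V \<in> ring_iso (sec Y V) (sec Y' V)"
    and closed: "\<And>U V s. openin (pts Y) U \<Longrightarrow> openin (pts Y) V \<Longrightarrow> V \<subseteq> U \<Longrightarrow> s \<in> carrier (sec Y U) \<Longrightarrow>
      res Y U V s \<in> carrier (sec Y V)"
    and res: "\<And>U V s. openin (pts Y) U \<Longrightarrow> openin (pts Y) V \<Longrightarrow> V \<subseteq> U \<Longrightarrow> s \<in> carrier (sec Y U) \<Longrightarrow>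
      res Y' U V (h U s) = h V (res Y U V s)"
    and affine: "affine_open Y U"
  shows "affine_open Y' U"
proof -
  define g where "g V = inv_into (carrier (sec Y V)) (h V)" for V
  have g: "g V \<in> ring_iso (sec Y' V) (sec Y V)" if "openin (pts Y) V" for V
    unfolding g_def using ring_iso_set_sym[OF _ iso[OF that]] ring(1)[OF that] cring.axioms(1) by blast
  have hom: "h V \<in> ring_hom (sec Y V) (sec Y' V)" "g V \<in> ring_hom (sec Y' V) (sec Y V)"
    and bij: "bij_betw (h V) (carrier (sec Y V)) (carrier (sec Y' V))" if "openin (pts Y) V" for V
    using iso[OF that] g[OF that] by (auto simp: ring_iso_def)
  have gh: "g V (h V s) = s" if "openin (pts Y) V" "s \<in> carrier (sec Y V)" for V s
    unfolding g_def using bij[OF that(1)] that(2) by (simp add: bij_betw_inv_into_left)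
  have hg: "h V (g V s) = s" if "openin (pts Y) V" "s \<in> carrier (sec Y' V)" for V s
    unfolding g_def using bij[OF that(1)] that(2) by (simp add: bij_betw_inv_into_right)
  have U: "openin (pts Y) U" using affine by (simp add: affine_open_def)
  have hU: "h U s \<in> carrier (sec Y' U)" if "s \<in> carrier (sec Y U)" for s
    using ring_hom_closed[OF hom(1)[OF U] that] .
  have gU: "g U s \<in> carrier (sec Y U)" if "s \<in> carrier (sec Y' U)" for s
    using ring_hom_closed[OF hom(2)[OF U] that] .
  have units: "h V s \<in> Units (sec Y' V) \<longleftrightarrow> s \<in> Units (sec Y V)"
    if "openin (pts Y) V" "s \<in> carrier (sec Y V)" for V s
    using ring_hom_Units[OF hom(1)[OF that(1)]] ring_hom_Units[OF hom(2)[OF that(1)], of "h V s"] gh[OF that]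
    by auto
  have locus: "unit_locus Y' U (h U f) = unit_locus Y U f" if "f \<in> carrier (sec Y U)" for f
    unfolding unit_locus_def pts using units res[OF U _ _ that] closed[OF U _ _ that] by auto
  have point: "ideal_of_point Y' x U = h U ` ideal_of_point Y x U" for x
  proof (intro equalityI subsetI)
    fix f assume "f \<in> ideal_of_point Y' x U"
    then have f: "f \<in> carrier (sec Y' U)" "x \<notin> unit_locus Y' U f" by (auto simp: ideal_of_point_def)
    then have "g U f \<in> ideal_of_point Y x U"
      using locus[OF gU[OF f(1)]] hg[OF U f(1)] gU by (auto simp: ideal_of_point_def)
    then show "f \<in> h U ` ideal_of_point Y x U" using hg[OF U f(1)] by force
  qed (auto simp: ideal_of_point_def hU locus)
  have "bij_betw ((`) (h U)) {P. primeideal P (sec Y U)} {P. primeideal P (sec Y' U)}"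
  proof (rule bij_betw_byWitness[of _ "(`) (g U)"])
    have "g U ` h U ` P = P" if "primeideal P (sec Y U)" for P
      using gh[OF U] primeideal_subset[OF that] by (force simp: image_image image_iff)
    then show "\<forall>P\<in>{P. primeideal P (sec Y U)}. g U ` h U ` P = P" by blast
    have "h U ` g U ` P = P" if "primeideal P (sec Y' U)" for P
      using hg[OF U] primeideal_subset[OF that] by (force simp: image_image image_iff)
    then show "\<forall>P\<in>{P. primeideal P (sec Y' U)}. h U ` g U ` P = P" by blast
    show "(`) (h U) ` {P. primeideal P (sec Y U)} \<subseteq> {P. primeideal P (sec Y' U)}"
      using primeideal_iso_image[OF hom[OF U] ring[OF U] gh[OF U] hg[OF U]] by auto
    show "(`) (g U) ` {P. primeideal P (sec Y' U)} \<subseteq> {P. primeideal P (sec Y U)}"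
      using primeideal_iso_image[OF hom(2)[OF U] hom(1)[OF U] ring(2)[OF U] ring(1)[OF U] hg[OF U] gh[OF U]] by auto
  qed
  then have "bij_betw ((`) (h U) \<circ> (\<lambda>x. ideal_of_point Y x U)) U {P. primeideal P (sec Y' U)}"
    using affine by (intro bij_betw_trans) (auto simp: affine_open_def)
  moreover have "(`) (h U) \<circ> (\<lambda>x. ideal_of_point Y x U) = (\<lambda>x. ideal_of_point Y' x U)"
    by (auto simp: point)
  ultimately have "bij_betw (\<lambda>x. ideal_of_point Y' x U) U {P. primeideal P (sec Y' U)}" by simp
  moreover have "\<exists>f\<in>carrier (sec Y' U). x \<in> unit_locus Y' U f \<and> unit_locus Y' U f \<subseteq> V"
    if V: "openin (pts Y') V" "V \<subseteq> U" "x \<in> V" for V x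
  proof -
    obtain f where "f \<in> carrier (sec Y U)" "x \<in> unit_locus Y U f" "unit_locus Y U f \<subseteq> V"
      using affine_open_base[OF affine _ V(2,3)] V(1) by (auto simp: pts)
    then show ?thesis using locus hU by (intro bexI[of _ "h U f"]) auto
  qed
  moreover have "let D = unit_locus Y' U f; r = res Y' U D in
           r f \<in> Units (sec Y' D) \<and>
           (\<forall>s\<in>carrier (sec Y' U). r s = \<zero>\<^bsub>sec Y' D\<^esub> \<longrightarrow>
              (\<exists>n::nat. f [^]\<^bsub>sec Y' U\<^esub> n \<otimes>\<^bsub>sec Y' U\<^esub> s = \<zero>\<^bsub>sec Y' U\<^esub>)) \<and>
           (\<forall>t\<in>carrier (sec Y' D). \<exists>n::nat. \<exists>s\<in>carrier (sec Y' U).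
              r s = r f [^]\<^bsub>sec Y' D\<^esub> n \<otimes>\<^bsub>sec Y' D\<^esub> t)" if f': "f \<in> carrier (sec Y' U)" for f
  proof -
    define f0 where "f0 = g U f"
    have f0: "f0 \<in> carrier (sec Y U)" "f = h U f0" using f' gU hg[OF U] by (auto simp: f0_def)
    define D where "D = unit_locus Y U f0"
    have D': "unit_locus Y' U f = D" using locus f0 by (simp add: D_def)
    have D: "openin (pts Y) D" "D \<subseteq> U"
      unfolding D_def by (subst openin_subopen, auto simp: unit_locus_def)
    have aff: "res Y U D f0 \<in> Units (sec Y D)"
      "\<And>s. s \<in> carrier (sec Y U) \<Longrightarrow> res Y U D s = \<zero>\<^bsub>sec Y D\<^esub> \<Longrightarrow>
              \<exists>n::nat. f0 [^]\<^bsub>sec Y U\<^esub> n \<otimes>\<^bsub>sec Y U\<^esub> s = \<zero>\<^bsub>sec Y U\<^esub>"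
      "\<And>t. t \<in> carrier (sec Y D) \<Longrightarrow> \<exists>n::nat. \<exists>s\<in>carrier (sec Y U).
              res Y U D s = res Y U D f0 [^]\<^bsub>sec Y D\<^esub> n \<otimes>\<^bsub>sec Y D\<^esub> t"
      using affine f0(1) unfolding affine_open_def Let_def D_def by blast+
    interpret U: ring_hom_ring "sec Y U" "sec Y' U" "h U"
      using hom[OF U] ring[OF U] by (intro ring_hom_ringI2) (auto dest: cring.axioms(1))
    interpret D: ring_hom_ring "sec Y D" "sec Y' D" "h D"
      using hom[OF D(1)] ring[OF D(1)] by (intro ring_hom_ringI2) (auto dest: cring.axioms(1))
    have rf: "res Y U D f0 \<in> carrier (sec Y D)" by (rule closed[OF U D f0(1)])
    show ?thesis unfolding Let_def D'
    proof (intro conjI ballI impI)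
      show "res Y' U D f \<in> Units (sec Y' D)"
        using aff(1) units[OF D(1) rf] res[OF U D f0(1)] f0(2) by simp
    next
      fix s assume s: "s \<in> carrier (sec Y' U)" "res Y' U D s = \<zero>\<^bsub>sec Y' D\<^esub>"
      define s0 where "s0 = g U s"
      have s0: "s0 \<in> carrier (sec Y U)" "s = h U s0" using s gU hg[OF U] by (auto simp: s0_def)
      have "h D (res Y U D s0) = h D \<zero>\<^bsub>sec Y D\<^esub>" using res[OF U D s0(1)] s s0 by simp
      then have "res Y U D s0 = \<zero>\<^bsub>sec Y D\<^esub>"
        using inj_onD[OF bij_betw_imp_inj_on[OF bij[OF D(1)]]] closed[OF U D s0(1)] by blast
      then obtain n where "f0 [^]\<^bsub>sec Y U\<^esub> (n::nat) \<otimes>\<^bsub>sec Y U\<^esub> s0 = \<zero>\<^bsub>sec Y U\<^esub>"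
        using aff(2) s0 by blast
      then have "h U (f0 [^]\<^bsub>sec Y U\<^esub> (n::nat) \<otimes>\<^bsub>sec Y U\<^esub> s0) = \<zero>\<^bsub>sec Y' U\<^esub>" by simp
      then show "\<exists>n::nat. f [^]\<^bsub>sec Y' U\<^esub> n \<otimes>\<^bsub>sec Y' U\<^esub> s = \<zero>\<^bsub>sec Y' U\<^esub>"
        using f0 s0 by (auto simp: U.hom_nat_pow)
    next
      fix t assume t: "t \<in> carrier (sec Y' D)"
      define t0 where "t0 = g D t"
      have t0: "t0 \<in> carrier (sec Y D)" "t = h D t0"
        using t hg[OF D(1)] ring_hom_closed[OF hom(2)[OF D(1)]] by (auto simp: t0_def)
      obtain n s0 where s0: "s0 \<in> carrier (sec Y U)"
         "res Y U D s0 = res Y U D f0 [^]\<^bsub>sec Y D\<^esub> (n::nat) \<otimes>\<^bsub>sec Y D\<^esub> t0"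
        using aff(3)[OF t0(1)] by blast
      have "res Y' U D (h U s0) = res Y' U D f [^]\<^bsub>sec Y' D\<^esub> n \<otimes>\<^bsub>sec Y' D\<^esub> t"
        using s0 t0 f0 rf by (simp add: res[OF U D] D.hom_nat_pow)
      then show "\<exists>n::nat. \<exists>s\<in>carrier (sec Y' U). res Y' U D s = res Y' U D f [^]\<^bsub>sec Y' D\<^esub> n \<otimes>\<^bsub>sec Y' D\<^esub> t"
        using s0 hU by blast
    qed
  qed
  ultimately show ?thesis
    using U by (simp add: affine_open_def pts)
qed

section \<open>Rings of roots\<close>

locale frobenius_roots =
  fixes X :: "('x, 'a, 'k::alg_closed_field) kspace"
    and \<iota> :: "'x set \<Rightarrow> 'a \<Rightarrow> 'l::alg_closed_field"
    and p :: nat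
  assumes CHAR_k: "CHAR('k) = p"
    and CHAR_pos [simp]: "p > 0"
    and ringed: "ringed_kspace X"
    and closure: "function_field_closure X \<iota>"
    and nonempty: "topspace (pts X) \<noteq> {}"
begin

abbreviation opn :: "'x set \<Rightarrow> bool" where "opn U \<equiv> openin (pts X) U"

definition \<kappa> :: "'k \<Rightarrow> 'l" where "\<kappa> c = \<iota> (topspace (pts X)) (scal X c)"

text \<open>The sections of the sheaf of \<open>p ^ e\<close>-th roots, as a subset of the field.
  Restrictions to nonempty open sets become inclusions, and hence stalks become unions.\<close>

definition A :: "nat \<Rightarrow> 'x set \<Rightarrow> 'l set" where
  "A e U = {z. z ^ (p ^ e) \<in> \<iota> U ` carrier (sec X U)}"

definition stalk :: "nat \<Rightarrow> 'x \<Rightarrow> 'l set" where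
  "stalk e x = (\<Union>U\<in>{U. opn U \<and> x \<in> U}. A e U)"

lemma cring_sec: "opn U \<Longrightarrow> cring (sec X U)"
  using ringed by (simp add: ringed_kspace_def)

lemma res_hom: "opn U \<Longrightarrow> opn V \<Longrightarrow> V \<subseteq> U \<Longrightarrow> res X U V \<in> ring_hom (sec X U) (sec X V)"
  using ringed by (simp add: ringed_kspace_def)

lemma iota_hom: "opn U \<Longrightarrow> U \<noteq> {} \<Longrightarrow> \<iota> U \<in> ring_hom (sec X U) ring_of_type_algebra"
  using closure by (simp add: function_field_closure_def)

lemma iota_inj: "opn U \<Longrightarrow> U \<noteq> {} \<Longrightarrow> inj_on (\<iota> U) (carrier (sec X U))"
  using closure by (simp add: function_field_closure_def)

lemma iota_res:
  "opn U \<Longrightarrow> opn V \<Longrightarrow> V \<noteq> {} \<Longrightarrow> V \<subseteq> U \<Longrightarrow> s \<in> carrier (sec X U) \<Longrightarrow> \<iota> V (res X U V s) = \<iota> U s"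
  using closure by (simp add: function_field_closure_def)

lemma subring_iota:
  assumes U: "opn U" "U \<noteq> {}"
  shows "is_subring (\<iota> U ` carrier (sec X U))"
proof -
  interpret cring "sec X U" by (rule cring_sec[OF U(1)])
  interpret L: cring "ring_of_type_algebra :: 'l ring" by (rule cring_from_type_algebra)
  interpret ring_hom_cring "sec X U" "ring_of_type_algebra :: 'l ring" "\<iota> U"
    by unfold_locales (rule iota_hom[OF U])
  have minus: "\<ominus>\<^bsub>ring_of_type_algebra\<^esub> y = - y" for y :: 'l
    by (rule L.minus_equality) auto
  show ?thesis unfolding is_subring_def
  proof (intro conjI ballI)
    show "1 \<in> \<iota> U ` carrier (sec X U)" using hom_one by (metis image_eqI one_closed type_algebra_simps(2))
    fix x y assume "x \<in> \<iota> U ` carrier (sec X U)" "y \<in> \<iota> U ` carrier (sec X U)"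
    then obtain a b where ab: "a \<in> carrier (sec X U)" "b \<in> carrier (sec X U)" "x = \<iota> U a" "y = \<iota> U b" by auto
    then have "\<iota> U (a \<otimes>\<^bsub>sec X U\<^esub> b) = x * y" "\<iota> U (a \<oplus>\<^bsub>sec X U\<^esub> \<ominus>\<^bsub>sec X U\<^esub> b) = x - y"
      by (simp_all add: minus)
    then show "x - y \<in> \<iota> U ` carrier (sec X U)" "x * y \<in> \<iota> U ` carrier (sec X U)"
      using ab by (metis a_inv_closed add.m_closed image_eqI, metis m_closed image_eqI)
  qed
qed

lemma iota_mono:
  assumes "opn U" "opn V" "V \<noteq> {}" "V \<subseteq> U"
  shows "\<iota> U ` carrier (sec X U) \<subseteq> \<iota> V ` carrier (sec X V)"
proof
  fix z assume "z \<in> \<iota> U ` carrier (sec X U)"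
  then obtain s where "s \<in> carrier (sec X U)" "z = \<iota> U s" by auto
  then have "z = \<iota> V (res X U V s)" "res X U V s \<in> carrier (sec X V)"
    using assms iota_res ring_hom_closed[OF res_hom] by auto
  then show "z \<in> \<iota> V ` carrier (sec X V)" by blast
qed

sublocale field_embedding \<kappa>
proof
  have s: "scal X \<in> ring_hom ring_of_type_algebra (sec X (topspace (pts X)))"
    using ringed by (simp add: ringed_kspace_def)
  have i: "\<iota> (topspace (pts X)) \<in> ring_hom (sec X (topspace (pts X))) ring_of_type_algebra"
    using iota_hom nonempty by simp
  have k: "\<kappa> = \<iota> (topspace (pts X)) \<circ> scal X" by (auto simp: \<kappa>_def)
  have "\<kappa> \<in> ring_hom (ring_of_type_algebra :: 'k ring) (ring_of_type_algebra :: 'l ring)"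
    unfolding k by (rule ring_hom_trans[OF s i])
  then show "\<kappa> 1 = 1" "\<kappa> (a + b) = \<kappa> a + \<kappa> b" "\<kappa> (a * b) = \<kappa> a * \<kappa> b" for a b
    by (auto simp: ring_hom_def)
qed

lemma scal_closed: "scal X c \<in> carrier (sec X (topspace (pts X)))"
  using ringed ring_hom_closed[of "scal X" ring_of_type_algebra "sec X (topspace (pts X))" c]
  by (simp add: ringed_kspace_def)

lemma emb_in_iota: "opn U \<Longrightarrow> U \<noteq> {} \<Longrightarrow> \<kappa> c \<in> \<iota> U ` carrier (sec X U)"
  using iota_mono[of "topspace (pts X)" U] scal_closed openin_subset unfolding \<kappa>_def by blast

lemma prime_CHAR: "prime p"
  using prime_CHAR_semidom[where ?'a = 'k] CHAR_pos by (simp add: CHAR_k)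

lemma CHAR_l: "CHAR('l) = p"
  using emb_CHAR by (simp add: CHAR_k)

lemma frob_add: "(x + y :: 'l) ^ (p ^ e) = x ^ (p ^ e) + y ^ (p ^ e)"
  by (rule freshmans_dream') (simp_all add: CHAR_l prime_CHAR)

lemma frob_sum: "(sum f S :: 'l) ^ (p ^ e) = (\<Sum>i\<in>S. f i ^ (p ^ e))"
  by (rule freshmans_dream_sum') (simp_all add: CHAR_l prime_CHAR)

lemma pe_pos [simp]: "p ^ e > 0"
  using CHAR_pos by simp

lemma frob_diff: "(x - y :: 'l) ^ (p ^ e) = x ^ (p ^ e) - y ^ (p ^ e)"
  using frob_add[of "x - y" y e] by simp

lemma frob_inj: "(x :: 'l) ^ (p ^ e) = y ^ (p ^ e) \<Longrightarrow> x = y"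
  using frob_diff[of x y e] by simp

lemma frob_surj: "\<exists>y::'l. y ^ (p ^ e) = z"
  using nth_root_exists[OF pe_pos] by blast

lemma subring_A:
  assumes "opn U" "U \<noteq> {}"
  shows "is_subring (A e U)"
  using is_subringD[OF subring_iota[OF assms]]
  by (auto simp: is_subring_def A_def frob_diff power_mult_distrib)

lemma emb_in_A: "opn U \<Longrightarrow> U \<noteq> {} \<Longrightarrow> \<kappa> c \<in> A e U"
  using emb_in_iota[of U "c ^ (p ^ e)"] by (simp add: A_def emb_power)

lemma A_mono: "opn U \<Longrightarrow> opn V \<Longrightarrow> V \<noteq> {} \<Longrightarrow> V \<subseteq> U \<Longrightarrow> A e U \<subseteq> A e V"
  using iota_mono[of U V] by (auto simp: A_def)

text \<open>Raising to the power \<open>p ^ d\<close> lowers the level by \<open>d\<close>. Together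
  with injectivity of Frobenius and existence of roots in the field, this reduces statements about
  any level to level 0.\<close>

lemma A_power_iff: "z ^ (p ^ d) \<in> A e U \<longleftrightarrow> z \<in> A (d + e) U"
  by (simp add: A_def power_add power_mult)

lemma A_0: "A 0 U = \<iota> U ` carrier (sec X U)"
  by (simp add: A_def)

lemma A_level_mono:
  assumes "opn U" "U \<noteq> {}" "d \<le> e"
  shows "A d U \<subseteq> A e U"
proof
  fix z assume "z \<in> A d U"
  then have "z ^ (p ^ (e - d)) \<in> A d U" by (rule is_subringD(7)[OF subring_A[OF assms(1,2)]])
  then show "z \<in> A e U" using assms(3) by (simp add: A_power_iff)
qed

lemma in_stalk: "opn U \<Longrightarrow> x \<in> U \<Longrightarrow> s \<in> A e U \<Longrightarrow> s \<in> stalk e x"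
  by (auto simp: stalk_def)

lemma stalkE:
  assumes "s \<in> stalk e x"
  obtains U where "opn U" "x \<in> U" "s \<in> A e U"
  using assms by (auto simp: stalk_def)

lemma subring_stalk:
  assumes x: "x \<in> topspace (pts X)"
  shows "is_subring (stalk e x)"
  unfolding is_subring_def
proof (intro conjI ballI)
  show "1 \<in> stalk e x"
    using in_stalk[of "topspace (pts X)"] x nonempty is_subringD(1)[OF subring_A] by blast
  fix s t assume "s \<in> stalk e x" "t \<in> stalk e x"
  then obtain U V where U: "opn U" "x \<in> U" "s \<in> A e U" and V: "opn V" "x \<in> V" "t \<in> A e V"
    by (metis stalkE)
  have UV: "opn (U \<inter> V)" "x \<in> U \<inter> V" "U \<inter> V \<noteq> {}" using U V by auto
  have "s \<in> A e (U \<inter> V)" "t \<in> A e (U \<inter> V)"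
    using A_mono[of U "U \<inter> V"] A_mono[of V "U \<inter> V"] U V UV by auto
  then have "s - t \<in> A e (U \<inter> V)" "s * t \<in> A e (U \<inter> V)"
    using is_subringD[OF subring_A[OF UV(1,3)]] by auto
  then show "s - t \<in> stalk e x" "s * t \<in> stalk e x" using in_stalk UV by auto
qed

lemma stalk_power_iff: "z ^ (p ^ d) \<in> stalk e x \<longleftrightarrow> z \<in> stalk (d + e) x"
  by (simp add: stalk_def A_power_iff)

lemma stalk_level_mono: "d \<le> e \<Longrightarrow> stalk d x \<subseteq> stalk e x"
  unfolding stalk_def using A_level_mono[of _ d e] by blast

lemma emb_in_stalk: "x \<in> topspace (pts X) \<Longrightarrow> \<kappa> c \<in> stalk e x"
  using in_stalk[of "topspace (pts X)"] emb_in_A nonempty by simp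

lemma subspace_subring:
  "is_subring B \<Longrightarrow> (\<And>c. \<kappa> c \<in> B) \<Longrightarrow> ideal_in B I \<Longrightarrow> vs.subspace I"
  using ideal_inD[of B I] by (intro vs.subspaceI) auto

section \<open>The schemes of roots, their units and their affine open sets\<close>

abbreviation Fr :: "nat \<Rightarrow> ('x, 'l, 'k) kspace" where "Fr e \<equiv> frob_root X \<iota> e"

abbreviation Fib :: "nat \<Rightarrow> 'x \<Rightarrow> 'x set \<Rightarrow> 'l set" where
  "Fib e x \<equiv> frob_fibre X \<iota> e x"

abbreviation Hilb :: "nat \<Rightarrow> ('x set \<Rightarrow> 'l set) topology" where
  "Hilb e \<equiv> hilb_topology (Fr e) (p ^ (e * krull_dim (pts X)))"

abbreviation Chart :: "nat \<Rightarrow> 'x set \<Rightarrow> 'l list \<Rightarrow> ('x set \<Rightarrow> 'l set) set" where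
  "Chart e U b \<equiv> hilb_chart (Fr e) U b"

abbreviation Coord :: "nat \<Rightarrow> 'x set \<Rightarrow> 'l list \<Rightarrow> 'l \<Rightarrow> nat \<Rightarrow> ('x set \<Rightarrow> 'l set) \<Rightarrow> 'k" where
  "Coord e U b s j I \<equiv> hilb_coord (Fr e) U b s j I"

lemma Fr_simps [simp]:
  "pts (Fr e) = pts X" "U \<noteq> {} \<Longrightarrow> sec (Fr e) U = ring_on (A e U)"
  "V \<noteq> {} \<Longrightarrow> res (Fr e) U V s = s" "res (Fr e) U {} s = 0" "scal (Fr e) c = \<kappa> c"
  by (simp_all add: frob_root_def A_def \<kappa>_def CHAR_k)

lemma sec_Fr_empty: "sec (Fr e) {} = ring_of_type_algebra\<lparr>carrier := {0}, one := 0\<rparr>"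
  by (simp add: frob_root_def)

lemma sec_Fr_empty_simps [simp]:
  "carrier (sec (Fr e) {}) = {0}" "\<one>\<^bsub>sec (Fr e) {}\<^esub> = 0" "\<zero>\<^bsub>sec (Fr e) {}\<^esub> = 0"
  "x \<otimes>\<^bsub>sec (Fr e) {}\<^esub> y = x * y" "x \<oplus>\<^bsub>sec (Fr e) {}\<^esub> y = x + y"
  by (simp_all add: sec_Fr_empty ring_of_type_algebra_def)

lemma cring_sec_Fr:
  assumes "opn U"
  shows "cring (sec (Fr e) U)"
proof (cases "U = {}")
  case True
  have "cring (sec (Fr e) {})"
  proof (rule cringI)
    show "abelian_group (sec (Fr e) {})" by (rule abelian_groupI) auto
    show "comm_monoid (sec (Fr e) {})" by (rule comm_monoidI) auto
  qed auto
  then show ?thesis using True by simp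
next
  case False
  then show ?thesis using cring_ring_on[OF subring_A[OF assms False]] by simp
qed

lemma unit_locus_subset: "unit_locus Y U f \<subseteq> U"
  by (auto simp: unit_locus_def)

lemma opn_unit_locus: "opn (unit_locus (Fr e) U f)"
proof (subst openin_subopen, intro ballI)
  fix x assume "x \<in> unit_locus (Fr e) U f"
  then obtain V where "opn V" "x \<in> V" "V \<subseteq> U" "res (Fr e) U V f \<in> Units (sec (Fr e) V)"
    by (auto simp: unit_locus_def)
  then show "\<exists>T. opn T \<and> x \<in> T \<and> T \<subseteq> unit_locus (Fr e) U f"
    by (intro exI[of _ V]) (auto simp: unit_locus_def)
qed

lemma unit_locus_iff:
  assumes U: "opn U" and f: "f \<in> A e U"
  shows "y \<in> unit_locus (Fr e) U f \<longleftrightarrow> y \<in> U \<and> f \<noteq> 0 \<and> inverse f \<in> stalk e y"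
proof
  assume "y \<in> unit_locus (Fr e) U f"
  then obtain V where V: "opn V" "y \<in> V" "V \<subseteq> U" "res (Fr e) U V f \<in> Units (sec (Fr e) V)"
    by (auto simp: unit_locus_def)
  then have "V \<noteq> {}" by auto
  then show "y \<in> U \<and> f \<noteq> 0 \<and> inverse f \<in> stalk e y"
    using V Units_ring_on[OF subring_A[OF V(1)]] by (auto intro: in_stalk)
next
  assume y: "y \<in> U \<and> f \<noteq> 0 \<and> inverse f \<in> stalk e y"
  then obtain V where V: "opn V" "y \<in> V" "inverse f \<in> A e V" by (metis stalkE)
  have ne: "U \<inter> V \<noteq> {}" "opn (U \<inter> V)" using y V U by auto
  have "inverse f \<in> A e (U \<inter> V)" "f \<in> A e (U \<inter> V)"
    using A_mono[of V "U \<inter> V" e] A_mono[of U "U \<inter> V" e] U V f ne by auto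
  then show "y \<in> unit_locus (Fr e) U f"
    unfolding unit_locus_def using ne y V
    by (auto simp: Units_ring_on[OF subring_A[OF ne(2,1)]] Fr_simps(2,3)[OF ne(1)] intro!: exI[of _ "U \<inter> V"])
qed

lemma ideal_of_point_iff:
  assumes U: "opn U" "U \<noteq> {}"
  shows "f \<in> ideal_of_point (Fr e) y U \<longleftrightarrow> f \<in> A e U \<and> \<not> (y \<in> U \<and> f \<noteq> 0 \<and> inverse f \<in> stalk e y)"
  using unit_locus_iff[OF U(1)] U by (auto simp: ideal_of_point_def)

text \<open>An inverse of a section is carried into the field by \<open>\<iota>\<close>; conversely,
  an inverse found in the field satisfies the same equation among sections, because
  \<open>\<iota>\<close> is injective.\<close>

lemma iota_ideal_of_point:
  assumes U: "opn U" "U \<noteq> {}"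
  shows "\<iota> U ` ideal_of_point X y U = {f \<in> A 0 U. \<not> (y \<in> U \<and> f \<noteq> 0 \<and> inverse f \<in> stalk 0 y)}"
proof -
  have "y \<in> unit_locus X U s \<longleftrightarrow> y \<in> U \<and> \<iota> U s \<noteq> 0 \<and> inverse (\<iota> U s) \<in> stalk 0 y"
    if s: "s \<in> carrier (sec X U)" for s
  proof
    assume "y \<in> unit_locus X U s"
    then obtain V where V: "opn V" "y \<in> V" "V \<subseteq> U" "res X U V s \<in> Units (sec X V)"
      by (auto simp: unit_locus_def)
    then have ne: "V \<noteq> {}" by auto
    obtain t where t: "t \<in> carrier (sec X V)" "res X U V s \<otimes>\<^bsub>sec X V\<^esub> t = \<one>\<^bsub>sec X V\<^esub>"
      and rs: "res X U V s \<in> carrier (sec X V)"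
      using V(4) by (auto simp: Units_def)
    have "\<iota> V (res X U V s) * \<iota> V t = 1"
      using iota_hom[OF V(1) ne] t rs ring_hom_mult[of "\<iota> V"] ring_hom_one[of "\<iota> V"]
      by (metis type_algebra_simps(2,4))
    then have "\<iota> U s * \<iota> V t = 1" using iota_res[OF U(1) V(1) ne V(3) s] by simp
    then have "\<iota> U s \<noteq> 0" "inverse (\<iota> U s) = \<iota> V t" by (auto simp: inverse_unique)
    moreover have "\<iota> V t \<in> stalk 0 y" using t V by (auto intro: in_stalk simp: A_0)
    ultimately show "y \<in> U \<and> \<iota> U s \<noteq> 0 \<and> inverse (\<iota> U s) \<in> stalk 0 y" using V by auto
  next
    assume y: "y \<in> U \<and> \<iota> U s \<noteq> 0 \<and> inverse (\<iota> U s) \<in> stalk 0 y"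
    then obtain V where V: "opn V" "y \<in> V" "inverse (\<iota> U s) \<in> A 0 V" by (metis stalkE)
    have ne: "U \<inter> V \<noteq> {}" "opn (U \<inter> V)" "U \<inter> V \<subseteq> U" using y V U by auto
    have "inverse (\<iota> U s) \<in> A 0 (U \<inter> V)"
      using A_mono[of V "U \<inter> V" 0] V ne by auto
    then obtain t where t: "t \<in> carrier (sec X (U \<inter> V))" "\<iota> (U \<inter> V) t = inverse (\<iota> U s)"
      by (auto simp: A_0)
    interpret cring "sec X (U \<inter> V)" by (rule cring_sec[OF ne(2)])
    have rs: "res X U (U \<inter> V) s \<in> carrier (sec X (U \<inter> V))"
      by (rule ring_hom_closed[OF res_hom[OF U(1) ne(2,3)] s])
    have "\<iota> (U \<inter> V) (res X U (U \<inter> V) s \<otimes>\<^bsub>sec X (U \<inter> V)\<^esub> t) = \<iota> (U \<inter> V) (\<one>\<^bsub>sec X (U \<inter> V)\<^esub>)"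
      using ring_hom_mult[OF iota_hom[OF ne(2,1)] rs t(1)] ring_hom_one[OF iota_hom[OF ne(2,1)]]
        iota_res[OF U(1) ne(2,1,3) s] t(2) y by simp
    then have 1: "res X U (U \<inter> V) s \<otimes>\<^bsub>sec X (U \<inter> V)\<^esub> t = \<one>\<^bsub>sec X (U \<inter> V)\<^esub>"
      using inj_onD[OF iota_inj[OF ne(2,1)]] rs t(1) by blast
    then have "res X U (U \<inter> V) s \<in> Units (sec X (U \<inter> V))"
      unfolding Units_def using rs t(1) m_comm[OF rs t(1)] by auto
    then show "y \<in> unit_locus X U s"
      unfolding unit_locus_def using y V ne by (auto intro!: exI[of _ "U \<inter> V"])
  qed
  then show ?thesis by (auto simp: ideal_of_point_def A_0)
qed

lemma Fr_res_closed:
  assumes "opn U" "opn V" "V \<subseteq> U" "s \<in> carrier (sec (Fr e) U)"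
  shows "res (Fr e) U V s \<in> carrier (sec (Fr e) V)"
proof (cases "V = {}")
  case False
  then have "U \<noteq> {}" using assms by auto
  then show ?thesis using A_mono[OF assms(1,2) False assms(3)] assms(4) False by auto
qed simp

lemma frob_ring_iso:
  assumes V: "opn V"
  shows "(\<lambda>z. z ^ p) \<in> ring_iso (sec (Fr (Suc e)) V) (sec (Fr e) V)"
proof (cases "V = {}")
  case True
  then show ?thesis using CHAR_pos by (auto simp: ring_iso_def ring_hom_def bij_betw_def)
next
  case False
  have "bij_betw (\<lambda>z. z ^ p) (A (Suc e) V) (A e V)"
  proof (rule bij_betw_imageI)
    show "inj_on (\<lambda>z. z ^ p) (A (Suc e) V)"
      using frob_inj[of _ 1] by (auto intro!: inj_onI)
    show "(\<lambda>z. z ^ p) ` A (Suc e) V = A e V"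
    proof (intro equalityI subsetI)
      fix z assume z: "z \<in> A e V"
      obtain y where "y ^ p = z" using frob_surj[of 1 z] by auto
      then show "z \<in> (\<lambda>z. z ^ p) ` A (Suc e) V"
        using z A_power_iff[of y 1 e V] by auto
    qed (use A_power_iff[of _ 1 e V] in auto)
  qed
  then show ?thesis
    using False frob_add[of _ _ 1] by (auto simp: ring_iso_def ring_hom_def bij_betw_def power_mult_distrib)
qed

text \<open>The \<open>p\<close>-th power map identifies the structure sheaf of level
  \<open>Suc e\<close> with that of level \<open>e\<close>. For the other direction one takes
  \<open>p\<close>-th roots, which commute with restriction because they are unique.\<close>

lemma affine_open_Fr_Suc: "affine_open (Fr (Suc e)) U \<longleftrightarrow> affine_open (Fr e) U"
proof
  have pp: "p > 0" by (rule CHAR_pos)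
  have r: "res (Fr e) U V (s ^ p) = (res (Fr (Suc e)) U V s) ^ p" for U V s
    using pp by (cases "V = {}") auto
  assume *: "affine_open (Fr (Suc e)) U"
  show "affine_open (Fr e) U"
    by (rule affine_open_transfer[OF _ _ _ _ _ _ *, where h = "\<lambda>_ z. z ^ p"])
      (simp_all add: cring_sec_Fr frob_ring_iso Fr_res_closed r)
next
  assume *: "affine_open (Fr e) U"
  define g where "g V = inv_into (carrier (sec (Fr (Suc e)) V)) (\<lambda>z. z ^ p)" for V
  have iso: "g V \<in> ring_iso (sec (Fr e) V) (sec (Fr (Suc e)) V)" if "opn V" for V
    unfolding g_def using ring_iso_set_sym[OF _ frob_ring_iso[OF that]] cring_sec_Fr[OF that] cring.axioms(1) by blast
  have gp: "g V s ^ p = s" if "opn V" "s \<in> carrier (sec (Fr e) V)" for V s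
    unfolding g_def using frob_ring_iso[OF that(1), of e] that(2)
      bij_betw_inv_into_right[where f = "\<lambda>z. z ^ p"] by (auto simp: ring_iso_def)
  have r: "res (Fr (Suc e)) U V (g U s) = g V (res (Fr e) U V s)"
    if "opn U" "opn V" "V \<subseteq> U" "s \<in> carrier (sec (Fr e) U)" for U V s
  proof (rule frob_inj[of _ 1])
    have pp: "p > 0" by (rule CHAR_pos)
    have "res (Fr (Suc e)) U V (g U s) ^ p = res (Fr e) U V s"
      using gp[OF that(1,4)] pp by (cases "V = {}") auto
    then show "res (Fr (Suc e)) U V (g U s) ^ (p ^ 1) = g V (res (Fr e) U V s) ^ (p ^ 1)"
      using gp[OF that(2) Fr_res_closed[OF that]] by simp
  qed
  show "affine_open (Fr (Suc e)) U"
    by (rule affine_open_transfer[OF _ _ _ _ _ _ *, where h = g])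
      (simp_all add: cring_sec_Fr iso Fr_res_closed r)
qed

section \<open>Subschemes supported at one point\<close>

definition ideal_stalk :: "('x set \<Rightarrow> 'l set) \<Rightarrow> 'x \<Rightarrow> 'l set" where
  "ideal_stalk I x = (\<Union>U\<in>{U. opn U \<and> x \<in> U}. I U)"

text \<open>The \<open>p ^ e\<close>-th powers of the elements of \<open>stalk e x\<close> are
  exactly the elements of \<open>stalk 0 x\<close>. So the last condition says that functions on
  \<open>X\<close> near \<open>x\<close> are constant on the subscheme, i.e. that the subscheme lies
  in the fibre of Frobenius over \<open>x\<close>. In this form the condition survives in limits,
  where the point moves.\<close>

definition fat_point :: "nat \<Rightarrow> ('x set \<Rightarrow> 'l set) \<Rightarrow> 'x \<Rightarrow> bool" where
  "fat_point e I x \<longleftrightarrow> closed_subscheme (Fr e) I \<and> x \<in> topspace (pts X) \<and>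
     (\<forall>y\<in>topspace (pts X). y \<noteq> x \<longrightarrow> (\<exists>V. opn V \<and> y \<in> V \<and> 1 \<in> I V)) \<and>
     1 \<notin> ideal_stalk I x \<and>
     (\<forall>s\<in>stalk e x. \<exists>c. s ^ (p ^ e) - \<kappa> c \<in> ideal_stalk I x)"

lemma closed_subscheme_ideal:
  assumes "closed_subscheme (Fr e) I" "opn U" "U \<noteq> {}"
  shows "ideal_in (A e U) (I U)"
proof -
  have "\<forall>U. opn U \<longrightarrow> ideal (I U) (sec (Fr e) U)"
    using assms(1) unfolding closed_subscheme_def Fr_simps(1) by (elim conjE)
  then have "ideal (I U) (sec (Fr e) U)" using assms(2) by simp
  then show ?thesis using ideal_ring_on_iff[OF subring_A[OF assms(2,3)]] assms(3) by simp
qed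

lemma closed_subscheme_mono:
  assumes "closed_subscheme (Fr e) I" "opn U" "opn V" "V \<subseteq> U" "V \<noteq> {}"
  shows "I U \<subseteq> I V"
proof
  fix s assume "s \<in> I U"
  moreover have "\<forall>s\<in>I U. res (Fr e) U V s \<in> I V"
    using assms(1-4) unfolding closed_subscheme_def by (metis Fr_simps(1))
  ultimately show "s \<in> I V" using assms(5) by simp
qed

lemma closed_subscheme_local:
  assumes I: "closed_subscheme (Fr e) I" and U: "opn U" "U \<noteq> {}" and s: "s \<in> A e U"
    and loc: "\<And>y. y \<in> U \<Longrightarrow> \<exists>V. opn V \<and> y \<in> V \<and> V \<subseteq> U \<and> s \<in> I V"
  shows "s \<in> I U"
proof -
  define VV where "VV = {V. opn V \<and> V \<noteq> {} \<and> V \<subseteq> U \<and> s \<in> I V}"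
  have un: "\<Union>VV = U"
  proof (intro equalityI subsetI)
    fix y assume "y \<in> U"
    then obtain V where "opn V" "y \<in> V" "V \<subseteq> U" "s \<in> I V" using loc by blast
    then show "y \<in> \<Union>VV" unfolding VV_def by blast
  qed (auto simp: VV_def)
  have "\<forall>\<U>. (\<forall>V\<in>\<U>. opn V) \<longrightarrow>
        (\<forall>s\<in>carrier (sec (Fr e) (\<Union>\<U>)). (\<forall>V\<in>\<U>. res (Fr e) (\<Union>\<U>) V s \<in> I V) \<longrightarrow> s \<in> I (\<Union>\<U>))"
    using I unfolding closed_subscheme_def Fr_simps(1) by (elim conjE)
  from this[rule_format, of VV s] show ?thesis
    unfolding un using U s by (auto simp: VV_def)
qed

lemma affine_localization:
  assumes aff: "affine_open (Fr e) U" and f: "f \<in> A e U" and x: "x \<in> unit_locus (Fr e) U f"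
    and t: "t \<in> A e (unit_locus (Fr e) U f)"
  shows "\<exists>n. f ^ n * t \<in> A e U"
proof -
  define D where "D = unit_locus (Fr e) U f"
  have U: "opn U" using aff by (simp add: affine_open_def)
  have D: "D \<noteq> {}" "opn D" using x opn_unit_locus by (auto simp: D_def)
  have ne: "U \<noteq> {}" using x unit_locus_subset by fast
  have "\<forall>f\<in>A e U. \<forall>t\<in>carrier (sec (Fr e) (unit_locus (Fr e) U f)). \<exists>n::nat. \<exists>s\<in>A e U.
          res (Fr e) U (unit_locus (Fr e) U f) s =
            res (Fr e) U (unit_locus (Fr e) U f) f [^]\<^bsub>sec (Fr e) (unit_locus (Fr e) U f)\<^esub> n
              \<otimes>\<^bsub>sec (Fr e) (unit_locus (Fr e) U f)\<^esub> t"
    using aff ne unfolding affine_open_def Let_def by simp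
  from this[rule_format, OF f, of t] obtain n::nat and s where "s \<in> A e U" "s = f [^]\<^bsub>ring_on (A e D)\<^esub> n * t"
    unfolding D_def[symmetric] using D t by (auto simp: D_def[symmetric])
  then have "f ^ n * t \<in> A e U"
    using nat_pow_ring_on[OF subring_A[OF D(2,1)]] by simp
  then show ?thesis ..
qed

lemma in_ideal_stalk: "opn U \<Longrightarrow> x \<in> U \<Longrightarrow> s \<in> I U \<Longrightarrow> s \<in> ideal_stalk I x"
  by (auto simp: ideal_stalk_def)

lemma ideal_stalkE:
  assumes "s \<in> ideal_stalk I x"
  obtains U where "opn U" "x \<in> U" "s \<in> I U"
  using assms by (auto simp: ideal_stalk_def)

lemma ideal_in_ideal_stalk:
  assumes I: "closed_subscheme (Fr e) I" and x: "x \<in> topspace (pts X)"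
  shows "ideal_in (stalk e x) (ideal_stalk I x)"
  unfolding ideal_in_def
proof (intro conjI ballI subsetI)
  fix s assume "s \<in> ideal_stalk I x"
  then obtain U where U: "opn U" "x \<in> U" "s \<in> I U" by (rule ideal_stalkE)
  then show "s \<in> stalk e x"
    using ideal_inD(1)[OF closed_subscheme_ideal[OF I U(1)]] in_stalk by blast
next
  show "0 \<in> ideal_stalk I x"
    using in_ideal_stalk[of "topspace (pts X)" x 0 I] x ideal_inD(2)[OF closed_subscheme_ideal[OF I]] by auto
next
  fix s t assume "s \<in> ideal_stalk I x" "t \<in> ideal_stalk I x"
  then obtain U V where U: "opn U" "x \<in> U" "s \<in> I U" and V: "opn V" "x \<in> V" "t \<in> I V"
    by (metis ideal_stalkE)
  have UV: "opn (U \<inter> V)" "x \<in> U \<inter> V" "U \<inter> V \<noteq> {}" using U V by auto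
  have "s \<in> I (U \<inter> V)" "t \<in> I (U \<inter> V)"
    using closed_subscheme_mono[OF I, of U "U \<inter> V"] closed_subscheme_mono[OF I, of V "U \<inter> V"] U V UV by auto
  then have "s + t \<in> I (U \<inter> V)" using ideal_inD(3)[OF closed_subscheme_ideal[OF I UV(1,3)]] by blast
  then show "s + t \<in> ideal_stalk I x" using in_ideal_stalk UV by blast
next
  fix a t assume "a \<in> stalk e x" "t \<in> ideal_stalk I x"
  then obtain U V where U: "opn U" "x \<in> U" "a \<in> A e U" and V: "opn V" "x \<in> V" "t \<in> I V"
    by (metis ideal_stalkE stalkE)
  have UV: "opn (U \<inter> V)" "x \<in> U \<inter> V" "U \<inter> V \<noteq> {}" using U V by auto
  have "a \<in> A e (U \<inter> V)" "t \<in> I (U \<inter> V)"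
    using A_mono[of U "U \<inter> V"] closed_subscheme_mono[OF I, of V "U \<inter> V"] U V UV by auto
  then have "a * t \<in> I (U \<inter> V)" using ideal_inD(4)[OF closed_subscheme_ideal[OF I UV(1,3)]] by blast
  then show "a * t \<in> ideal_stalk I x" using in_ideal_stalk UV by blast
qed

lemma subspace_A: "opn U \<Longrightarrow> U \<noteq> {} \<Longrightarrow> vs.subspace (A e U)"
  using subspace_subring[OF subring_A emb_in_A ideal_in_self[OF subring_A]] by blast

lemma subspace_closed_subscheme:
  "closed_subscheme (Fr e) I \<Longrightarrow> opn U \<Longrightarrow> U \<noteq> {} \<Longrightarrow> vs.subspace (I U)"
  using subspace_subring[OF subring_A emb_in_A closed_subscheme_ideal] by blast

lemma subspace_ideal_stalk:
  "closed_subscheme (Fr e) I \<Longrightarrow> x \<in> topspace (pts X) \<Longrightarrow> vs.subspace (ideal_stalk I x)"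
  using subspace_subring[OF subring_stalk emb_in_stalk ideal_in_ideal_stalk] by blast

section \<open>Hilbert charts expressed by bases modulo an ideal\<close>

lemma lincomb_Fr:
  assumes U: "opn U" "U \<noteq> {}" and b: "set b \<subseteq> A e U"
  shows "lincomb (Fr e) U cs b = lc cs b"
proof -
  have "lincomb (Fr e) U cs b = (\<Oplus>\<^bsub>ring_on (A e U)\<^esub>i\<in>{..<length b}. \<kappa> (cs ! i) * (b ! i))"
    using U by (simp add: lincomb_def)
  also have "\<dots> = lc cs b"
    unfolding lc_def using is_subringD(4)[OF subring_A[OF U]] emb_in_A[OF U] b
    by (intro finsum_ring_on[OF subring_A[OF U]]) (auto simp: subset_iff)
  finally show ?thesis .
qed

lemma minus_lincomb_Fr:
  assumes U: "opn U" "U \<noteq> {}" and b: "set b \<subseteq> A e U" and s: "s \<in> A e U"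
  shows "s \<ominus>\<^bsub>sec (Fr e) U\<^esub> lincomb (Fr e) U cs b = s - lc cs b"
  using a_minus_ring_on[OF subring_A[OF U] s lc_closed[OF subspace_A[OF U] b]] lincomb_Fr[OF U b] U by simp

lemma hilb_chart_Fr_iff:
  assumes U: "opn U" "U \<noteq> {}" and b: "set b \<subseteq> A e U"
  shows "I \<in> Chart e U b \<longleftrightarrow>
    closed_subscheme (Fr e) I \<and> supported_in (Fr e) I U \<and> basis_mod (A e U) (I U) b"
  using basis_mod_iff[OF subspace_closed_subscheme[OF _ U] subspace_A[OF U] b, of e I]
    minus_lincomb_Fr[OF U b] U
  by (auto simp: hilb_chart_def)

lemma hilb_coord_Fr:
  assumes U: "opn U" "U \<noteq> {}" and b: "set b \<subseteq> A e U" and s: "s \<in> A e U"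
    and I: "I \<in> Chart e U b" and cs: "length cs = length b" "s - lc cs b \<in> I U"
  shows "Coord e U b s i I = cs ! i"
proof -
  have "(THE cs. length cs = length b \<and> s \<ominus>\<^bsub>sec (Fr e) U\<^esub> lincomb (Fr e) U cs b \<in> I U) = cs"
    using I cs s U minus_lincomb_Fr[OF U b s] by (intro the1_equality) (auto simp: hilb_chart_def)
  then show ?thesis by (simp add: hilb_coord_def)
qed

text \<open>Over the empty set the ring is zero, so all coordinate vectors represent 0 and they are
  unique only for the empty list.\<close>

lemma hilb_chart_nonempty:
  assumes I: "I \<in> Chart e U b" and b: "b \<noteq> []"
  shows "U \<noteq> {}"
proof
  assume U: "U = {}"
  interpret cring "sec (Fr e) {}" by (rule cring_sec_Fr) simp
  have lin: "lincomb (Fr e) U cs b = \<zero>\<^bsub>sec (Fr e) {}\<^esub>" for cs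
    using finsum_zero[of "{..<length b}"] U by (simp add: lincomb_def)
  have "\<zero>\<^bsub>sec (Fr e) {}\<^esub> \<in> carrier (sec (Fr e) U)" using U by simp
  then have "\<exists>!cs. length cs = length b \<and>
      \<zero>\<^bsub>sec (Fr e) {}\<^esub> \<ominus>\<^bsub>sec (Fr e) U\<^esub> lincomb (Fr e) U cs b \<in> I U"
    using I unfolding hilb_chart_def by blast
  then have "\<exists>!cs::'k list. length cs = length b \<and> \<zero>\<^bsub>sec (Fr e) {}\<^esub> \<ominus>\<^bsub>sec (Fr e) {}\<^esub> \<zero>\<^bsub>sec (Fr e) {}\<^esub> \<in> I {}"
    unfolding lin using U by simp
  then have "replicate (length b) (0::'k) = replicate (length b) 1"
    by (metis length_replicate)
  then show False using b by simp
qed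

section \<open>Comparing affine sections with the stalk at the supporting point\<close>

lemma fat_pointD:
  assumes "fat_point e I x"
  shows "closed_subscheme (Fr e) I" "x \<in> topspace (pts X)"
    "\<And>y. y \<in> topspace (pts X) \<Longrightarrow> y \<noteq> x \<Longrightarrow> \<exists>V. opn V \<and> y \<in> V \<and> 1 \<in> I V"
    "1 \<notin> ideal_stalk I x" "\<And>s. s \<in> stalk e x \<Longrightarrow> \<exists>c. s ^ (p ^ e) - \<kappa> c \<in> ideal_stalk I x"
  using assms by (auto simp: fat_point_def)

text \<open>The ideal is a sheaf, so membership can be tested near each point. Near \<open>x\<close>
  the germ decides; near any other point the ideal contains 1 and the condition is empty.\<close>

lemma ideal_eq_ideal_stalk:
  assumes I: "closed_subscheme (Fr e) I" and x: "x \<in> topspace (pts X)"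
    and sup: "\<And>y. y \<in> topspace (pts X) \<Longrightarrow> y \<noteq> x \<Longrightarrow> \<exists>V. opn V \<and> y \<in> V \<and> 1 \<in> I V"
    and U: "opn U" "x \<in> U"
  shows "I U = A e U \<inter> ideal_stalk I x"
proof (intro equalityI subsetI)
  have ne: "U \<noteq> {}" using U by auto
  fix s assume "s \<in> I U"
  then show "s \<in> A e U \<inter> ideal_stalk I x"
    using in_ideal_stalk[OF U] ideal_inD(1)[OF closed_subscheme_ideal[OF I U(1) ne]] by blast
next
  have ne: "U \<noteq> {}" using U by auto
  fix s assume s: "s \<in> A e U \<inter> ideal_stalk I x"
  then obtain W where W: "opn W" "x \<in> W" "s \<in> I W" by (auto elim: ideal_stalkE)
  show "s \<in> I U"
  proof (rule closed_subscheme_local[OF I U(1) ne])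
    fix y assume y: "y \<in> U"
    show "\<exists>V. opn V \<and> y \<in> V \<and> V \<subseteq> U \<and> s \<in> I V"
    proof (cases "y = x")
      case True
      have "opn (W \<inter> U)" "W \<inter> U \<subseteq> W" "W \<inter> U \<noteq> {}" using W U by auto
      then have "s \<in> I (W \<inter> U)" using closed_subscheme_mono[OF I W(1)] W(3) by blast
      then show ?thesis using W U True by (intro exI[of _ "W \<inter> U"]) auto
    next
      case False
      have "y \<in> topspace (pts X)" using y openin_subset[OF U(1)] by auto
      then obtain V where V: "opn V" "y \<in> V" "1 \<in> I V" using sup[OF _ False] by auto
      have VU: "opn (V \<inter> U)" "V \<inter> U \<subseteq> V" "V \<inter> U \<noteq> {}" using V U y by auto
      then have "1 \<in> I (V \<inter> U)" using closed_subscheme_mono[OF I V(1)] V(3) by blast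
      moreover have "s \<in> A e (V \<inter> U)" using A_mono[OF U(1) VU(1,3)] s by auto
      ultimately have "s * 1 \<in> I (V \<inter> U)"
        using ideal_inD(4)[OF closed_subscheme_ideal[OF I VU(1,3)]] by blast
      then show ?thesis using V y VU by (intro exI[of _ "V \<inter> U"]) auto
    qed
  qed (use s in auto)
qed

lemma fat_point_ideal:
  "fat_point e I x \<Longrightarrow> opn U \<Longrightarrow> x \<in> U \<Longrightarrow> I U = A e U \<inter> ideal_stalk I x"
  using ideal_eq_ideal_stalk fat_pointD(1-3) by metis

lemma affine_opn: "affine_open (Fr e) U \<Longrightarrow> opn U"
  by (simp add: affine_open_def)

text \<open>Near \<open>x\<close> the element \<open>t\<close> is a fraction with denominator
  \<open>g ^ n\<close>, where \<open>g\<close> is a section over \<open>U\<close> that is a unit at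
  \<open>x\<close>. As \<open>g ^ (p ^ e)\<close> is a nonzero scalar modulo the ideal,
  \<open>g\<close> has an inverse modulo the ideal that is already a section over
  \<open>U\<close>.\<close>

lemma stalk_approx:
  assumes aff: "affine_open (Fr e) U" and x: "x \<in> U" and I: "closed_subscheme (Fr e) I"
    and one: "1 \<notin> ideal_stalk I x"
    and residue: "\<And>s. s \<in> A e U \<Longrightarrow> \<exists>c. s ^ (p ^ e) - \<kappa> c \<in> ideal_stalk I x"
    and t: "t \<in> stalk e x"
  shows "\<exists>s\<in>A e U. t - s \<in> ideal_stalk I x"
proof -
  have U: "opn U" "U \<noteq> {}" using affine_opn[OF aff] x by auto
  have xt: "x \<in> topspace (pts X)" using openin_subset[OF U(1)] x by auto
  note st = is_subringD[OF subring_stalk[OF xt]]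
  note J = ideal_in_ideal_stalk[OF I xt]
  obtain W where W: "opn W" "x \<in> W" "t \<in> A e W" using t by (rule stalkE)
  have "opn (W \<inter> U)" using W U by auto
  then obtain g where g: "g \<in> A e U" "x \<in> unit_locus (Fr e) U g" "unit_locus (Fr e) U g \<subseteq> W \<inter> U"
    using affine_open_base[OF aff, of "W \<inter> U" x] W U x by auto
  define D where "D = unit_locus (Fr e) U g"
  have "opn D" "D \<noteq> {}" "D \<subseteq> W" using g opn_unit_locus by (auto simp: D_def)
  then have "t \<in> A e D" using A_mono[OF W(1)] W(3) by blast
  then obtain n where n: "g ^ n * t \<in> A e U" using affine_localization[OF aff g(1,2)] by (auto simp: D_def)
  have gs: "g \<in> stalk e x" "g \<noteq> 0" "inverse g \<in> stalk e x"
    using in_stalk[OF U(1) x g(1)] g(2) unit_locus_iff[OF U(1) g(1)] by auto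
  obtain c where c: "g ^ (p ^ e) - \<kappa> c \<in> ideal_stalk I x" using residue[OF g(1)] by auto
  have c0: "c \<noteq> 0"
  proof
    assume "c = 0"
    then have "inverse g ^ (p ^ e) * g ^ (p ^ e) \<in> ideal_stalk I x"
      using ideal_inD(4)[OF J] st(7)[OF gs(3)] c by simp
    then show False using gs(2) one by (simp flip: power_mult_distrib)
  qed
  \<comment> \<open>The inverse of \<open>g\<close> modulo the ideal, from
    \<open>g ^ (p ^ e)\<close> being congruent to \<open>\<kappa> c\<close>.\<close>
  define h where "h = g ^ (p ^ e - 1) * \<kappa> (inverse c)"
  have hA: "h \<in> A e U"
    unfolding h_def using g by (intro is_subringD(4,7)[OF subring_A[OF U]] emb_in_A[OF U])
  have gq: "g ^ (p ^ e) = g ^ (p ^ e - 1) * g"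
    using power_minus_mult[OF pe_pos, of g e] by simp
  have "(g ^ (p ^ e) - \<kappa> c) * \<kappa> (inverse c) \<in> ideal_stalk I x"
    using ideal_inD(5)[OF J _ c] emb_in_stalk[OF xt] by blast
  moreover have "(g ^ (p ^ e) - \<kappa> c) * \<kappa> (inverse c) = h * g - 1"
    using c0 by (simp add: h_def gq algebra_simps flip: emb_mult)
  ultimately have "h * g - 1 \<in> ideal_stalk I x" by simp
  moreover have "h * g \<in> stalk e x" using st(4) gs in_stalk[OF U(1) x hA] by blast
  ultimately have hgn: "(h * g) ^ n - 1 \<in> ideal_stalk I x"
    using ideal_in_power_minus_one[OF J subring_stalk[OF xt]] by blast
  define s where "s = h ^ n * (g ^ n * t)"
  have "s \<in> A e U" unfolding s_def
    by (rule is_subringD(4)[OF subring_A[OF U] is_subringD(7)[OF subring_A[OF U] hA] n])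
  moreover have "- t * ((h * g) ^ n - 1) \<in> ideal_stalk I x"
    using ideal_inD(4)[OF J _ hgn] st(5)[OF t] by blast
  then have "t - s \<in> ideal_stalk I x"
    by (simp add: s_def algebra_simps power_mult_distrib)
  ultimately show ?thesis by blast
qed

text \<open>By approximation, sections over \<open>U\<close> and germs at \<open>x\<close> have the
  same quotient. Passing through the stalk allows the affine set to be changed.\<close>

lemma fat_point_basis_iff:
  assumes fat: "fat_point e I x" and aff: "affine_open (Fr e) U" and x: "x \<in> U" and b: "set b \<subseteq> A e U"
  shows "basis_mod (A e U) (I U) b \<longleftrightarrow> basis_mod (stalk e x) (ideal_stalk I x) b"
proof -
  note F = fat_pointD[OF fat]
  have U: "opn U" "U \<noteq> {}" using affine_opn[OF aff] x by auto
  have IU: "I U = A e U \<inter> ideal_stalk I x" by (rule fat_point_ideal[OF fat U(1) x])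
  have sub: "A e U \<subseteq> stalk e x" using in_stalk[OF U(1) x] by blast
  have lcA: "lc cs b \<in> A e U" for cs by (rule lc_closed[OF subspace_A[OF U] b])
  have "indep_mod (I U) b \<longleftrightarrow> indep_mod (ideal_stalk I x) b"
    unfolding indep_mod_def IU using lcA by auto
  moreover have "spans_mod (A e U) (I U) b \<longleftrightarrow> spans_mod (stalk e x) (ideal_stalk I x) b"
  proof
    assume s: "spans_mod (A e U) (I U) b"
    show "spans_mod (stalk e x) (ideal_stalk I x) b" unfolding spans_mod_def
    proof
      fix t assume t: "t \<in> stalk e x"
      obtain s where s': "s \<in> A e U" "t - s \<in> ideal_stalk I x"
        using stalk_approx[OF aff x F(1,4) F(5) t] sub by blast
      then obtain cs where cs: "length cs = length b" "s - lc cs b \<in> I U"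
        using s unfolding spans_mod_def by auto
      then have "(t - s) + (s - lc cs b) \<in> ideal_stalk I x"
        using s' ideal_inD(3)[OF ideal_in_ideal_stalk[OF F(1,2)]] IU by blast
      then show "\<exists>cs. length cs = length b \<and> t - lc cs b \<in> ideal_stalk I x"
        using cs by auto
    qed
  next
    assume "spans_mod (stalk e x) (ideal_stalk I x) b"
    then show "spans_mod (A e U) (I U) b"
      unfolding spans_mod_def IU using sub lcA is_subringD(3)[OF subring_A[OF U]] by blast
  qed
  ultimately show ?thesis using b sub by (auto simp: basis_mod_def)
qed

text \<open>Since \<open>p ^ e\<close>-th powers are scalars modulo \<open>I U\<close>, every
  section is nilpotent or a unit there. Hence the radical is prime, and affineness of
  \<open>U\<close> turns it into a point \<open>x\<close>. The radical is also maximal, which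
  removes all other points from the support.\<close>

lemma fat_point_exists:
  assumes aff: "affine_open (Fr e) U" and b: "set b \<subseteq> A e U" "b \<noteq> []" and chart: "I \<in> Chart e U b"
    and residue: "\<And>s. s \<in> A e U \<Longrightarrow> \<exists>c. s ^ (p ^ e) - \<kappa> c \<in> I U"
  obtains x where "x \<in> U" "fat_point e I x"
proof -
  have U: "opn U" "U \<noteq> {}" by (rule affine_opn[OF aff], rule hilb_chart_nonempty[OF chart b(2)])
  have I: "closed_subscheme (Fr e) I" and supp: "supported_in (Fr e) I U"
    and basis: "basis_mod (A e U) (I U) b"
    using chart hilb_chart_Fr_iff[OF U b(1)] by auto
  note R = is_subringD[OF subring_A[OF U, of e]]
  note IU = closed_subscheme_ideal[OF I U]
  define q where "q = p ^ e"
  have q: "q > 0" by (simp add: q_def)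
  have one: "1 \<notin> I U"
  proof
    assume "1 \<in> I U"
    then have "A e U \<subseteq> I U" using ideal_inD(4)[OF IU, of _ 1] by auto
    then show False using unit_ideal_not_indep_mod[of "I U" b] basis b by (auto simp: basis_mod_def)
  qed
  have unit: "c = 0" if "\<kappa> c \<in> I U" for c
  proof (rule ccontr)
    assume "c \<noteq> 0"
    then have "\<kappa> (inverse c) * \<kappa> c = 1" by (simp flip: emb_mult)
    then show False using ideal_inD(4)[OF IU emb_in_A[OF U] that] one by metis
  qed
  \<comment> \<open>This is the radical of \<open>I U\<close>: the exponent \<open>q\<close>
    suffices because \<open>s ^ q\<close> is a scalar modulo \<open>I U\<close>, and a nilpotent
    scalar is 0.\<close>
  define P where "P = {s \<in> A e U. s ^ q \<in> I U}"
  have IP: "I U \<subseteq> P"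
    using ideal_in_power[OF IU subring_A[OF U] _ q] ideal_inD(1)[OF IU] by (auto simp: P_def)
  have idP: "ideal_in (A e U) P"
    unfolding ideal_in_def P_def
    using R ideal_inD[OF IU] q by (auto simp: q_def frob_add power_mult_distrib zero_power)
  have "1 \<notin> P" using one by (simp add: P_def)
  have "primeideal P (ring_on (A e U))"
  proof (rule primeidealI)
    show "ideal P (ring_on (A e U))" using ideal_ring_on_iff[OF subring_A[OF U]] idP by simp
    show "cring (ring_on (A e U))" by (rule cring_ring_on[OF subring_A[OF U]])
    show "carrier (ring_on (A e U)) \<noteq> P" using R(1) \<open>1 \<notin> P\<close> by auto
  next
    fix s t assume "s \<in> carrier (ring_on (A e U))" "t \<in> carrier (ring_on (A e U))"
      and st: "s \<otimes>\<^bsub>ring_on (A e U)\<^esub> t \<in> P"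
    then have s: "s \<in> A e U" "t \<in> A e U" by auto
    obtain c d where c: "s ^ q - \<kappa> c \<in> I U" and d: "t ^ q - \<kappa> d \<in> I U"
      using residue s unfolding q_def by metis
    have "s ^ q * t ^ q \<in> I U" using st by (simp add: P_def power_mult_distrib)
    moreover have "t ^ q * (s ^ q - \<kappa> c) + \<kappa> c * (t ^ q - \<kappa> d) \<in> I U"
      by (rule ideal_inD(3)[OF IU ideal_inD(4)[OF IU R(7)[OF s(2)] c] ideal_inD(4)[OF IU emb_in_A[OF U] d]])
    ultimately have "s ^ q * t ^ q - (t ^ q * (s ^ q - \<kappa> c) + \<kappa> c * (t ^ q - \<kappa> d)) \<in> I U"
      by (rule ideal_in_diff[OF IU subring_A[OF U]])
    moreover have "s ^ q * t ^ q - (t ^ q * (s ^ q - \<kappa> c) + \<kappa> c * (t ^ q - \<kappa> d)) = \<kappa> (c * d)"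
      by (simp add: algebra_simps emb_mult)
    ultimately have "c * d = 0" using unit by metis
    then have "c = 0 \<or> d = 0" by simp
    then show "s \<in> P \<or> t \<in> P" using c d s by (auto simp: P_def)
  qed
  moreover have bij: "bij_betw (\<lambda>x. ideal_of_point (Fr e) x U) U {P. primeideal P (ring_on (A e U))}"
    using aff U by (simp add: affine_open_def)
  ultimately have "P \<in> (\<lambda>x. ideal_of_point (Fr e) x U) ` U" by (simp add: bij_betw_def)
  then obtain x where x: "x \<in> U" "ideal_of_point (Fr e) x U = P" by auto
  have xt: "x \<in> topspace (pts X)" using openin_subset[OF U(1)] x by auto
  have sup: "\<exists>V. opn V \<and> y \<in> V \<and> 1 \<in> I V" if y: "y \<in> topspace (pts X)" "y \<noteq> x" for y
  proof (cases "y \<in> U")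
    case False
    then obtain V where V: "opn V" "y \<in> V" "\<one>\<^bsub>sec (Fr e) V\<^esub> \<in> I V"
      using supp y by (auto simp: supported_in_def)
    then have "V \<noteq> {}" by auto
    then show ?thesis using V by auto
  next
    case True
    define Q where "Q = ideal_of_point (Fr e) y U"
    have "Q \<noteq> P" using bij y True x unfolding Q_def bij_betw_def inj_on_def by metis
    have "primeideal Q (ring_on (A e U))" using bij True unfolding Q_def bij_betw_def by blast
    then have Q: "ideal_in (A e U) Q"
      using primeideal.axioms(1) ideal_ring_on_iff[OF subring_A[OF U]] by blast
    have Q1: "1 \<notin> Q"
      unfolding Q_def ideal_of_point_iff[OF U] using True y is_subringD(1)[OF subring_stalk] by simp
    \<comment> \<open>Were \<open>P\<close> properly contained in \<open>Q\<close>, some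
      \<open>s\<close> in \<open>Q\<close> would have a nonzero scalar as its \<open>q\<close>-th
      power modulo \<open>P\<close>, and \<open>Q\<close> would be the unit ideal. An element of
      \<open>P\<close> outside \<open>Q\<close> is a unit near \<open>y\<close>, and its
      \<open>q\<close>-th power then makes \<open>I\<close> the unit ideal there.\<close>
    have "\<not> P \<subseteq> Q"
    proof
      assume PQ: "P \<subseteq> Q"
      then obtain s where s: "s \<in> Q" "s \<notin> P" using \<open>Q \<noteq> P\<close> by auto
      then have sA: "s \<in> A e U" using ideal_inD(1)[OF Q] by blast
      then obtain c where c: "s ^ q - \<kappa> c \<in> I U" using residue unfolding q_def by blast
      then have c0: "c \<noteq> 0" using s sA by (auto simp: P_def)
      have "s ^ q - (s ^ q - \<kappa> c) \<in> Q"
        using ideal_in_diff[OF Q subring_A[OF U] ideal_in_power[OF Q subring_A[OF U] s(1) q]] c IP PQ by blast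
      then have "\<kappa> (inverse c) * \<kappa> c \<in> Q" using ideal_inD(4)[OF Q emb_in_A[OF U]] by simp
      then show False using Q1 c0 by (simp flip: emb_mult)
    qed
    then obtain s where s: "s \<in> A e U" "s ^ q \<in> I U" "s \<noteq> 0" "inverse s \<in> stalk e y"
      using ideal_of_point_iff[OF U] by (auto simp: P_def Q_def)
    then obtain V where V: "opn V" "y \<in> V" "inverse s \<in> A e V" by (metis stalkE)
    have UV: "opn (U \<inter> V)" "U \<inter> V \<noteq> {}" using U V True by auto
    have "inverse s \<in> A e (U \<inter> V)" "s ^ q \<in> I (U \<inter> V)"
      using A_mono[OF V(1) UV] closed_subscheme_mono[OF I U(1) UV(1) _ UV(2)] s V by auto
    then have "inverse s ^ q * s ^ q \<in> I (U \<inter> V)"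
      using ideal_inD(4)[OF closed_subscheme_ideal[OF I UV]] is_subringD(7)[OF subring_A[OF UV]] by blast
    then have "1 \<in> I (U \<inter> V)" using s(3) by (simp flip: power_mult_distrib)
    then show ?thesis using UV True V by (intro exI[of _ "U \<inter> V"]) auto
  qed
  have eq: "I U = A e U \<inter> ideal_stalk I x" by (rule ideal_eq_ideal_stalk[OF I xt sup U(1) x(1)])
  have one': "1 \<notin> ideal_stalk I x" using eq one R(1) by blast
  have res: "\<exists>c. s ^ (p ^ e) - \<kappa> c \<in> ideal_stalk I x" if "s \<in> A e U" for s
    using residue[OF that] eq by blast
  have "\<exists>c. t ^ (p ^ e) - \<kappa> c \<in> ideal_stalk I x" if t: "t \<in> stalk e x" for t
  proof -
    note J = ideal_in_ideal_stalk[OF I xt]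
    obtain s where s: "s \<in> A e U" "t - s \<in> ideal_stalk I x"
      using stalk_approx[OF aff x(1) I one' res t] by blast
    obtain c where c: "s ^ (p ^ e) - \<kappa> c \<in> ideal_stalk I x" using res[OF s(1)] by blast
    have "(t - s) ^ (p ^ e) + (s ^ (p ^ e) - \<kappa> c) \<in> ideal_stalk I x"
      using ideal_inD(3)[OF J] ideal_in_power[OF J subring_stalk[OF xt] s(2) pe_pos] c by blast
    then have "t ^ (p ^ e) - \<kappa> c \<in> ideal_stalk I x" by (simp add: frob_diff)
    then show ?thesis ..
  qed
  then have "fat_point e I x" unfolding fat_point_def using I xt sup one' by blast
  then show ?thesis using that x by blast
qed

section \<open>Fibres of Frobenius and splittings\<close>

text \<open>For \<open>x\<close> in \<open>W\<close> this is the ideal of \<open>x\<close> in the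
  sections of \<open>X\<close> over \<open>W\<close>, viewed inside the field.\<close>

definition nonunits :: "'x \<Rightarrow> 'x set \<Rightarrow> 'l set" where
  "nonunits x W = {f \<in> A 0 W. f = 0 \<or> inverse f \<notin> stalk 0 x}"

text \<open>The stalk of the fibre ideal: the extension of the maximal ideal at \<open>x\<close> to
  the ring of \<open>p ^ e\<close>-th roots.\<close>

definition fibre_stalk :: "nat \<Rightarrow> 'x \<Rightarrow> 'l set" where
  "fibre_stalk e x = (\<Union>W\<in>{W. opn W \<and> x \<in> W}. ideal_gen (A e W) (nonunits x W))"

lemma nonunits_subset: "opn W \<Longrightarrow> W \<noteq> {} \<Longrightarrow> nonunits x W \<subseteq> A e W"
  using A_level_mono[of W 0 e] by (auto simp: nonunits_def)

lemma ideal_in_nonunits_gen: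
  "opn W \<Longrightarrow> W \<noteq> {} \<Longrightarrow> ideal_in (A e W) (ideal_gen (A e W) (nonunits x W))"
  by (rule ideal_in_ideal_gen[OF subring_A nonunits_subset])

lemma nonunits_gen_mono:
  assumes "opn W" "opn W'" "W' \<subseteq> W" "W' \<noteq> {}" "d \<le> e"
  shows "ideal_gen (A d W) (nonunits x W) \<subseteq> ideal_gen (A e W') (nonunits x W')"
proof (rule ideal_gen_mono)
  have W: "W \<noteq> {}" using assms by auto
  show "is_subring (A d W)" "is_subring (A e W')" using assms W by (simp_all add: subring_A)
  show "A d W \<subseteq> A e W'" using A_mono[of W W' d] A_level_mono[of W' d e] assms by auto
  show "nonunits x W \<subseteq> A d W" "nonunits x W' \<subseteq> A e W'" using nonunits_subset assms W by auto
  show "nonunits x W \<subseteq> nonunits x W'" using A_mono[of W W' 0] assms by (auto simp: nonunits_def)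
qed

lemma in_fibre_stalk:
  "opn W \<Longrightarrow> x \<in> W \<Longrightarrow> s \<in> ideal_gen (A e W) (nonunits x W) \<Longrightarrow> s \<in> fibre_stalk e x"
  by (auto simp: fibre_stalk_def)

lemma fibre_stalkE:
  assumes "s \<in> fibre_stalk e x"
  obtains W where "opn W" "x \<in> W" "s \<in> ideal_gen (A e W) (nonunits x W)"
  using assms by (auto simp: fibre_stalk_def)

lemma fibre_stalk_level_mono:
  assumes "d \<le> e"
  shows "fibre_stalk d x \<subseteq> fibre_stalk e x"
proof
  fix s assume "s \<in> fibre_stalk d x"
  then obtain W where W: "opn W" "x \<in> W" "s \<in> ideal_gen (A d W) (nonunits x W)" by (rule fibre_stalkE)
  then have "s \<in> ideal_gen (A e W) (nonunits x W)" using nonunits_gen_mono[OF W(1,1) _ _ assms] by blast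
  then show "s \<in> fibre_stalk e x" using W in_fibre_stalk by blast
qed

lemma nonunit_in_fibre_stalk:
  assumes "f \<in> stalk 0 x" "f = 0 \<or> inverse f \<notin> stalk 0 x"
  shows "f \<in> fibre_stalk e x"
proof -
  obtain W where W: "opn W" "x \<in> W" "f \<in> A 0 W" using assms(1) by (rule stalkE)
  then have "f \<in> nonunits x W" using assms(2) by (simp add: nonunits_def)
  then show ?thesis using in_fibre_stalk[OF W(1,2)] ideal_gen_superset by blast
qed

text \<open>At points other than \<open>x\<close> the local condition holds automatically:
  \<open>V - {x}\<close> is open because \<open>x\<close> is closed, and over it the ideal of the
  point generates the unit ideal. Only the germ at \<open>x\<close> remains.\<close>

lemma frob_fibre_eq:
  assumes x: "closedin (pts X) {x}" and V: "opn V" "V \<noteq> {}"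
  shows "Fib e x V = {s \<in> A e V. x \<in> V \<longrightarrow> s \<in> fibre_stalk e x}"
proof -
  have gen: "Idl\<^bsub>sec (Fr e) W\<^esub> (frob_map \<iota> W ` ideal_of_point X x W) =
      (if x \<in> W then ideal_gen (A e W) (nonunits x W) else ideal_gen (A e W) (A 0 W))"
    if W: "opn W" "W \<noteq> {}" for W
  proof -
    have "frob_map \<iota> W ` ideal_of_point X x W = \<iota> W ` ideal_of_point X x W"
      using W by (auto simp: frob_map_def)
    also have "\<dots> = (if x \<in> W then nonunits x W else A 0 W)"
      unfolding iota_ideal_of_point[OF W] by (auto simp: nonunits_def)
    finally show ?thesis using genideal_ring_on[OF subring_A[OF W]] W by simp
  qed
  have one: "ideal_gen (A e W) (A 0 W) = A e W" if W: "opn W" "W \<noteq> {}" for W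
  proof -
    have id: "ideal_in (A e W) (ideal_gen (A e W) (A 0 W))"
      by (rule ideal_in_ideal_gen[OF subring_A[OF W] A_level_mono[OF W]]) simp
    have "1 \<in> ideal_gen (A e W) (A 0 W)"
      using ideal_gen_superset[of "A 0 W" "A e W"] is_subringD(1)[OF subring_A[OF W]] by blast
    then show ?thesis using ideal_inD(1,4)[OF id] by force
  qed
  have "(\<forall>y\<in>V. \<exists>W. opn W \<and> y \<in> W \<and> W \<subseteq> V \<and>
      res (Fr e) V W s \<in> Idl\<^bsub>sec (Fr e) W\<^esub> (frob_map \<iota> W ` ideal_of_point X x W)) \<longleftrightarrow>
      (x \<in> V \<longrightarrow> s \<in> fibre_stalk e x)" (is "?L \<longleftrightarrow> ?R") if s: "s \<in> A e V" for s
  proof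
    assume L: ?L
    show ?R
    proof
      assume "x \<in> V"
      then obtain W where W: "opn W" "x \<in> W"
        "res (Fr e) V W s \<in> Idl\<^bsub>sec (Fr e) W\<^esub> (frob_map \<iota> W ` ideal_of_point X x W)"
        using L by blast
      then have "W \<noteq> {}" by auto
      then have "s \<in> ideal_gen (A e W) (nonunits x W)"
        using W(2,3) gen[OF W(1)] by auto
      then show "s \<in> fibre_stalk e x" using W in_fibre_stalk by blast
    qed
  next
    assume R: ?R
    show ?L
    proof
      fix y assume y: "y \<in> V"
      show "\<exists>W. opn W \<and> y \<in> W \<and> W \<subseteq> V \<and>
          res (Fr e) V W s \<in> Idl\<^bsub>sec (Fr e) W\<^esub> (frob_map \<iota> W ` ideal_of_point X x W)"
      proof (cases "y = x")
        case True
        then obtain W where W: "opn W" "x \<in> W" "s \<in> ideal_gen (A e W) (nonunits x W)"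
          using R y by (auto elim: fibre_stalkE)
        have VW: "opn (V \<inter> W)" "V \<inter> W \<noteq> {}" using V W y True by auto
        then have "s \<in> ideal_gen (A e (V \<inter> W)) (nonunits x (V \<inter> W))"
          using nonunits_gen_mono[OF W(1) VW(1) _ VW(2) order_refl] W(3) by blast
        then have "res (Fr e) V (V \<inter> W) s \<in>
            Idl\<^bsub>sec (Fr e) (V \<inter> W)\<^esub> (frob_map \<iota> (V \<inter> W) ` ideal_of_point X x (V \<inter> W))"
          unfolding gen[OF VW] using W y True VW by simp
        then show ?thesis using VW W y True by (intro exI[of _ "V \<inter> W"]) auto
      next
        case False
        have VW: "opn (V - {x})" "V - {x} \<noteq> {}" using V x y False openin_diff by auto
        have "s \<in> A e (V - {x})" using A_mono[OF V(1) VW] s by auto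
        then have "res (Fr e) V (V - {x}) s \<in>
            Idl\<^bsub>sec (Fr e) (V - {x})\<^esub> (frob_map \<iota> (V - {x}) ` ideal_of_point X x (V - {x}))"
          unfolding gen[OF VW] one[OF VW] using VW by simp
        then show ?thesis using VW y False by (intro exI[of _ "V - {x}"]) auto
      qed
    qed
  qed
  then show ?thesis using V by (auto simp: frob_fibre_def scheme_fibre_def)
qed

lemma frob_fibre_empty: "Fib e x {} = {0}"
  by (simp add: frob_fibre_def scheme_fibre_def)

lemma frob_fibre_not_open: "\<not> opn V \<Longrightarrow> Fib e x V = {}"
  by (simp add: frob_fibre_def scheme_fibre_def)

lemma one_in_frob_fibre:
  assumes "closedin (pts X) {x}" "opn V" "V \<noteq> {}" "x \<notin> V"
  shows "1 \<in> Fib e x V"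
  using frob_fibre_eq[OF assms(1-3)] assms(4) is_subringD(1)[OF subring_A[OF assms(2,3)]] by simp

lemma ideal_stalk_frob_fibre:
  assumes x: "closedin (pts X) {x}"
  shows "ideal_stalk (Fib e x) x = fibre_stalk e x"
proof (intro equalityI subsetI)
  fix s assume "s \<in> ideal_stalk (Fib e x) x"
  then obtain U where U: "opn U" "x \<in> U" "s \<in> Fib e x U" by (rule ideal_stalkE)
  then have "U \<noteq> {}" by auto
  then show "s \<in> fibre_stalk e x" using frob_fibre_eq[OF x U(1)] U by auto
next
  fix s assume s: "s \<in> fibre_stalk e x"
  then obtain W where W: "opn W" "x \<in> W" "s \<in> ideal_gen (A e W) (nonunits x W)" by (rule fibre_stalkE)
  have ne: "W \<noteq> {}" using W by auto
  have "s \<in> A e W" using ideal_inD(1)[OF ideal_in_nonunits_gen[OF W(1) ne]] W(3) by blast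
  then have "s \<in> Fib e x W" using frob_fibre_eq[OF x W(1) ne] s by simp
  then show "s \<in> ideal_stalk (Fib e x) x" using W in_ideal_stalk by metis
qed

text \<open>Over the algebraically closed ground field \<open>g\<close> has a linear factor with
  root \<open>c\<close>. The element \<open>f - \<kappa> c\<close> is a nonunit of
  \<open>stalk 0 x\<close>, hence in \<open>J\<close>, or a unit, which can be cancelled from the
  relation to lower the degree. \<open>J\<close> need not be prime for this.\<close>

lemma eigenvalue_exists:
  fixes g :: "'k poly"
  assumes J: "ideal_in (stalk e x) J" and x: "x \<in> topspace (pts X)" and one: "1 \<notin> J"
    and nonunits: "\<And>f. f \<in> stalk 0 x \<Longrightarrow> f = 0 \<or> inverse f \<notin> stalk 0 x \<Longrightarrow> f \<in> J"
    and f: "f \<in> stalk 0 x" and g: "g \<noteq> 0" "poly (map_poly \<kappa> g) f \<in> J"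
  shows "\<exists>c. f - \<kappa> c \<in> J"
  using g
proof (induction "degree g" arbitrary: g)
  case 0
  then obtain a where a: "g = [:a:]" by (metis degree_eq_zeroE)
  then have "a \<noteq> 0" "\<kappa> a \<in> J" using 0 by (auto simp: map_poly_pCons)
  then have "\<kappa> (inverse a) * \<kappa> a \<in> J" using ideal_inD(4)[OF J emb_in_stalk[OF x]] by blast
  then show ?case using \<open>a \<noteq> 0\<close> one by (simp flip: emb_mult)
next
  case (Suc n)
  obtain c where "poly g c = 0" using alg_closed_imp_poly_has_root[of g] Suc(2) by auto
  then obtain g' where g': "g = [:- c, 1:] * g'" by (auto simp: poly_eq_0_iff_dvd)
  have "g' \<noteq> 0" using Suc.prems g' by auto
  then have "degree g = Suc (degree g')"
    using degree_mult_eq[of "[:- c, 1:]" g'] unfolding g' by (simp del: mult_pCons_left)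
  then have deg: "degree g' = n" using Suc(2) by simp
  have "map_poly \<kappa> g = map_poly \<kappa> (pCons 0 g') - smult (\<kappa> c) (map_poly \<kappa> g')"
    unfolding g' by (rule poly_eqI) (simp add: coeff_map_poly coeff_pCons emb_diff emb_mult split: nat.split)
  then have ev: "poly (map_poly \<kappa> g) f = (f - \<kappa> c) * poly (map_poly \<kappa> g') f"
    by (simp only:) (simp add: map_poly_pCons algebra_simps)
  show ?case
  proof (cases "f - \<kappa> c \<in> J")
    case False
    have fc: "f - \<kappa> c \<in> stalk 0 x"
      using is_subringD(3)[OF subring_stalk[OF x] f emb_in_stalk[OF x]] .
    then have u: "f - \<kappa> c \<noteq> 0" "inverse (f - \<kappa> c) \<in> stalk 0 x" using nonunits False by auto
    then have "inverse (f - \<kappa> c) \<in> stalk e x" using stalk_level_mono[of 0 e x] by auto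
    then have "inverse (f - \<kappa> c) * poly (map_poly \<kappa> g) f \<in> J" using ideal_inD(4)[OF J _ Suc.prems(2)] by blast
    then have "poly (map_poly \<kappa> g') f \<in> J" using u(1) by (simp add: ev flip: mult.assoc)
    then show ?thesis using Suc(1)[of g'] deg \<open>g' \<noteq> 0\<close> by auto
  qed blast
qed

lemma lc_powers: "lc cs (map (\<lambda>i. f ^ i) [0..<length cs]) = poly (map_poly \<kappa> (Poly cs)) f"
proof (induction cs)
  case (Cons c cs)
  have "lc (c # cs) (map (\<lambda>i. f ^ i) [0..<length (c # cs)]) =
      (\<Sum>i<Suc (length cs). \<kappa> ((c # cs) ! i) * f ^ i)"
    unfolding lc_def by (rule sum.cong) (auto simp del: upt_Suc)
  also have "\<dots> = \<kappa> c + f * lc cs (map (\<lambda>i. f ^ i) [0..<length cs])"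
    by (simp add: sum.lessThan_Suc_shift lc_def sum_distrib_left mult_ac del: sum.lessThan_Suc)
  finally show ?case by (simp add: Cons map_poly_pCons)
qed simp

text \<open>That the residue field of \<open>x\<close> is the ground field is deduced from finite
  length: the powers of \<open>f = s ^ (p ^ e)\<close> are linearly dependent modulo the fibre,
  which is a polynomial relation, and it yields a scalar congruent to \<open>f\<close>.\<close>

lemma frob_fibre_fat_point:
  assumes x: "closedin (pts X) {x}" and aff: "affine_open (Fr e) U" and b: "set b \<subseteq> A e U" "b \<noteq> []"
    and chart: "Fib e x \<in> Chart e U b"
  shows "x \<in> U" "fat_point e (Fib e x) x"
proof -
  let ?F = "Fib e x"
  have U: "opn U" "U \<noteq> {}" by (rule affine_opn[OF aff], rule hilb_chart_nonempty[OF chart b(2)])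
  have I: "closed_subscheme (Fr e) ?F" and basis: "basis_mod (A e U) (?F U) b"
    using chart hilb_chart_Fr_iff[OF U b(1)] by auto
  have xt: "x \<in> topspace (pts X)" using x closedin_subset by blast
  note J = ideal_in_ideal_stalk[OF I xt, unfolded ideal_stalk_frob_fibre[OF x]]
  note F = frob_fibre_eq[OF x U]
  note R = is_subringD[OF subring_A[OF U, of e]]
  have one: "1 \<notin> ?F U"
  proof
    assume "1 \<in> ?F U"
    then have "A e U \<subseteq> ?F U" using ideal_inD(4)[OF closed_subscheme_ideal[OF I U], of _ 1] by auto
    then show False using unit_ideal_not_indep_mod[of "?F U" b] basis b by (auto simp: basis_mod_def)
  qed
  show xU: "x \<in> U" using one one_in_frob_fibre[OF x U] by blast
  have one': "1 \<notin> fibre_stalk e x" using one F xU R(1) by blast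
  have "\<exists>c. s ^ (p ^ e) - \<kappa> c \<in> ?F U" if s: "s \<in> A e U" for s
  proof -
    define f where "f = s ^ (p ^ e)"
    have f: "f \<in> A 0 U" using s A_power_iff[of s e 0 U] by (simp add: f_def)
    have fe: "f \<in> A e U" using R(7)[OF s] by (simp add: f_def)
    \<comment> \<open>One power more than the length of the fibre, which forces a relation.\<close>
    define fs where "fs = map (\<lambda>i. f ^ i) [0..<Suc (length b)]"
    have "set fs \<subseteq> A e U" using R(7)[OF fe] by (auto simp: fs_def)
    then have "\<not> indep_mod (?F U) fs"
      using indep_mod_length_le[OF _ subspace_closed_subscheme[OF I U], of fs "A e U" b] basis
      by (auto simp: basis_mod_def fs_def)
    then obtain cs i where cs: "length cs = length fs" "lc cs fs \<in> ?F U" "i < length fs" "cs ! i \<noteq> 0"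
      by (auto simp: indep_mod_def)
    have "poly (map_poly \<kappa> (Poly cs)) f \<in> fibre_stalk e x"
      using lc_powers[of cs f] cs(1,2) F xU by (simp add: fs_def)
    moreover have "coeff (Poly cs) i \<noteq> 0" using cs by (simp add: nth_default_def)
    then have "Poly cs \<noteq> 0" by (metis coeff_0)
    ultimately obtain c where "f - \<kappa> c \<in> fibre_stalk e x"
      using eigenvalue_exists[OF J xt one' nonunit_in_fibre_stalk in_stalk[OF U(1) xU f]] by blast
    moreover have "f - \<kappa> c \<in> A e U" by (rule R(3)[OF fe emb_in_A[OF U]])
    ultimately show ?thesis using F unfolding f_def by blast
  qed
  then obtain y where y: "y \<in> U" "fat_point e ?F y" using fat_point_exists[OF aff b chart] by metis
  \<comment> \<open>The supporting point was found abstractly, as a prime ideal. It must be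
    \<open>x\<close>, because the fibre ideal contains 1 on \<open>U - {x}\<close>.\<close>
  have "y = x"
  proof (rule ccontr)
    assume yx: "y \<noteq> x"
    then have V: "opn (U - {x})" "y \<in> U - {x}" using U x y openin_diff by auto
    then have "1 \<in> ?F (U - {x})" using one_in_frob_fibre[OF x V(1)] by blast
    then show False using in_ideal_stalk[OF V] fat_pointD(4)[OF y(2)] by blast
  qed
  then show "fat_point e ?F x" using y by simp
qed

text \<open>A map on the sections over the single open set \<open>W\<close> takes the place of a map
  of sheaves. The last clause records what compatibility with smaller neighbourhoods gives for the
  ideals of the fibres.\<close>

definition frobenius_splitting :: "nat \<Rightarrow> 'x set \<Rightarrow> ('l \<Rightarrow> 'l) \<Rightarrow> bool" where
  "frobenius_splitting e W \<psi> \<longleftrightarrow>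
     (\<forall>s\<in>A (Suc e) W. \<psi> s \<in> A e W) \<and>
     (\<forall>s\<in>A (Suc e) W. \<forall>t\<in>A (Suc e) W. \<psi> (s + t) = \<psi> s + \<psi> t) \<and>
     (\<forall>a\<in>A e W. \<forall>s\<in>A (Suc e) W. \<psi> (a * s) = a * \<psi> s) \<and>
     (\<forall>a\<in>A e W. \<psi> a = a) \<and>
     (\<forall>x\<in>W. \<forall>s\<in>A (Suc e) W \<inter> fibre_stalk (Suc e) x. \<psi> s \<in> fibre_stalk e x)"

text \<open>F-purity supplies the splitting for roots of order \<open>p\<close>. Conjugating it by
  the \<open>p ^ e\<close>-th power map moves it to level \<open>e\<close>, and every identity is
  checked after taking \<open>p ^ e\<close>-th powers, which is injective.\<close>

lemma frobenius_splitting_exists: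
  assumes pure: "F_pure X \<iota>" and x0: "x0 \<in> topspace (pts X)"
  shows "\<exists>U. opn U \<and> x0 \<in> U \<and> (\<forall>W. opn W \<and> W \<noteq> {} \<and> W \<subseteq> U \<longrightarrow> (\<exists>\<psi>. frobenius_splitting e W \<psi>))"
proof -
  obtain U \<phi> where U: "opn U" "x0 \<in> U"
    and 1: "\<forall>V. opn V \<and> V \<subseteq> U \<longrightarrow>
           \<phi> V \<in> carrier (sec (Fr 1) V) \<rightarrow> carrier (sec X V) \<and>
           (\<forall>s\<in>carrier (sec (Fr 1) V). \<forall>t\<in>carrier (sec (Fr 1) V).
              \<phi> V (s \<oplus>\<^bsub>sec (Fr 1) V\<^esub> t) = \<phi> V s \<oplus>\<^bsub>sec X V\<^esub> \<phi> V t) \<and>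
           (\<forall>a\<in>carrier (sec X V). \<forall>s\<in>carrier (sec (Fr 1) V).
              \<phi> V (frob_map \<iota> V a \<otimes>\<^bsub>sec (Fr 1) V\<^esub> s) = a \<otimes>\<^bsub>sec X V\<^esub> \<phi> V s) \<and>
           (\<forall>a\<in>carrier (sec X V). \<phi> V (frob_map \<iota> V a) = a)"
    and 2: "\<forall>V W. opn V \<and> opn W \<and> W \<subseteq> V \<and> V \<subseteq> U \<longrightarrow>
           (\<forall>s\<in>carrier (sec (Fr 1) V). res X V W (\<phi> V s) = \<phi> W (res (Fr 1) V W s))"
    using bspec[OF pure[unfolded F_pure_def Let_def] x0]
    by (elim exE conjE) (rule that)
  note \<phi> = 1[THEN spec, THEN mp, OF conjI]
  have \<phi>_res: "res X V W (\<phi> V s) = \<phi> W (res (Fr 1) V W s)"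
    if "opn V" "opn W" "W \<subseteq> V" "V \<subseteq> U" "s \<in> carrier (sec (Fr 1) V)" for V W s
    using 2 that by (simp only: simp_thms)
  define q where "q = p ^ e"
  \<comment> \<open>Roots of order \<open>q\<close> exist and are unique in the field, so the choice
    is canonical.\<close>
  define root where "root w = (SOME y::'l. y ^ q = w)" for w
  have root: "root w ^ q = w" for w
    unfolding root_def q_def by (rule someI_ex[OF frob_surj])
  define \<psi> where "\<psi> V z = root (\<iota> V (\<phi> V (z ^ q)))" for V z
  have \<psi>: "\<psi> V z ^ q = \<iota> V (\<phi> V (z ^ q))" for V z
    unfolding \<psi>_def by (rule root)
  have inj: "y ^ q = z ^ q \<Longrightarrow> y = z" for y z :: 'l
    unfolding q_def by (rule frob_inj)
  have A1: "z ^ q \<in> A 1 V \<longleftrightarrow> z \<in> A (Suc e) V" and A0: "z ^ q \<in> A 0 V \<longleftrightarrow> z \<in> A e V" for z V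
    unfolding q_def using A_power_iff[of z e 1 V] A_power_iff[of z e 0 V] by simp_all
  have \<phi>1: "\<phi> V s \<in> carrier (sec X V)" if "opn V" "V \<subseteq> U" "V \<noteq> {}" "s \<in> A 1 V" for V s
    using \<phi>[OF that(1,2)] that by auto
  have closed: "\<psi> V z \<in> A e V" if V: "opn V" "V \<subseteq> U" "V \<noteq> {}" "z \<in> A (Suc e) V" for V z
    unfolding A0[symmetric] \<psi> A_0 using \<phi>1[OF V(1-3)] A1 V(4) by blast
  have add: "\<psi> V (s + t) = \<psi> V s + \<psi> V t"
    if V: "opn V" "V \<subseteq> U" "V \<noteq> {}" and st: "s \<in> A (Suc e) V" "t \<in> A (Suc e) V" for V s t
  proof (rule inj)
    have "\<phi> V (s ^ q + t ^ q) = \<phi> V (s ^ q) \<oplus>\<^bsub>sec X V\<^esub> \<phi> V (t ^ q)"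
      using \<phi>[OF V(1,2)] V st A1 by auto
    then have "\<iota> V (\<phi> V (s ^ q + t ^ q)) = \<iota> V (\<phi> V (s ^ q)) + \<iota> V (\<phi> V (t ^ q))"
      using ring_hom_add[OF iota_hom[OF V(1,3)] \<phi>1[OF V] \<phi>1[OF V]] A1 st by auto
    then show "\<psi> V (s + t) ^ q = (\<psi> V s + \<psi> V t) ^ q"
      using \<psi> by (simp add: q_def frob_add)
  qed
  have scale: "\<psi> V (a * s) = a * \<psi> V s"
    if V: "opn V" "V \<subseteq> U" "V \<noteq> {}" and st: "a \<in> A e V" "s \<in> A (Suc e) V" for V a s
  proof (rule inj)
    obtain a0 where a0: "a0 \<in> carrier (sec X V)" "a ^ q = \<iota> V a0" using st(1) A0[of a V] by (auto simp: A_0)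
    have "\<phi> V (\<iota> V a0 * s ^ q) = a0 \<otimes>\<^bsub>sec X V\<^esub> \<phi> V (s ^ q)"
      using \<phi>[OF V(1,2)] V st a0 A1 by (auto simp: frob_map_def)
    then have "\<iota> V (\<phi> V (\<iota> V a0 * s ^ q)) = \<iota> V a0 * \<iota> V (\<phi> V (s ^ q))"
      using ring_hom_mult[OF iota_hom[OF V(1,3)] a0(1) \<phi>1[OF V]] A1 st by auto
    then show "\<psi> V (a * s) ^ q = (a * \<psi> V s) ^ q"
      using \<psi> a0 by (simp add: power_mult_distrib)
  qed
  have ident: "\<psi> V a = a" if V: "opn V" "V \<subseteq> U" "V \<noteq> {}" and a: "a \<in> A e V" for V a
  proof (rule inj)
    obtain a0 where a0: "a0 \<in> carrier (sec X V)" "a ^ q = \<iota> V a0" using a A0[of a V] by (auto simp: A_0)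
    then have "\<phi> V (a ^ q) = a0" using \<phi>[OF V(1,2)] V by (auto simp: frob_map_def)
    then show "\<psi> V a ^ q = a ^ q" using \<psi> a0 by simp
  qed
  have compat: "\<psi> V z = \<psi> W z"
    if V: "opn V" "V \<subseteq> U" and W: "opn W" "W \<subseteq> V" "W \<noteq> {}" and z: "z \<in> A (Suc e) V" for V W z
  proof (rule inj)
    have ne: "V \<noteq> {}" using W by auto
    have z1: "z ^ q \<in> A 1 V" using z A1 by simp
    have "\<iota> W (res X V W (\<phi> V (z ^ q))) = \<iota> V (\<phi> V (z ^ q))"
      by (rule iota_res[OF V(1) W(1,3,2) \<phi>1[OF V ne z1]])
    moreover have "res X V W (\<phi> V (z ^ q)) = \<phi> W (z ^ q)"
      using \<phi>_res[OF V(1) W(1,2) V(2), of "z ^ q"] z1 ne W(3) by simp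
    ultimately show "\<psi> V z ^ q = \<psi> W z ^ q" using \<psi> by simp
  qed
  have fibre: "\<psi> W s \<in> fibre_stalk e x"
    if W: "opn W" "W \<subseteq> U" and x: "x \<in> W" and s: "s \<in> A (Suc e) W" "s \<in> fibre_stalk (Suc e) x" for W x s
  proof -
    obtain W' where W': "opn W'" "x \<in> W'" "s \<in> ideal_gen (A (Suc e) W') (nonunits x W')"
      using s(2) by (rule fibre_stalkE)
    define V where "V = W \<inter> W'"
    have V: "opn V" "V \<subseteq> U" "V \<noteq> {}" "V \<subseteq> W" "V \<subseteq> W'" "x \<in> V" using W W' x by (auto simp: V_def)
    have sV: "s \<in> ideal_gen (A (Suc e) V) (nonunits x V)"
      using nonunits_gen_mono[OF W'(1) V(1,5,3) order_refl] W'(3) by blast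
    define N where "N = ideal_gen (A e V) (nonunits x V)"
    have N: "ideal_in (A e V) N" unfolding N_def by (rule ideal_in_nonunits_gen[OF V(1,3)])
    note R1 = is_subringD[OF subring_A[OF V(1,3), of "Suc e"]]
    \<comment> \<open>The splitting is linear only over level \<open>e\<close>. Quantifying over all
      multipliers \<open>a\<close> of level \<open>Suc e\<close> makes \<open>Q\<close> an ideal
      there, so it suffices to check that it contains the generators, which have level 0.\<close>
    define Q where "Q = {s \<in> A (Suc e) V. \<forall>a\<in>A (Suc e) V. \<psi> V (a * s) \<in> N}"
    have "ideal_in (A (Suc e) V) Q"
      unfolding ideal_in_def
    proof (intro conjI ballI)
      show "0 \<in> Q"
        using R1(2) ident[OF V(1-3) is_subringD(2)[OF subring_A[OF V(1,3)]]] ideal_inD(2)[OF N] by (simp add: Q_def)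
    next
      fix s t assume "s \<in> Q" "t \<in> Q"
      then show "s + t \<in> Q"
        using R1(4,6) ideal_inD(3)[OF N] by (auto simp: Q_def distrib_left add[OF V(1-3)])
    next
      fix a s assume "a \<in> A (Suc e) V" "s \<in> Q"
      then show "a * s \<in> Q"
        using R1(4) by (auto simp: Q_def simp flip: mult.assoc)
    qed (auto simp: Q_def)
    moreover have "nonunits x V \<subseteq> Q"
    proof
      fix f assume f: "f \<in> nonunits x V"
      then have fA: "f \<in> A e V" "f \<in> A (Suc e) V" using nonunits_subset[OF V(1,3)] by auto
      have "f \<in> N" using f ideal_gen_superset unfolding N_def by blast
      have "\<psi> V (a * f) \<in> N" if a: "a \<in> A (Suc e) V" for a
        using scale[OF V(1-3) fA(1) a] ideal_inD(5)[OF N closed[OF V(1-3) a] \<open>f \<in> N\<close>] by (simp add: mult.commute)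
      then show "f \<in> Q" using fA by (simp add: Q_def)
    qed
    ultimately have "ideal_gen (A (Suc e) V) (nonunits x V) \<subseteq> Q"
      by (rule ideal_gen_minimal)
    then have "\<psi> V (1 * s) \<in> N" using sV R1(1) unfolding Q_def by blast
    then have "\<psi> W s \<in> N" using compat[OF W V(1,4,3) s(1)] by simp
    then show ?thesis unfolding N_def using in_fibre_stalk[OF V(1,6)] by blast
  qed
  have "frobenius_splitting e W (\<psi> W)" if "opn W" "W \<noteq> {}" "W \<subseteq> U" for W
    unfolding frobenius_splitting_def using that closed add scale ident fibre by auto
  then show ?thesis using U by blast
qed

section \<open>The length of the fibre over a smooth point\<close>

text \<open>This moves the regularity condition from sections to subrings of the field, where roots
  of the generators can be taken. Injectivity of \<open>\<iota> U\<close> preserves their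
  number.\<close>

lemma smooth_generators:
  assumes "smooth_closed_point X x"
  shows "\<exists>T. finite T \<and> card T = krull_dim (pts X) \<and>
    (\<forall>t\<in>T. t \<in> stalk 0 x \<and> (t = 0 \<or> inverse t \<notin> stalk 0 x)) \<and>
    (\<forall>f\<in>stalk 0 x. f = 0 \<or> inverse f \<notin> stalk 0 x \<longrightarrow>
      (\<exists>r. (\<forall>t\<in>T. r t \<in> stalk 0 x) \<and> f = (\<Sum>t\<in>T. r t * t)))"
proof -
  obtain U T where U: "opn U" "x \<in> U" and T: "T \<subseteq> ideal_of_point X x U" "finite T" "card T = krull_dim (pts X)"
    and gen: "\<forall>V s. opn V \<and> x \<in> V \<and> s \<in> ideal_of_point X x V \<longrightarrow>
           (\<exists>W. opn W \<and> x \<in> W \<and> W \<subseteq> U \<inter> V \<and> res X V W s \<in> Idl\<^bsub>sec X W\<^esub> (res X U W ` T))"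
    using assms unfolding smooth_closed_point_def by (elim conjE exE)
  have Une: "U \<noteq> {}" using U by auto
  have Tc: "T \<subseteq> carrier (sec X U)" using T(1) by (auto simp: ideal_of_point_def)
  define T' where "T' = \<iota> U ` T"
  have T'1: "finite T'" "card T' = krull_dim (pts X)"
    using T card_image[OF inj_on_subset[OF iota_inj[OF U(1) Une] Tc]] by (auto simp: T'_def)
  have T'2: "t \<in> stalk 0 x \<and> (t = 0 \<or> inverse t \<notin> stalk 0 x)" if "t \<in> T'" for t
  proof -
    have "t \<in> \<iota> U ` ideal_of_point X x U" using that T(1) by (auto simp: T'_def)
    then show ?thesis unfolding iota_ideal_of_point[OF U(1) Une] using U by (auto intro: in_stalk)
  qed
  have T'3: "\<exists>r. (\<forall>t\<in>T'. r t \<in> stalk 0 x) \<and> f = (\<Sum>t\<in>T'. r t * t)"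
    if f: "f \<in> stalk 0 x" "f = 0 \<or> inverse f \<notin> stalk 0 x" for f
  proof -
    obtain V where V: "opn V" "x \<in> V" "f \<in> A 0 V" using f(1) by (rule stalkE)
    have Vne: "V \<noteq> {}" using V by auto
    have "f \<in> \<iota> V ` ideal_of_point X x V" unfolding iota_ideal_of_point[OF V(1) Vne] using V f by auto
    then obtain s where s: "s \<in> ideal_of_point X x V" "f = \<iota> V s" by auto
    then have sc: "s \<in> carrier (sec X V)" by (auto simp: ideal_of_point_def)
    obtain W where W: "opn W" "x \<in> W" "W \<subseteq> U \<inter> V" "res X V W s \<in> Idl\<^bsub>sec X W\<^esub> (res X U W ` T)"
      using gen V s by blast
    have ne: "W \<noteq> {}" "W \<subseteq> U" "W \<subseteq> V" using W by auto
    have T'W: "T' \<subseteq> A 0 W" using Tc iota_mono[OF U(1) W(1) ne(1,2)] unfolding T'_def A_0 by auto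
    interpret W: cring "sec X W" by (rule cring_sec[OF W(1)])
    interpret L: cring "ring_on (A 0 W)" by (rule cring_ring_on[OF subring_A[OF W(1) ne(1)]])
    have "\<iota> W \<in> ring_hom (sec X W) (ring_on (A 0 W))"
      using iota_hom[OF W(1) ne(1)] by (auto simp: ring_hom_def A_0)
    then interpret h: ring_hom_ring "sec X W" "ring_on (A 0 W)" "\<iota> W"
      by (rule ring_hom_ringI2[OF W.ring_axioms L.ring_axioms])
    \<comment> \<open>The preimage of \<open>J\<close> under \<open>\<iota> W\<close> is an ideal of
      sections that contains the restricted generators, hence everything they generate.\<close>
    define J where "J = ideal_gen (A 0 W) T'"
    have "ideal J (ring_on (A 0 W))"
      unfolding J_def using ideal_in_ideal_gen[OF subring_A[OF W(1) ne(1)] T'W]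
        ideal_ring_on_iff[OF subring_A[OF W(1) ne(1)]] by blast
    then have "ideal {r \<in> carrier (sec X W). \<iota> W r \<in> J} (sec X W)" by (rule h.ideal_vimage)
    moreover have "res X U W ` T \<subseteq> {r \<in> carrier (sec X W). \<iota> W r \<in> J}"
    proof
      fix r assume "r \<in> res X U W ` T"
      then obtain t where t: "t \<in> T" "r = res X U W t" by auto
      then have "\<iota> W r = \<iota> U t" "r \<in> carrier (sec X W)"
        using iota_res[OF U(1) W(1) ne(1,2)] ring_hom_closed[OF res_hom[OF U(1) W(1) ne(2)]] Tc by auto
      moreover have "\<iota> U t \<in> J" using t ideal_gen_superset unfolding J_def T'_def by blast
      ultimately show "r \<in> {r \<in> carrier (sec X W). \<iota> W r \<in> J}" by simp
    qed
    ultimately have "res X V W s \<in> {r \<in> carrier (sec X W). \<iota> W r \<in> J}"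
      using W.genideal_minimal W(4) by blast
    then have "f \<in> J" using iota_res[OF V(1) W(1) ne(1,3) sc] s by simp
    then obtain r where "\<forall>t\<in>T'. r t \<in> A 0 W" "f = (\<Sum>t\<in>T'. r t * t)"
      unfolding J_def using ideal_gen_finite[OF subring_A[OF W(1) ne(1)] T'1(1) T'W] by blast
    then show ?thesis using in_stalk[OF W(1,2)] by blast
  qed
  show ?thesis using T'1 T'2 T'3 by (intro exI[of _ T']) blast
qed

lemma fibre_stalk_ideal: "closedin (pts X) {x} \<Longrightarrow> closed_subscheme (Fr e) (Fib e x) \<Longrightarrow>
    ideal_in (stalk e x) (fibre_stalk e x)"
  using ideal_in_ideal_stalk[of e "Fib e x" x] closedin_subset[of "pts X" "{x}"]
    ideal_stalk_frob_fibre[of x e] by simp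

text \<open>
  If \<open>T\<close> generates the maximal ideal, the monomials in the \<open>p\<^sup>e\<close>-th roots of \<open>T\<close> with exponents
  less than \<open>p\<^sup>e\<close> span the fibre of \<open>F\<^sub>e\<close>, which gives an upper bound for its length.  At level
  \<open>e + 1\<close> these monomials are products of monomials with exponents less than \<open>p\<close> and elements
  of level \<open>e\<close>, so the length at level \<open>e + 1\<close> bounds the length at level \<open>e\<close> from below.
\<close>

lemma length_frob_fibre:
  assumes x: "smooth_closed_point X x"
    and cl: "closed_subscheme (Fr e) (Fib e x)"
    and fat: "fat_point (Suc e) (Fib (Suc e) x) x"
    and c: "basis_mod (stalk (Suc e) x) (fibre_stalk (Suc e) x) c"
      "length c = p ^ (Suc e * krull_dim (pts X))"
    and b: "basis_mod (stalk e x) (fibre_stalk e x) b"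
  shows "length b = p ^ (e * krull_dim (pts X))"
proof -
  define d where "d = krull_dim (pts X)"
  have cx: "closedin (pts X) {x}" using x by (simp add: smooth_closed_point_def)
  then have xt: "x \<in> topspace (pts X)" using closedin_subset by blast
  have cl': "closed_subscheme (Fr (Suc e)) (Fib (Suc e) x)" by (rule fat_pointD(1)[OF fat])
  obtain T where "finite T \<and> card T = d \<and>
    (\<forall>t\<in>T. t \<in> stalk 0 x \<and> (t = 0 \<or> inverse t \<notin> stalk 0 x)) \<and>
    (\<forall>f\<in>stalk 0 x. f = 0 \<or> inverse f \<notin> stalk 0 x \<longrightarrow>
      (\<exists>r. (\<forall>t\<in>T. r t \<in> stalk 0 x) \<and> f = (\<Sum>t\<in>T. r t * t)))"
    using smooth_generators[OF x] unfolding d_def by (rule exE)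
  then have T: "finite T" "card T = d"
    and Tn: "\<And>t. t \<in> T \<Longrightarrow> t \<in> stalk 0 x \<and> (t = 0 \<or> inverse t \<notin> stalk 0 x)"
    and Tg: "\<And>f. f \<in> stalk 0 x \<Longrightarrow> f = 0 \<or> inverse f \<notin> stalk 0 x \<Longrightarrow>
      \<exists>r. (\<forall>t\<in>T. r t \<in> stalk 0 x) \<and> f = (\<Sum>t\<in>T. r t * t)"
    by blast+
  define y where "y n t = (SOME y::'l. y ^ (p ^ n) = t)" for n t
  have y: "y n t ^ (p ^ n) = t" for n t
    unfolding y_def by (rule someI_ex[OF frob_surj])
  have ys: "y n t \<in> stalk n x" if "t \<in> stalk 0 x" for n t
    using stalk_power_iff[of "y n t" n 0 x] y that by simp
  note N' = fibre_stalk_ideal[OF cx cl'] and N = fibre_stalk_ideal[OF cx cl]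
  have one: "1 \<notin> fibre_stalk (Suc e) x"
    using fat_pointD(4)[OF fat] ideal_stalk_frob_fibre[OF cx] by simp
  \<comment> \<open>The residue field at \<open>x\<close> is read off from the fat point of level
    \<open>Suc e\<close>: a power of \<open>f\<close> is congruent to a scalar, and subtracting the
    root of that scalar leaves an element with a power in a proper ideal, hence no unit.\<close>
  have residue: "\<exists>c. f - \<kappa> c = 0 \<or> inverse (f - \<kappa> c) \<notin> stalk 0 x" if f: "f \<in> stalk 0 x" for f
  proof -
    have "f \<in> stalk (Suc e) x" using f stalk_level_mono[of 0 "Suc e" x] by auto
    then obtain c where c: "f ^ (p ^ Suc e) - \<kappa> c \<in> fibre_stalk (Suc e) x"
      using fat_pointD(5)[OF fat] ideal_stalk_frob_fibre[OF cx] by metis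
    obtain a where a: "a ^ (p ^ Suc e) = c" using nth_root_exists[OF pe_pos[of "Suc e"], of c] by blast
    then have fa: "(f - \<kappa> a) ^ (p ^ Suc e) \<in> fibre_stalk (Suc e) x"
      using c by (simp only: frob_diff a[symmetric] emb_power)
    have "f - \<kappa> a = 0 \<or> inverse (f - \<kappa> a) \<notin> stalk 0 x"
    proof (rule ccontr)
      assume "\<not> (f - \<kappa> a = 0 \<or> inverse (f - \<kappa> a) \<notin> stalk 0 x)"
      then have u: "f - \<kappa> a \<noteq> 0" "inverse (f - \<kappa> a) \<in> stalk (Suc e) x"
        using stalk_level_mono[of 0 "Suc e" x] by auto
      have "inverse (f - \<kappa> a) ^ (p ^ Suc e) * (f - \<kappa> a) ^ (p ^ Suc e) \<in> fibre_stalk (Suc e) x"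
        using ideal_inD(4)[OF N' is_subringD(7)[OF subring_stalk[OF xt] u(2)] fa] .
      then show False using one u(1) by (simp flip: power_mult_distrib)
    qed
    then show ?thesis ..
  qed
  have span: "\<exists>v\<in>vs.span (monomials (y n) T (p ^ n)). s - v \<in> fibre_stalk n x"
    if N: "ideal_in (stalk n x) (fibre_stalk n x)" and s: "s \<in> stalk n x" for n s
  proof (rule monomials_span_mod[OF subring_stalk[OF xt] emb_in_stalk[OF xt] N T(1) _ _ _ s])
    fix t assume t: "t \<in> T"
    show "y n t \<in> stalk n x" using ys Tn[OF t] by blast
    show "y n t ^ (p ^ n) \<in> fibre_stalk n x" unfolding y using nonunit_in_fibre_stalk Tn[OF t] by blast
  next
    fix s assume s: "s \<in> stalk n x"
    have "s ^ (p ^ n) \<in> stalk 0 x" using stalk_power_iff[of s n 0 x] s by simp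
    then obtain c where c: "s ^ (p ^ n) - \<kappa> c = 0 \<or> inverse (s ^ (p ^ n) - \<kappa> c) \<notin> stalk 0 x"
      using residue by blast
    have "s ^ (p ^ n) - \<kappa> c \<in> stalk 0 x"
      using is_subringD(3)[OF subring_stalk[OF xt] \<open>s ^ (p ^ n) \<in> stalk 0 x\<close> emb_in_stalk[OF xt]] .
    then obtain r where r: "\<forall>t\<in>T. r t \<in> stalk 0 x" "s ^ (p ^ n) - \<kappa> c = (\<Sum>t\<in>T. r t * t)"
      using Tg c by blast
    obtain a where a: "a ^ (p ^ n) = c" using nth_root_exists[OF pe_pos[of n], of c] by blast
    \<comment> \<open>The expansion of \<open>s ^ (p ^ n)\<close> at level 0 in the generators
      \<open>T\<close> becomes an expansion of \<open>s\<close> by extracting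
      \<open>p ^ n\<close>-th roots termwise, as Frobenius is additive and injective.\<close>
    have "(s - \<kappa> a) ^ (p ^ n) = (\<Sum>t\<in>T. y n (r t) * y n t) ^ (p ^ n)"
      unfolding frob_diff frob_sum power_mult_distrib y using r(2) a by (simp add: emb_power[symmetric])
    then have "s - \<kappa> a = (\<Sum>t\<in>T. y n (r t) * y n t)" by (rule frob_inj)
    then have "s - \<kappa> a - (\<Sum>t\<in>T. y n (r t) * y n t) \<in> fibre_stalk n x"
      using ideal_inD(2)[OF N] by simp
    then show "\<exists>c r. (\<forall>t\<in>T. r t \<in> stalk n x) \<and> s - \<kappa> c - (\<Sum>t\<in>T. r t * y n t) \<in> fibre_stalk n x"
      using ys r(1) by (intro exI[of _ a] exI[of _ "\<lambda>t. y n (r t)"]) auto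
  qed
  have sub: "vs.subspace (fibre_stalk n x)" if "ideal_in (stalk n x) (fibre_stalk n x)" for n
    using subspace_subring[OF subring_stalk[OF xt] emb_in_stalk[OF xt] that] .
  have "length b \<le> card (monomials (y e) T (p ^ e))"
    using b span[OF N] by (intro indep_mod_bound[OF _ sub[OF N] finite_monomials[OF T(1)]])
      (auto simp: basis_mod_def subset_iff)
  also have "\<dots> \<le> (p ^ e) ^ d" using card_monomials[OF T(1)] T(2) by metis
  finally have upper: "length b \<le> p ^ (e * d)" by (simp add: power_mult)
  \<comment> \<open>Exponents are divided by \<open>p\<close> with remainder. The remainders give
    the first factor; the remaining part is a product of powers of \<open>y (Suc e) t ^ p\<close>,
    which has level \<open>e\<close> and is expanded in \<open>b\<close>.\<close>
  define G where "G = (\<lambda>(a, i). (\<Prod>t\<in>T. y (Suc e) t ^ a t) * b ! i) ` (PiE T (\<lambda>_. {..<p}) \<times> {..<length b})"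
  have finG: "finite G" unfolding G_def using T(1) by (simp add: finite_PiE)
  have "card G \<le> card (PiE T (\<lambda>_. {..<p}) \<times> {..<length b})"
    unfolding G_def using T(1) by (intro card_image_le) (simp add: finite_PiE)
  then have cardG: "card G \<le> p ^ d * length b" using T by (simp add: card_cartesian_product card_PiE)
  have mono: "\<exists>w\<in>vs.span G. m - w \<in> fibre_stalk (Suc e) x" if mon: "m \<in> monomials (y (Suc e)) T (p ^ Suc e)" for m
  proof -
    obtain a where a: "a \<in> PiE T (\<lambda>_. {..<p ^ Suc e})" "m = (\<Prod>t\<in>T. y (Suc e) t ^ a t)"
      using mon by (auto simp: monomials_def)
    define u where "u = (\<Prod>t\<in>T. y (Suc e) t ^ (a t mod p))"
    define v where "v = (\<Prod>t\<in>T. (y (Suc e) t ^ p) ^ (a t div p))"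
    have m: "m = u * v"
      unfolding a(2) u_def v_def by (simp flip: prod.distrib power_mult power_add)
    have "y (Suc e) t ^ p \<in> stalk e x" if "t \<in> T" for t
      using stalk_power_iff[of "y (Suc e) t" 1 e x] ys[of t "Suc e"] Tn[OF that] by simp
    then have "v \<in> stalk e x"
      unfolding v_def using is_subringD(7)[OF subring_stalk[OF xt, of e]]
      by (intro is_subring_prod[OF subring_stalk[OF xt]]) blast
    then obtain cs where cs: "length cs = length b" "v - lc cs b \<in> fibre_stalk e x"
      using b by (auto simp: basis_mod_def spans_mod_def)
    have uS: "u \<in> stalk (Suc e) x"
      unfolding u_def using Tn ys[of _ "Suc e"] is_subringD(7)[OF subring_stalk[OF xt, of "Suc e"]]
      by (intro is_subring_prod[OF subring_stalk[OF xt]]) blast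
    have "u * (v - lc cs b) \<in> fibre_stalk (Suc e) x"
      using ideal_inD(4)[OF N' uS] fibre_stalk_level_mono[of e "Suc e" x] cs(2) by auto
    then have "m - u * lc cs b \<in> fibre_stalk (Suc e) x" by (simp add: m right_diff_distrib)
    moreover have "u * lc cs b \<in> vs.span G"
    proof (rule span_mult[OF lc_in_span])
      fix z assume "z \<in> set b"
      then obtain i where i: "i < length b" "z = b ! i" by (metis in_set_conv_nth)
      have "u = (\<Prod>t\<in>T. y (Suc e) t ^ restrict (\<lambda>t. a t mod p) T t)"
        unfolding u_def by (rule prod.cong) auto
      moreover have "restrict (\<lambda>t. a t mod p) T \<in> PiE T (\<lambda>_. {..<p})" by auto
      ultimately have "u * z \<in> G"
        unfolding G_def using i by (intro image_eqI[of _ _ "(restrict (\<lambda>t. a t mod p) T, i)"]) auto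
      then show "u * z \<in> vs.span G" by (rule vs.span_base)
    qed
    ultimately show ?thesis by blast
  qed
  have G': "\<exists>w\<in>vs.span G. s - w \<in> fibre_stalk (Suc e) x" if s: "s \<in> stalk (Suc e) x" for s
  proof -
    obtain v where v: "v \<in> vs.span (monomials (y (Suc e)) T (p ^ Suc e))" "s - v \<in> fibre_stalk (Suc e) x"
      using span[OF N' s] by blast
    obtain w where w: "w \<in> vs.span G" "v - w \<in> fibre_stalk (Suc e) x" 
      using span_mod_trans[OF sub[OF N'] mono v(1)] by blast
    have "(s - v) + (v - w) \<in> fibre_stalk (Suc e) x" using ideal_inD(3)[OF N'] v(2) w(2) by blast
    then show ?thesis using w by auto
  qed
  have "length c \<le> card G"
    using c(1) G' by (intro indep_mod_bound[OF _ sub[OF N'] finG]) (auto simp: basis_mod_def subset_iff)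
  then have "p ^ (Suc e * d) \<le> p ^ d * length b" using cardG c(2) by (simp add: d_def)
  then have "p ^ (e * d) \<le> length b" by (simp add: power_add)
  then show ?thesis using upper by (simp add: d_def)
qed

section \<open>Scheme-theoretic images\<close>

abbreviation sch_image :: "nat \<Rightarrow> ('x set \<Rightarrow> 'l set) \<Rightarrow> 'x set \<Rightarrow> 'l set" where
  "sch_image e Z \<equiv> scheme_image (Fr e) (\<lambda>U s. s) Z"

lemma sch_image_eq: "opn U \<Longrightarrow> U \<noteq> {} \<Longrightarrow> sch_image e Z U = A e U \<inter> Z U"
  by (auto simp: scheme_image_def)

lemma sch_image_empty: "sch_image e Z {} = {0} \<inter> Z {}"
  by (auto simp: scheme_image_def)

text \<open>An inverse at the higher level already exists at the lower one, since
  \<open>inverse f = f ^ (p - 1) * inverse f ^ p\<close> and \<open>p\<close>-th powers have the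
  lower level.\<close>

lemma unit_locus_level:
  assumes U: "opn U" and f: "f \<in> A e U"
  shows "unit_locus (Fr (Suc e)) U f = unit_locus (Fr e) U f"
proof -
  have ne: "y \<in> U \<Longrightarrow> U \<noteq> {}" for y by auto
  have fs: "f \<in> A (Suc e) U" if "y \<in> U" for y
    using A_level_mono[OF U ne[OF that], of e "Suc e"] f by auto
  have "inverse f \<in> stalk (Suc e) y \<longleftrightarrow> inverse f \<in> stalk e y" if y: "y \<in> U" "f \<noteq> 0" for y
  proof
    assume "inverse f \<in> stalk (Suc e) y"
    then have i: "inverse f ^ p \<in> stalk e y" using stalk_power_iff[of "inverse f" 1 e y] by simp
    have yt: "y \<in> topspace (pts X)" using y openin_subset[OF U] by auto
    have "f ^ (p - 1) * inverse f ^ p \<in> stalk e y"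
      using is_subringD(4,7)[OF subring_stalk[OF yt, of e]] in_stalk[OF U y(1) f] i by blast
    moreover have "f ^ (p - 1) * inverse f ^ p = (f * inverse f) ^ (p - 1) * inverse f"
      unfolding power_minus_mult[OF CHAR_pos, of "inverse f", symmetric]
      by (simp only: power_mult_distrib mult.assoc)
    then have "f ^ (p - 1) * inverse f ^ p = inverse f" using y(2) by simp
    ultimately show "inverse f \<in> stalk e y" by simp
  qed (use stalk_level_mono[of e "Suc e" y] in auto)
  then have "y \<in> unit_locus (Fr (Suc e)) U f \<longleftrightarrow> y \<in> unit_locus (Fr e) U f" if "y \<in> U" for y
    using unit_locus_iff[OF U f, of y] unit_locus_iff[OF U fs[OF that], of y] that by blast
  then show ?thesis by (auto dest: subsetD[OF unit_locus_subset])
qed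

text \<open>The point is quasi-coherence. For \<open>t\<close> on \<open>D(f)\<close>, one power of
  \<open>f\<close> brings it into \<open>Z U\<close>, by quasi-coherence of \<open>Z\<close> on the
  same affine set at the higher level, and another brings it into \<open>A e U\<close>. The product
  of both powers does both.\<close>

lemma closed_subscheme_image:
  assumes Z: "closed_subscheme (Fr (Suc e)) Z"
  shows "closed_subscheme (Fr e) (sch_image e Z)"
proof -
  have Zideal: "opn U \<longrightarrow> ideal (Z U) (sec (Fr (Suc e)) U)" for U
    using Z unfolding closed_subscheme_def Fr_simps(1) by (elim conjE allE)
  have Z0: "0 \<in> Z {}"
    using additive_subgroup.zero_closed[OF ideal.axioms(1)[OF Zideal[rule_format, of "{}"]]] by simp
  then have im0: "sch_image e Z {} = {0}" by (simp add: sch_image_empty)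
  have res_level: "res (Fr e) = res (Fr (Suc e))" by (simp add: frob_root_def)
  have sub: "carrier (sec (Fr e) U) \<subseteq> carrier (sec (Fr (Suc e)) U)" if "opn U" for U
    using A_level_mono[OF that, of e "Suc e"] by (cases "U = {}") auto
  have memb: "s \<in> sch_image e Z U \<longleftrightarrow> s \<in> carrier (sec (Fr e) U) \<and> s \<in> Z U" if "opn U" for U s
    using that by (simp add: scheme_image_def)
  show ?thesis unfolding closed_subscheme_def Fr_simps(1)
  proof (intro conjI allI impI ballI)
    fix U assume "\<not> opn U"
    then show "sch_image e Z U = {}" by (simp add: scheme_image_def)
  next
    fix U assume U: "opn U"
    show "ideal (sch_image e Z U) (sec (Fr e) U)"
    proof (cases "U = {}")
      case True
      have "ideal {\<zero>\<^bsub>sec (Fr e) {}\<^esub>} (sec (Fr e) {})"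
        by (rule ring.zeroideal[OF cring.axioms(1)[OF cring_sec_Fr]]) simp
      then show ?thesis using True im0 by simp
    next
      case False
      have "ideal_in (A e U) (A e U \<inter> Z U)"
        using is_subringD(2,4,6)[OF subring_A[OF U False, of e]] ideal_inD(2-4)[OF closed_subscheme_ideal[OF Z U False]]
          A_level_mono[OF U False, of e "Suc e"] by (auto simp: ideal_in_def)
      then show ?thesis
        using ideal_ring_on_iff[OF subring_A[OF U False]] sch_image_eq[OF U False] False by simp
    qed
  next
    fix U V s assume *: "opn U \<and> opn V \<and> V \<subseteq> U" and s: "s \<in> sch_image e Z U"
    have "\<forall>U V. opn U \<and> opn V \<and> V \<subseteq> U \<longrightarrow> (\<forall>s\<in>Z U. res (Fr (Suc e)) U V s \<in> Z V)"
      using Z unfolding closed_subscheme_def Fr_simps(1) by (elim conjE)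
    then have "res (Fr e) U V s \<in> Z V" using * s memb unfolding res_level by blast
    moreover have "res (Fr e) U V s \<in> carrier (sec (Fr e) V)" using Fr_res_closed * s memb by blast
    ultimately show "res (Fr e) U V s \<in> sch_image e Z V" using memb * by blast
  next
    fix \<U> s assume \<U>: "\<forall>V\<in>\<U>. opn V" and s: "s \<in> carrier (sec (Fr e) (\<Union>\<U>))"
      and loc: "\<forall>V\<in>\<U>. res (Fr e) (\<Union>\<U>) V s \<in> sch_image e Z V"
    have un: "opn (\<Union>\<U>)" using \<U> by blast
    have "\<forall>\<U>. (\<forall>V\<in>\<U>. opn V) \<longrightarrow>
        (\<forall>s\<in>carrier (sec (Fr (Suc e)) (\<Union>\<U>)). (\<forall>V\<in>\<U>. res (Fr (Suc e)) (\<Union>\<U>) V s \<in> Z V) \<longrightarrow> s \<in> Z (\<Union>\<U>))"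
      using Z unfolding closed_subscheme_def Fr_simps(1) by (elim conjE)
    moreover have "s \<in> carrier (sec (Fr (Suc e)) (\<Union>\<U>))" using sub[OF un] s by blast
    moreover have "\<forall>V\<in>\<U>. res (Fr (Suc e)) (\<Union>\<U>) V s \<in> Z V"
      using loc memb \<U> unfolding res_level by blast
    ultimately have "s \<in> Z (\<Union>\<U>)" using \<U> by blast
    then show "s \<in> sch_image e Z (\<Union>\<U>)" using memb[OF un] s by blast
  next
    fix U f assume aff: "affine_open (Fr e) U" and f: "f \<in> carrier (sec (Fr e) U)"
    have U: "opn U" by (rule affine_opn[OF aff])
    define D where "D = unit_locus (Fr e) U f"
    have "\<exists>n::nat. \<exists>s\<in>sch_image e Z U. res (Fr e) U D s = res (Fr e) U D f [^]\<^bsub>sec (Fr e) D\<^esub> n \<otimes>\<^bsub>sec (Fr e) D\<^esub> t"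
      if t: "t \<in> sch_image e Z D" for t
    proof (cases "D = {}")
      case True
      have "0 \<in> sch_image e Z U"
      proof (cases "U = {}")
        case False
        then show ?thesis
          using sch_image_eq[OF U False] is_subringD(2)[OF subring_A[OF U False]]
            ideal_inD(2)[OF closed_subscheme_ideal[OF Z U False]] by simp
      qed (simp add: im0)
      then show ?thesis using True t im0 by (intro exI[of _ "0::nat"] bexI[of _ 0]) auto
    next
      case False
      have ne: "U \<noteq> {}" using False unit_locus_subset unfolding D_def by fast
      have D: "opn D" unfolding D_def by (rule opn_unit_locus)
      have fA: "f \<in> A e U" using f ne by simp
      have fA': "f \<in> A (Suc e) U" using A_level_mono[OF U ne, of e "Suc e"] fA by auto
      have tD: "t \<in> A e D" "t \<in> Z D" using t sch_image_eq[OF D False] by auto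
      have aff': "affine_open (Fr (Suc e)) U" using aff affine_open_Fr_Suc by blast
      have "\<forall>U. affine_open (Fr (Suc e)) U \<longrightarrow> (\<forall>f\<in>carrier (sec (Fr (Suc e)) U).
        (let D = unit_locus (Fr (Suc e)) U f; r = res (Fr (Suc e)) U D in
           \<forall>t\<in>Z D. \<exists>n::nat. \<exists>s\<in>Z U. r s = r f [^]\<^bsub>sec (Fr (Suc e)) D\<^esub> n \<otimes>\<^bsub>sec (Fr (Suc e)) D\<^esub> t))"
        using Z unfolding closed_subscheme_def Fr_simps(1) by (elim conjE)
      note this[THEN spec, THEN mp, OF aff', THEN bspec, of f, unfolded Let_def unit_locus_level[OF U fA]]
      then have "\<forall>t\<in>Z D. \<exists>n::nat. \<exists>s\<in>Z U. res (Fr (Suc e)) U D s =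
          res (Fr (Suc e)) U D f [^]\<^bsub>sec (Fr (Suc e)) D\<^esub> n \<otimes>\<^bsub>sec (Fr (Suc e)) D\<^esub> t"
        using fA' ne unfolding D_def by simp
      then have "\<forall>t\<in>Z D. \<exists>n. f ^ n * t \<in> Z U"
        using False nat_pow_ring_on[OF subring_A[OF D False]] by simp
      then obtain n where s: "f ^ n * t \<in> Z U" using tD(2) by blast
      obtain m where m: "f ^ m * t \<in> A e U"
        using affine_localization[OF aff fA] tD(1) False unfolding D_def by blast
      have "f ^ m * (f ^ n * t) \<in> Z U"
        using ideal_inD(4)[OF closed_subscheme_ideal[OF Z U ne] is_subringD(7)[OF subring_A[OF U ne] fA'] s] .
      moreover have "f ^ n * (f ^ m * t) \<in> A e U"
        by (rule is_subringD(4)[OF subring_A[OF U ne] is_subringD(7)[OF subring_A[OF U ne] fA] m])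
      moreover have "f ^ n * (f ^ m * t) = f ^ (n + m) * t" "f ^ m * (f ^ n * t) = f ^ (n + m) * t"
        by (simp_all add: power_add mult_ac)
      ultimately have "f ^ (n + m) * t \<in> sch_image e Z U" using sch_image_eq[OF U ne] by simp
      then show ?thesis
        using False nat_pow_ring_on[OF subring_A[OF D False]]
        by (intro exI[of _ "n + m"] bexI[of _ "f ^ (n + m) * t"]) auto
    qed
    then show "let D = unit_locus (Fr e) U f; r = res (Fr e) U D in
         \<forall>t\<in>sch_image e Z D. \<exists>n::nat. \<exists>s\<in>sch_image e Z U. r s = r f [^]\<^bsub>sec (Fr e) D\<^esub> n \<otimes>\<^bsub>sec (Fr e) D\<^esub> t"
      unfolding Let_def D_def by blast
  qed
qed

text \<open>An element of level \<open>e\<close> is fixed by the splitting, so if it lies in the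
  upper fibre ideal, its image under the splitting shows that it lies in the lower one.\<close>

lemma sch_image_frob_fibre:
  assumes pure: "F_pure X \<iota>" and x: "closedin (pts X) {x}"
  shows "sch_image e (Fib (Suc e) x) = Fib e x"
proof
  fix V
  have xt: "x \<in> topspace (pts X)" using x closedin_subset by blast
  consider "\<not> opn V" | "V = {}" | "opn V" "V \<noteq> {}" by blast
  then show "sch_image e (Fib (Suc e) x) V = Fib e x V"
  proof cases
    case 1
    then show ?thesis by (simp add: scheme_image_def frob_fibre_not_open)
  next
    case 2
    then show ?thesis by (simp add: sch_image_empty frob_fibre_empty)
  next
    case 3
    have "s \<in> fibre_stalk (Suc e) x \<longleftrightarrow> s \<in> fibre_stalk e x" if s: "s \<in> A e V" "x \<in> V" for s
    proof
      assume sf: "s \<in> fibre_stalk (Suc e) x"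
      obtain U where U: "opn U" "x \<in> U" "\<forall>W. opn W \<and> W \<noteq> {} \<and> W \<subseteq> U \<longrightarrow> (\<exists>\<psi>. frobenius_splitting e W \<psi>)"
        using frobenius_splitting_exists[OF pure xt] by blast
      have W: "opn (U \<inter> V)" "U \<inter> V \<noteq> {}" "U \<inter> V \<subseteq> V" using U 3 s by auto
      then obtain \<psi> where \<psi>: "frobenius_splitting e (U \<inter> V) \<psi>" using U(3) by blast
      have sW: "s \<in> A e (U \<inter> V)" using A_mono[OF 3(1) W] s by auto
      then have "s \<in> A (Suc e) (U \<inter> V)" using A_level_mono[OF W(1,2), of e "Suc e"] by auto
      then have "\<psi> s \<in> fibre_stalk e x" using \<psi> sf U(2) s(2) unfolding frobenius_splitting_def by blast
      then show "s \<in> fibre_stalk e x" using \<psi> sW unfolding frobenius_splitting_def by simp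
    qed (use fibre_stalk_level_mono[of e "Suc e" x] in auto)
    then show ?thesis
      unfolding sch_image_eq[OF 3] frob_fibre_eq[OF x 3] using A_level_mono[OF 3, of e "Suc e"] by auto
  qed
qed

section \<open>Charts around the image of a fat point\<close>

lemma fat_point_supported_in:
  assumes "fat_point e I x" "x \<in> U"
  shows "supported_in (Fr e) I U"
  unfolding supported_in_def
proof
  fix y assume y: "y \<in> topspace (pts (Fr e)) - U"
  then obtain V where V: "opn V" "y \<in> V" "1 \<in> I V" using fat_pointD(3)[OF assms(1), of y] assms(2) by auto
  then have "V \<noteq> {}" by auto
  then show "\<exists>V. openin (pts (Fr e)) V \<and> y \<in> V \<and> \<one>\<^bsub>sec (Fr e) V\<^esub> \<in> I V"
    using V by (intro exI[of _ V]) simp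
qed

lemma frobenius_splitting_lc:
  assumes \<psi>: "frobenius_splitting e W \<psi>" and W: "opn W" "W \<noteq> {}"
    and b: "set b \<subseteq> A (Suc e) W" and zero: "\<And>z. z \<in> set b \<Longrightarrow> \<psi> z = 0"
  shows "\<psi> (lc cs b) = 0"
proof -
  note R = is_subringD[OF subring_A[OF W, of "Suc e"]]
  have "(\<Sum>i<n. \<kappa> (cs ! i) * b ! i) \<in> A (Suc e) W \<and> \<psi> (\<Sum>i<n. \<kappa> (cs ! i) * b ! i) = 0"
    if "n \<le> length b" for n
    using that
  proof (induction n)
    case 0
    show ?case using R(2) \<psi> is_subringD(2)[OF subring_A[OF W, of e]] by (simp add: frobenius_splitting_def)
  next
    case (Suc n)
    have bn: "b ! n \<in> A (Suc e) W" "\<psi> (b ! n) = 0" using Suc.prems b zero by auto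
    have "\<kappa> (cs ! n) * b ! n \<in> A (Suc e) W" by (rule R(4)[OF emb_in_A[OF W] bn(1)])
    moreover have "\<psi> (\<kappa> (cs ! n) * b ! n) = 0"
      using \<psi> bn emb_in_A[OF W, of "cs ! n" e] by (simp add: frobenius_splitting_def)
    ultimately show ?case using Suc R(6) \<psi> by (simp add: frobenius_splitting_def)
  qed
  then show ?thesis unfolding lc_def by blast
qed

lemma lc_append_zeros:
  "length cs = length b \<Longrightarrow> lc (cs @ replicate (length b') 0) (b @ b') = lc cs b"
  by (simp add: lc_append lc_replicate_0)

text \<open>
  A basis \<open>b'\<close> of the image of \<open>Z\<close> is extended by elements \<open>b''\<close> in the kernel of the splitting to
  a basis of \<open>Z\<close>.  For every fibre in the resulting chart, the splitting shows that \<open>b'\<close> is also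
  a basis of its image, and the coordinates of the image are among those of the fibre.
  The function \<open>g\<close> cuts out the open set on which the splitting is defined.
\<close>

lemma sch_image_chart:
  assumes pure: "F_pure X \<iota>" and fat: "fat_point (Suc e) Z x0"
    and aff: "affine_open (Fr e) U" and x0: "x0 \<in> U"
    and b: "set b \<subseteq> A e U" "basis_mod (A e U) (A e U \<inter> Z U) b"
    and b0: "basis_mod (stalk (Suc e) x0) (ideal_stalk Z x0) b0"
  obtains b' g i where "set b' \<subseteq> A (Suc e) U" "length (b @ b') = length b0"
    "Z \<in> Chart (Suc e) U (b @ b')"
    "g \<in> A (Suc e) U" "i < length (b @ b')" "Coord (Suc e) U (b @ b') g i Z \<noteq> 0"
    "sch_image e Z \<in> Chart e U b"
    "\<forall>s\<in>A e U. \<forall>j<length b.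
       Coord e U b s j (sch_image e Z) = Coord (Suc e) U (b @ b') s j Z"
    "\<forall>x. closedin (pts X) {x} \<and> Fib (Suc e) x \<in> Chart (Suc e) U (b @ b') \<and>
       Coord (Suc e) U (b @ b') g i (Fib (Suc e) x) \<noteq> 0 \<longrightarrow>
       Fib e x \<in> Chart e U b \<and>
       (\<forall>s\<in>A e U. \<forall>j<length b. Coord e U b s j (Fib e x) =
          Coord (Suc e) U (b @ b') s j (Fib (Suc e) x))"
proof -
  define E where "E = Suc e"
  have eE: "e \<le> E" by (simp add: E_def)
  define J where "J = ideal_stalk Z x0"
  have U: "opn U" "U \<noteq> {}" using affine_opn[OF aff] x0 by auto
  have aff': "affine_open (Fr E) U" using aff by (simp add: E_def affine_open_Fr_Suc)
  note F = fat_pointD[OF fat, folded E_def J_def]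
  have ZU: "Z U = A E U \<inter> J" unfolding J_def E_def by (rule fat_point_ideal[OF fat U(1) x0])
  have Aeu: "A e V \<subseteq> A E V" if "opn V" "V \<noteq> {}" for V
    using A_level_mono[OF that, of e E] by (simp add: E_def)
  note id = ideal_in_ideal_stalk[OF F(1,2), folded J_def] and sJ = subspace_ideal_stalk[OF F(1,2), folded J_def]
  note S = is_subringD[OF subring_stalk[OF F(2), of E]]
  note R = is_subringD[OF subring_A[OF U, of E]] and Re = is_subringD[OF subring_A[OF U, of e]]
  have unit: "c = 0" if "\<kappa> c \<in> J" for c
  proof (rule ccontr)
    assume "c \<noteq> 0"
    then have "\<kappa> (inverse c) * \<kappa> c = 1" by (simp flip: emb_mult)
    then show False using ideal_inD(4)[OF id emb_in_stalk[OF F(2)] that] F(4) by metis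
  qed
  obtain U0 where U0: "opn U0" "x0 \<in> U0" "\<forall>W. opn W \<and> W \<noteq> {} \<and> W \<subseteq> U0 \<longrightarrow> (\<exists>\<psi>. frobenius_splitting e W \<psi>)"
    using frobenius_splitting_exists[OF pure F(2)] by blast
  have "opn (U0 \<inter> U)" using U0 U by auto
  \<comment> \<open>The affine set \<open>U\<close> comes from a given chart and may exceed the
    domain of the splitting, so the splitting is taken on \<open>D(f)\<close>.\<close>
  then obtain f where f: "f \<in> A e U" "x0 \<in> unit_locus (Fr e) U f" "unit_locus (Fr e) U f \<subseteq> U0 \<inter> U"
    using affine_open_base[OF aff, of "U0 \<inter> U" x0] U0 U x0 by auto
  define W where "W = unit_locus (Fr e) U f"
  have W: "opn W" "x0 \<in> W" "W \<noteq> {}" "W \<subseteq> U" "W \<subseteq> U0" using f opn_unit_locus by (auto simp: W_def)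
  then obtain \<psi> where \<psi>: "frobenius_splitting e W \<psi>" using U0(3) by blast
  note \<psi>' = \<psi>[unfolded frobenius_splitting_def, folded E_def]
  note RW = is_subringD[OF subring_A[OF W(1,3), of E]]
  have UW: "A n U \<subseteq> A n W" for n using A_mono[OF U(1) W(1,3,4)] .
  have fi: "f \<noteq> 0" "inverse f \<in> stalk e x0" using f(2) unit_locus_iff[OF U(1) f(1)] by auto
  \<comment> \<open>Functions vanishing at a point may be nonzero nilpotents on the fibre. With the
    exponent \<open>p ^ E\<close> they become 0, and for the fat point \<open>Z\<close> the power is
    a scalar, nonzero since \<open>f\<close> is a unit at \<open>x0\<close>.\<close>
  define g where "g = f ^ (p ^ E)"
  have ge: "g \<in> A e U" unfolding g_def by (rule Re(7)[OF f(1)])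
  then have gE: "g \<in> A E U" using Aeu[OF U] by blast
  have fst: "f \<in> stalk E x0" using in_stalk[OF U(1) x0] Aeu[OF U] f(1) by blast
  obtain c where c: "g - \<kappa> c \<in> J" using F(5)[OF fst] unfolding g_def by blast
  have c0: "c \<noteq> 0"
  proof
    assume "c = 0"
    moreover have "inverse f \<in> stalk E x0" using fi(2) stalk_level_mono[of e E x0] by (auto simp: E_def)
    ultimately have "inverse f ^ (p ^ E) * g \<in> J" using ideal_inD(4)[OF id S(7)] c by simp
    then show False using F(4) fi(1) by (simp add: g_def flip: power_mult_distrib)
  qed
  have gJ: "g \<notin> J"
  proof
    assume "g \<in> J"
    then have "\<kappa> c \<in> J" using ideal_in_diff[OF id subring_stalk[OF F(2)] _ c] by fastforce
    then show False using unit c0 by blast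
  qed
  define G where "G = {s \<in> A E U. \<psi> s = 0}"
  have indb: "indep_mod J b"
    using b lc_closed[OF subspace_A[OF U] b(1)] Aeu[OF U]
    unfolding basis_mod_def indep_mod_def ZU by blast
  have stU: "A E U \<subseteq> stalk E x0" using in_stalk[OF U(1) x0] by blast
  have bst: "set b \<subseteq> stalk E x0" using b(1) Aeu[OF U] stU by blast
  have Gst: "G \<subseteq> stalk E x0" using stU by (auto simp: G_def)
  have sp0: "spans_mod (stalk E x0) J b0" using b0 by (simp add: basis_mod_def E_def J_def)
  obtain b' where b': "set b' \<subseteq> G" "indep_mod J (b @ b')" "spans_mod G J (b @ b')"
    using indep_mod_extend[OF sp0 sJ indb bst Gst] by blast
  have b'A: "set b' \<subseteq> A E U" using b'(1) by (auto simp: G_def)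
  have bb': "set (b @ b') \<subseteq> A E U" using b(1) b'A Aeu[OF U] by auto
  have "spans_mod (set b \<union> G) J (b @ b')"
    unfolding spans_mod_iff[OF sJ]
  proof
    fix s assume "s \<in> set b \<union> G"
    then show "\<exists>v\<in>vs.span (set (b @ b')). s - v \<in> J"
    proof
      assume "s \<in> set b"
      then show ?thesis using vs.span_base[of s "set (b @ b')"] vs.subspace_0[OF sJ] by force
    qed (use b'(3)[unfolded spans_mod_iff[OF sJ]] in blast)
  qed
  then have spans: "spans_mod (stalk E x0) J (b @ b')"
  proof (rule spans_mod_trans[OF sJ])
    \<comment> \<open>After approximation by a section \<open>s'\<close> over \<open>U\<close>, one
      decomposes \<open>g ^ n * s'\<close> into the multiple \<open>g ^ n * \<psi> s'\<close>, which
      has level \<open>e\<close> and is expanded in \<open>b\<close>, and a rest in the kernel of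
      \<open>\<psi>\<close>. The factor \<open>g ^ n\<close> is then divided out, being a nonzero
      scalar modulo \<open>J\<close>.\<close>
    fix s assume s: "s \<in> stalk E x0"
    have "\<exists>s'\<in>A E U. s - s' \<in> J"
      using stalk_approx[OF aff' x0 F(1) _ _ s] F(4,5) stU unfolding J_def by blast
    then obtain s' where s': "s' \<in> A E U" "s - s' \<in> J" by blast
    have s'W: "s' \<in> A E W" using s'(1) UW by blast
    have "\<psi> s' \<in> A e W" using \<psi>' s'W by blast
    then obtain n where n: "f ^ n * \<psi> s' \<in> A e U"
      using affine_localization[OF aff f(1,2)] by (auto simp: W_def)
    \<comment> \<open>Localization gives a power of \<open>f\<close> that clears the denominator of
      \<open>\<psi> s'\<close>; the same power of \<open>g\<close> is a multiple of it.\<close>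
    have "g ^ n = f ^ (n * (p ^ E - 1)) * f ^ n"
    proof -
      have "p ^ E * n = n * (p ^ E - 1) + n"
        using pe_pos[of E] by (cases "p ^ E") (simp_all add: algebra_simps)
      then show ?thesis by (simp add: g_def flip: power_mult power_add)
    qed
    then have v1: "g ^ n * \<psi> s' \<in> A e U"
      using Re(4)[OF Re(7)[OF f(1)] n] by (simp add: mult.assoc)
    define v2 where "v2 = g ^ n * s' - g ^ n * \<psi> s'"
    have gn: "g ^ n \<in> A E U" "g ^ n \<in> A e W" "g ^ n \<in> A E W"
      using R(7)[OF gE] Re(7)[OF ge] UW by blast+
    have v1W: "- (g ^ n * \<psi> s') \<in> A e W" "g ^ n * \<psi> s' \<in> A E U"
      using v1 UW Re(5) Aeu[OF U] by blast+
    have "v2 \<in> A E U" unfolding v2_def using R(3)[OF R(4)[OF gn(1) s'(1)] v1W(2)] .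
    moreover have "\<psi> v2 = 0"
    proof -
      have "\<psi> (g ^ n * s' + (- (g ^ n * \<psi> s'))) = \<psi> (g ^ n * s') + \<psi> (- (g ^ n * \<psi> s'))"
        using \<psi>' RW(4)[OF gn(3) s'W] Aeu[OF W(1,3)] v1W(1) by blast
      also have "\<dots> = g ^ n * \<psi> s' + (- (g ^ n * \<psi> s'))"
        using \<psi>' gn(2) s'W v1W(1) by simp
      finally show ?thesis by (simp add: v2_def)
    qed
    ultimately have v2: "v2 \<in> G" by (simp add: G_def)
    obtain cs where cs: "length cs = length b" "g ^ n * \<psi> s' - lc cs b \<in> J"
      using b(2) v1 unfolding basis_mod_def spans_mod_def ZU by blast
    define k where "k = inverse c ^ n"
    have "\<kappa> (inverse c) * g - 1 \<in> J"
    proof -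
      have "\<kappa> (inverse c) * (g - \<kappa> c) \<in> J" using vs.subspace_scale[OF sJ c] .
      moreover have "\<kappa> (inverse c) * \<kappa> c = 1" using c0 by (simp flip: emb_mult)
      ultimately show ?thesis by (simp add: right_diff_distrib)
    qed
    moreover have "\<kappa> (inverse c) * g \<in> stalk E x0" using S(4)[OF emb_in_stalk[OF F(2)]] gE stU by blast
    ultimately have "(\<kappa> (inverse c) * g) ^ n - 1 \<in> J"
      by (rule ideal_in_power_minus_one[OF id subring_stalk[OF F(2)], rotated])
    then have "\<kappa> k * g ^ n - 1 \<in> J" by (simp add: k_def emb_power power_mult_distrib)
    moreover have "- s' \<in> stalk E x0" using S(5) s'(1) stU by blast
    ultimately have "(- s') * (\<kappa> k * g ^ n - 1) \<in> J" by (rule ideal_inD(4)[OF id, rotated])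
    moreover have "\<kappa> k * (g ^ n * \<psi> s' - lc cs b) \<in> J" using vs.subspace_scale[OF sJ cs(2)] .
    ultimately have "(s - s') + ((- s') * (\<kappa> k * g ^ n - 1) + \<kappa> k * (g ^ n * \<psi> s' - lc cs b)) \<in> J"
      using s'(2) vs.subspace_add[OF sJ] by blast
    then have "s - \<kappa> k * (lc cs b + v2) \<in> J" by (simp add: v2_def algebra_simps)
    moreover have "lc cs b \<in> vs.span (set b \<union> G)" using lc_in_span vs.span_mono[of "set b" "set b \<union> G"] by blast
    then have "\<kappa> k * (lc cs b + v2) \<in> vs.span (set b \<union> G)"
      using v2 by (intro vs.span_scale vs.span_add) (auto intro: vs.span_base)
    ultimately show "\<exists>v\<in>vs.span (set b \<union> G). s - v \<in> J" by blast
  qed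
  have basis: "basis_mod (stalk E x0) J (b @ b')"
    using spans b'(2) bst b'(1) Gst by (auto simp: basis_mod_def)
  have len: "length (b @ b') = length b0"
    using basis_mod_length_eq[OF basis _ sJ] b0 by (simp add: E_def J_def)
  have supp: "supported_in (Fr E) Z U" unfolding E_def by (rule fat_point_supported_in[OF fat x0])
  have chart: "Z \<in> Chart E U (b @ b')"
    unfolding hilb_chart_Fr_iff[OF U bb']
    using F(1) supp fat_point_basis_iff[OF fat[folded E_def] aff' x0 bb'] basis by (simp add: J_def)
  have ZB: "basis_mod (A E U) (Z U) (b @ b')" using chart unfolding hilb_chart_Fr_iff[OF U bb'] by blast
  obtain gs where gs: "length gs = length (b @ b')" "g - lc gs (b @ b') \<in> Z U"
    using ZB gE unfolding basis_mod_def spans_mod_def by blast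
  \<comment> \<open>As \<open>g\<close> is nonzero modulo \<open>Z\<close>, one of its coordinates
    does not vanish. Its nonvanishing is an open condition, and on a fibre it forces the base point
    into \<open>D(f)\<close>.\<close>
  have "\<exists>i<length (b @ b'). gs ! i \<noteq> 0"
  proof (rule ccontr)
    assume "\<not> ?thesis"
    then have "lc gs (b @ b') = 0" by (simp add: lc_def)
    then show False using gs(2) gJ ZU by simp
  qed
  then obtain i where i: "i < length (b @ b')" "gs ! i \<noteq> 0" by blast
  have coord: "Coord E U (b @ b') g i Z \<noteq> 0"
    using hilb_coord_Fr[OF U bb' gE chart gs] i by simp
  have imU: "sch_image e Z U = A e U \<inter> Z U" by (rule sch_image_eq[OF U])
  have im_chart: "sch_image e Z \<in> Chart e U b"
    unfolding hilb_chart_Fr_iff[OF U b(1)]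
  proof (intro conjI)
    show "closed_subscheme (Fr e) (sch_image e Z)" using closed_subscheme_image F(1) by (simp add: E_def)
    show "supported_in (Fr e) (sch_image e Z) U"
      unfolding supported_in_def
    proof
      fix y assume y: "y \<in> topspace (pts (Fr e)) - U"
      then obtain V where V: "opn V" "y \<in> V" "1 \<in> Z V" using F(3)[of y] x0 by auto
      then have Vne: "V \<noteq> {}" by auto
      then have "1 \<in> sch_image e Z V" using sch_image_eq[OF V(1) Vne] is_subringD(1)[OF subring_A[OF V(1) Vne]] V(3) by simp
      then show "\<exists>V. openin (pts (Fr e)) V \<and> y \<in> V \<and> \<one>\<^bsub>sec (Fr e) V\<^esub> \<in> sch_image e Z V"
        using V Vne by (intro exI[of _ V]) simp
    qed
    show "basis_mod (A e U) (sch_image e Z U) b" using b(2) imU by simp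
  qed
  have coords: "Coord e U b s j (sch_image e Z) = Coord E U (b @ b') s j Z"
    if s: "s \<in> A e U" and j: "j < length b" for s j
  proof -
    obtain cs where cs: "length cs = length b" "s - lc cs b \<in> A e U \<inter> Z U"
      using b(2) s unfolding basis_mod_def spans_mod_def by blast
    have 1: "Coord e U b s j (sch_image e Z) = cs ! j"
      using hilb_coord_Fr[OF U b(1) s im_chart cs(1)] cs(2) imU by simp
    have "s - lc (cs @ replicate (length b') 0) (b @ b') \<in> Z U"
      using cs by (simp add: lc_append_zeros)
    then have "Coord E U (b @ b') s j Z = (cs @ replicate (length b') 0) ! j"
      using hilb_coord_Fr[OF U bb' _ chart, of s "cs @ replicate (length b') 0"] s Aeu[OF U] cs(1) by auto
    then show ?thesis using 1 cs(1) j by (simp add: nth_append)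
  qed
  have fibres: "Fib e x \<in> Chart e U b \<and>
       (\<forall>s\<in>A e U. \<forall>j<length b. Coord e U b s j (Fib e x) =
          Coord E U (b @ b') s j (Fib E x))"
    if x: "closedin (pts X) {x}" and ch: "Fib E x \<in> Chart E U (b @ b')"
      and co: "Coord E U (b @ b') g i (Fib E x) \<noteq> 0" for x
  proof -
    let ?F = "Fib E x" and ?Fe = "Fib e x"
    have ne: "b @ b' \<noteq> []" using i by auto
    have xU: "x \<in> U" by (rule frob_fibre_fat_point(1)[OF x aff' bb' ne ch])
    have fatx: "fat_point E ?F x" by (rule frob_fibre_fat_point(2)[OF x aff' bb' ne ch])
    have Fbasis: "basis_mod (A E U) (?F U) (b @ b')" and Fcl: "closed_subscheme (Fr E) ?F"
      using ch unfolding hilb_chart_Fr_iff[OF U bb'] by blast+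
    have FU: "?F U = A E U \<inter> fibre_stalk E x" using frob_fibre_eq[OF x U] xU by auto
    have FeU: "?Fe U = A e U \<inter> fibre_stalk e x" using frob_fibre_eq[OF x U] xU by auto
    have gF: "g \<notin> ?F U"
    proof
      assume "g \<in> ?F U"
      then have "g - lc (replicate (length (b @ b')) 0) (b @ b') \<in> ?F U" by (simp only: lc_replicate_0 diff_zero)
      then have "Coord E U (b @ b') g i ?F = replicate (length (b @ b')) 0 ! i"
        using hilb_coord_Fr[OF U bb' gE ch] by simp
      then show False using co i by simp
    qed
    \<comment> \<open>If \<open>f\<close> vanished at \<open>x\<close>, then
      \<open>f ^ (p ^ e)\<close>, a section of \<open>X\<close>, would lie in the maximal ideal, so
      \<open>g\<close> would lie in the fibre ideal.\<close>
    have xW: "x \<in> W"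
    proof (rule ccontr)
      assume "x \<notin> W"
      then have nu: "f = 0 \<or> inverse f \<notin> stalk e x" using unit_locus_iff[OF U(1) f(1)] xU by (auto simp: W_def)
      have "f ^ (p ^ e) \<in> stalk 0 x" using stalk_power_iff[of f e 0 x] in_stalk[OF U(1) xU f(1)] by simp
      moreover have "f ^ (p ^ e) = 0 \<or> inverse (f ^ (p ^ e)) \<notin> stalk 0 x"
        using nu stalk_power_iff[of "inverse f" e 0 x] by (auto simp: power_inverse)
      ultimately have "f ^ (p ^ e) \<in> fibre_stalk E x" by (rule nonunit_in_fibre_stalk)
      then have "(f ^ (p ^ e)) ^ p \<in> fibre_stalk E x"
        using ideal_in_power[OF fibre_stalk_ideal[OF x Fcl] subring_stalk] fat_pointD(2)[OF fatx] by simp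
      moreover have "(f ^ (p ^ e)) ^ p = g" by (simp add: g_def E_def mult.commute flip: power_mult)
      ultimately show False using gF FU gE by simp
    qed
    have image: "sch_image e ?F = ?Fe" unfolding E_def by (rule sch_image_frob_fibre[OF pure x])
    \<comment> \<open>The splitting kills the part of the combination in \<open>b'\<close> and fixes
      what has level \<open>e\<close>. So truncating the coordinate vector at level \<open>E\<close>
      gives coordinates at level \<open>e\<close>.\<close>
    have key: "s - lc (take (length b) ds) b \<in> ?Fe U"
      if s: "s \<in> A e U" and ds: "length ds = length (b @ b')" "s - lc ds (b @ b') \<in> ?F U" for s ds
    proof -
      define t where "t = s - lc (take (length b) ds) b"
      define r where "r = s - lc ds (b @ b')"
      have te: "t \<in> A e U" unfolding t_def by (rule Re(3)[OF s lc_closed[OF subspace_A[OF U] b(1)]])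
      have "lc ds (b @ b') = lc (take (length b) ds) b + lc (drop (length b) ds) b'"
        using lc_append[of "take (length b) ds" b "drop (length b) ds" b'] ds(1) by simp
      then have t: "t = r + lc (drop (length b) ds) b'" by (simp add: t_def r_def)
      have rF: "r \<in> A E W" "r \<in> fibre_stalk E x" using ds(2) UW unfolding FU r_def by auto
      have lW: "lc (drop (length b) ds) b' \<in> A E W" by (rule lc_closed[OF subspace_A[OF W(1,3)]]) (use b'A UW in blast)
      have "\<psi> (lc (drop (length b) ds) b') = 0"
        by (rule frobenius_splitting_lc[OF \<psi> W(1,3)]) (use b'(1) b'A UW in \<open>auto simp: G_def E_def[symmetric]\<close>)
      then have "\<psi> t = \<psi> r" using \<psi>' rF(1) lW by (simp add: t)
      moreover have "\<psi> t = t" using \<psi>' te UW by blast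
      moreover have "\<psi> r \<in> fibre_stalk e x" using \<psi>' rF xW by blast
      ultimately show ?thesis using te unfolding FeU t_def by simp
    qed
    have obt: "\<exists>ds. length ds = length (b @ b') \<and> s - lc ds (b @ b') \<in> ?F U" if "s \<in> A e U" for s
      using Fbasis that Aeu[OF U] unfolding basis_mod_def spans_mod_def by blast
    have "basis_mod (A e U) (?Fe U) b" unfolding basis_mod_def
    proof (intro conjI b(1))
      show "spans_mod (A e U) (?Fe U) b" unfolding spans_mod_def
      proof
        fix s assume s: "s \<in> A e U"
        then obtain ds where ds: "length ds = length (b @ b')" "s - lc ds (b @ b') \<in> ?F U" using obt by blast
        then show "\<exists>cs. length cs = length b \<and> s - lc cs b \<in> ?Fe U"
          using key[OF s ds] by (intro exI[of _ "take (length b) ds"]) simp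
      qed
      show "indep_mod (?Fe U) b" unfolding indep_mod_def
      proof (intro allI impI)
        fix cs j assume cs: "length cs = length b \<and> lc cs b \<in> ?Fe U" and j: "j < length b"
        \<comment> \<open>Padded with zeros, a relation modulo the lower fibre is one modulo the
          upper fibre, whose ideal contains the lower one.\<close>
        have "lc (cs @ replicate (length b') 0) (b @ b') \<in> ?F U"
          using cs Aeu[OF U] fibre_stalk_level_mono[OF eE, of x]
          unfolding FU FeU by (auto simp: lc_append_zeros)
        then have "\<forall>j<length (b @ b'). (cs @ replicate (length b') 0) ! j = 0"
          using Fbasis cs unfolding basis_mod_def indep_mod_def by (metis length_append length_replicate)
        then have "(cs @ replicate (length b') 0) ! j = 0" using j by simp
        then show "cs ! j = 0" using j cs by (simp add: nth_append)
      qed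
    qed
    moreover have "closed_subscheme (Fr e) ?Fe"
      using closed_subscheme_image[of e ?F] Fcl image by (simp add: E_def)
    moreover have "supported_in (Fr e) ?Fe U" unfolding supported_in_def
    proof
      fix y assume y: "y \<in> topspace (pts (Fr e)) - U"
      define V where "V = topspace (pts X) - {x}"
      have V: "opn V" "y \<in> V" "V \<noteq> {}" "x \<notin> V" using x y xU openin_diff[OF openin_topspace] by (auto simp: V_def)
      then have "1 \<in> ?Fe V" using one_in_frob_fibre[OF x] by blast
      then show "\<exists>V. openin (pts (Fr e)) V \<and> y \<in> V \<and> \<one>\<^bsub>sec (Fr e) V\<^esub> \<in> ?Fe V"
        using V by (intro exI[of _ V]) simp
    qed
    ultimately have ch': "?Fe \<in> Chart e U b" unfolding hilb_chart_Fr_iff[OF U b(1)] by blast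
    moreover have "Coord e U b s j ?Fe = Coord E U (b @ b') s j ?F"
      if s: "s \<in> A e U" and j: "j < length b" for s j
    proof -
      obtain ds where ds: "length ds = length (b @ b')" "s - lc ds (b @ b') \<in> ?F U" using obt[OF s] by blast
      have "Coord E U (b @ b') s j ?F = ds ! j"
        using hilb_coord_Fr[OF U bb' _ ch ds] s Aeu[OF U] by blast
      moreover have "Coord e U b s j ?Fe = take (length b) ds ! j"
        using hilb_coord_Fr[OF U b(1) s ch' _ key[OF s ds]] ds(1) by simp
      ultimately show ?thesis using j by simp
    qed
    ultimately show ?thesis by blast
  qed
  show ?thesis
    by (rule that[of b' g i]) (use b'A len chart gE i(1) coord im_chart coords fibres in \<open>auto simp: E_def\<close>)
qed

section \<open>Images of limits of fibres\<close>

text \<open>Each coordinate occurring in \<open>f\<close> is replaced by the coordinate of the same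
  section in the larger basis. Agreement of coordinates is known only for particular pairs of a
  subscheme and its image, so it is required on a relation \<open>S\<close>.\<close>

lemma hilb_functions_image:
  assumes f: "f \<in> hilb_functions (Fr e) U b" and U: "opn U" "U \<noteq> {}"
    and coord: "\<And>I I' s j. (I, I') \<in> S \<Longrightarrow> s \<in> A e U \<Longrightarrow> j < length b \<Longrightarrow>
      Coord e U b s j I = Coord (Suc e) U (b @ b') s j I'"
  shows "\<exists>f'\<in>hilb_functions (Fr (Suc e)) U (b @ b'). \<forall>z\<in>S. f (fst z) = f' (snd z)"
  using f
proof induction
  case (const c)
  show ?case by (rule bexI[OF _ hilb_functions.const]) auto
next
  case (coord s j)
  then have s: "s \<in> A e U" using U by simp
  then have "s \<in> carrier (sec (Fr (Suc e)) U)" using A_level_mono[OF U, of e "Suc e"] U by auto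
  then show ?case
    using coord assms(4)[OF _ s coord(2)]
    by (intro bexI[OF _ hilb_functions.coord[of s "Fr (Suc e)" U j "b @ b'"]]) auto
next
  case (add f g)
  then obtain f' g' where "f' \<in> hilb_functions (Fr (Suc e)) U (b @ b')" "\<forall>z\<in>S. f (fst z) = f' (snd z)"
    "g' \<in> hilb_functions (Fr (Suc e)) U (b @ b')" "\<forall>z\<in>S. g (fst z) = g' (snd z)" by blast
  then show ?case by (intro bexI[OF _ hilb_functions.add[of f' _ _ _ g']]) auto
next
  case (mult f g)
  then obtain f' g' where "f' \<in> hilb_functions (Fr (Suc e)) U (b @ b')" "\<forall>z\<in>S. f (fst z) = f' (snd z)"
    "g' \<in> hilb_functions (Fr (Suc e)) U (b @ b')" "\<forall>z\<in>S. g (fst z) = g' (snd z)" by blast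
  then show ?case by (intro bexI[OF _ hilb_functions.mult[of f' _ _ _ g']]) auto
qed

section \<open>The topology near a point of the F-blowup\<close>

lemma openin_hilb_basic:
  assumes "affine_open (Fr e) U" "U \<noteq> {}" "set b \<subseteq> A e U" "length b = n" "f \<in> hilb_functions (Fr e) U b"
  shows "openin (hilb_topology (Fr e) n) {I \<in> Chart e U b. f I \<noteq> 0}"
  unfolding hilb_topology_def
proof (rule topology_generated_by_Basis)
  have "set b \<subseteq> carrier (sec (Fr e) U)" using assms(2,3) by simp
  then show "{I \<in> Chart e U b. f I \<noteq> 0} \<in>
      {{I \<in> Chart e U b. f I \<noteq> 0} | U b f. affine_open (Fr e) U \<and>
         set b \<subseteq> carrier (sec (Fr e) U) \<and> length b = n \<and> f \<in> hilb_functions (Fr e) U b}"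
    using assms(1,4,5) by blast
qed

lemma F_blowup_eq:
  "F_blowup X \<iota> e = Hilb e closure_of
     {Fib e x | x. smooth_closed_point X x}"
  by (simp add: F_blowup_def CHAR_k)

lemma F_blowup_fibre_near:
  assumes "Z \<in> F_blowup X \<iota> e" "openin (Hilb e) T" "Z \<in> T"
  obtains x where "smooth_closed_point X x" "Fib e x \<in> T"
  using assms unfolding F_blowup_eq closure_of_def by blast

text \<open>On a fibre, \<open>t = s ^ (p ^ e)\<close> is a scalar, so the coordinate vectors of 1
  and \<open>t\<close> are proportional. The 2 by 2 minors are functions on the chart that vanish on
  all fibres in it, hence at \<open>Z\<close>; and proportionality at \<open>Z\<close> says that
  \<open>t\<close> is a scalar modulo \<open>Z U\<close>.\<close>

lemma F_blowup_fat_point: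
  assumes Z: "Z \<in> F_blowup X \<iota> e" and aff: "affine_open (Fr e) U" and b: "set b \<subseteq> A e U"
    and len: "length b = p ^ (e * krull_dim (pts X))" and chart: "Z \<in> Chart e U b"
  obtains x where "x \<in> U" "fat_point e Z x"
proof -
  have "length b > 0" unfolding len by (rule pe_pos)
  then have ne: "b \<noteq> []" by simp
  have U: "opn U" "U \<noteq> {}" by (rule affine_opn[OF aff], rule hilb_chart_nonempty[OF chart ne])
  note R = is_subringD[OF subring_A[OF U, of e]]
  have basis: "spans_mod (A e U) (I U) b" "vs.subspace (I U)" if "I \<in> Chart e U b" for I
    using that subspace_closed_subscheme[OF _ U] unfolding hilb_chart_Fr_iff[OF U b] basis_mod_def by blast+
  have "\<exists>c. s ^ (p ^ e) - \<kappa> c \<in> Z U" if s: "s \<in> A e U" for s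
  proof -
    define t where "t = s ^ (p ^ e)"
    have t: "t \<in> A e U" unfolding t_def by (rule R(7)[OF s])
    let ?c = "Coord e U b"
    have minor: "?c 1 i Z * ?c t j Z = ?c 1 j Z * ?c t i Z" if ij: "i < length b" "j < length b" for i j
    proof (rule ccontr)
      assume neq: "?c 1 i Z * ?c t j Z \<noteq> ?c 1 j Z * ?c t i Z"
      \<comment> \<open>The minor, written with a constant -1 because \<open>hilb_functions\<close>
        is generated by sums and products.\<close>
      define f where "f I = ?c 1 i I * ?c t j I + (- 1) * (?c 1 j I * ?c t i I)" for I
      have cf: "?c r l \<in> hilb_functions (Fr e) U b" if "r \<in> A e U" "l < length b" for r l
        using that U by (intro hilb_functions.coord) auto
      have "f \<in> hilb_functions (Fr e) U b"
        unfolding f_def by (intro hilb_functions.add hilb_functions.mult hilb_functions.const cf R(1) t ij)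
      then have "openin (Hilb e) {I \<in> Chart e U b. f I \<noteq> 0}"
        using openin_hilb_basic[OF aff U(2) b len] by blast
      moreover have "Z \<in> {I \<in> Chart e U b. f I \<noteq> 0}" using chart neq by (simp add: f_def)
      ultimately obtain x where x: "smooth_closed_point X x" "Fib e x \<in> {I \<in> Chart e U b. f I \<noteq> 0}"
        by (rule F_blowup_fibre_near[OF Z])
      let ?F = "Fib e x"
      have F: "?F \<in> Chart e U b" "f ?F \<noteq> 0" using x(2) by auto
      have cx: "closedin (pts X) {x}" using x(1) by (simp add: smooth_closed_point_def)
      note xU = frob_fibre_fat_point[OF cx aff b ne F(1)]
      have "s \<in> stalk e x" by (rule in_stalk[OF U(1) xU(1) s])
      then obtain c where c: "t - \<kappa> c \<in> ideal_stalk ?F x" using fat_pointD(5)[OF xU(2)] unfolding t_def by blast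
      have "t - \<kappa> c \<in> A e U" by (rule R(3)[OF t emb_in_A[OF U]])
      then have c': "t - \<kappa> c \<in> ?F U" using c fat_point_ideal[OF xU(2) U(1) xU(1)] by blast
      obtain cs where cs: "length cs = length b" "1 - lc cs b \<in> ?F U"
        using basis(1)[OF F(1)] R(1) unfolding spans_mod_def by blast
      have "(t - \<kappa> c) + \<kappa> c * (1 - lc cs b) \<in> ?F U"
        using vs.subspace_add[OF basis(2)[OF F(1)] c' vs.subspace_scale[OF basis(2)[OF F(1)] cs(2)]] .
      then have "t - lc (map ((*) c) cs) b \<in> ?F U" by (simp add: right_diff_distrib lc_scale[OF cs(1)])
      then have "?c t l ?F = c * ?c 1 l ?F" if "l < length b" for l
        using hilb_coord_Fr[OF U b t F(1), of "map ((*) c) cs" l] hilb_coord_Fr[OF U b R(1) F(1) cs, of l] cs(1) that by simp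
      then have "f ?F = 0" using ij by (simp add: f_def)
      then show False using F(2) by simp
    qed
    obtain cs where cs: "length cs = length b" "1 - lc cs b \<in> Z U"
      using basis(1)[OF chart] R(1) unfolding spans_mod_def by blast
    obtain ds where ds: "length ds = length b" "t - lc ds b \<in> Z U"
      using basis(1)[OF chart] t unfolding spans_mod_def by blast
    have minor': "cs ! i * ds ! j = cs ! j * ds ! i" if "i < length b" "j < length b" for i j
      using minor[OF that] hilb_coord_Fr[OF U b R(1) chart cs] hilb_coord_Fr[OF U b t chart ds] by simp
    \<comment> \<open>Vanishing minors give a factor of proportionality only if the vector of 1 is
      nonzero; otherwise \<open>Z U\<close> would be the unit ideal.\<close>
    have "\<exists>i<length b. cs ! i \<noteq> 0"
    proof (rule ccontr)
      assume "\<not> ?thesis"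
      then have "lc cs b = 0" by (simp add: lc_def)
      then have one: "1 \<in> Z U" using cs(2) by simp
      have ch: "closed_subscheme (Fr e) Z" "indep_mod (Z U) b"
        using chart unfolding hilb_chart_Fr_iff[OF U b] basis_mod_def by blast+
      have "A e U \<subseteq> Z U" using ideal_inD(4)[OF closed_subscheme_ideal[OF ch(1) U] _ one] by auto
      then show False using unit_ideal_not_indep_mod[OF ch(2)] b ne by blast
    qed
    then obtain i where i: "i < length b" "cs ! i \<noteq> 0" by blast
    define c where "c = ds ! i / cs ! i"
    have "ds = map ((*) c) cs"
    proof (rule nth_equalityI)
      fix j assume "j < length ds"
      then have j: "j < length b" using ds(1) by simp
      then show "ds ! j = map ((*) c) cs ! j"
        using minor'[OF i(1) j] i(2) cs(1) by (simp add: c_def field_simps)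
    qed (simp add: cs ds)
    then have "lc ds b = \<kappa> c * lc cs b" by (simp add: lc_scale[OF cs(1)])
    moreover have "(t - lc ds b) - \<kappa> c * (1 - lc cs b) \<in> Z U"
      using vs.subspace_diff[OF basis(2)[OF chart] ds(2) vs.subspace_scale[OF basis(2)[OF chart] cs(2)]] .
    ultimately have "t - \<kappa> c \<in> Z U" by (simp add: right_diff_distrib)
    then show ?thesis unfolding t_def ..
  qed
  then show ?thesis using fat_point_exists[OF aff b ne chart] that by metis
qed

lemma F_blowup_chart:
  assumes "Z \<in> F_blowup X \<iota> e"
  obtains U b where "affine_open (Fr e) U" "U \<noteq> {}" "set b \<subseteq> A e U"
    "length b = p ^ (e * krull_dim (pts X))" "Z \<in> Chart e U b"
proof -
  have "Z \<in> topspace (Hilb e)"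
    using assms unfolding F_blowup_eq closure_of_def by blast
  then obtain U b where *: "affine_open (Fr e) U" "set b \<subseteq> carrier (sec (Fr e) U)"
    "length b = p ^ (e * krull_dim (pts X))" "Z \<in> Chart e U b"
    unfolding hilb_topology_def topology_generated_by_topspace by blast
  moreover have "length b > 0" unfolding *(3) by (rule pe_pos)
  then have "U \<noteq> {}" using hilb_chart_nonempty[OF *(4)] by simp
  ultimately show ?thesis using that by auto
qed

text \<open>The local statement \<open>near\<close> is used twice: to find the length of the image,
  by looking at a single fibre near \<open>Z\<close>, and to pull back basic neighbourhoods of the
  image to neighbourhoods of \<open>Z\<close>. Every neighbourhood of \<open>Z\<close> contains a
  fibre, so every neighbourhood of the image does too.\<close>

lemma sch_image_in_F_blowup:
  assumes pure: "F_pure X \<iota>" and Z: "Z \<in> F_blowup X \<iota> (Suc e)"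
  shows "sch_image e Z \<in> F_blowup X \<iota> e"
proof -
  define N where "N n = p ^ (n * krull_dim (pts X))" for n
  have Npos: "N n > 0" for n by (simp add: N_def)
  obtain U0 b0 where U0: "affine_open (Fr (Suc e)) U0" "U0 \<noteq> {}" "set b0 \<subseteq> A (Suc e) U0"
    "length b0 = N (Suc e)" "Z \<in> Chart (Suc e) U0 b0"
    using F_blowup_chart[OF Z] unfolding N_def by metis
  obtain x0 where x0: "x0 \<in> U0" "fat_point (Suc e) Z x0"
    using F_blowup_fat_point[OF Z U0(1,3) _ U0(5)] U0(4) unfolding N_def by blast
  have opU0: "opn U0" by (rule affine_opn[OF U0(1)])
  note F = fat_pointD[OF x0(2)]
  have basis0: "basis_mod (A (Suc e) U0) (Z U0) b0"
    using U0(5) hilb_chart_Fr_iff[OF opU0 U0(2,3)] by blast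
  have st0: "basis_mod (stalk (Suc e) x0) (ideal_stalk Z x0) b0"
    using basis0 fat_point_basis_iff[OF x0(2) U0(1) x0(1) U0(3)] by blast
  \<comment> \<open>The length of \<open>b\<close> is part of the conclusion, since at first
    \<open>b\<close> is just any basis for the image.\<close>
  have near: "\<exists>T. openin (hilb_topology (Fr (Suc e)) (N (Suc e))) T \<and> Z \<in> T \<and>
      sch_image e Z \<in> Chart e U b \<and>
      (\<forall>x. smooth_closed_point X x \<and> Fib (Suc e) x \<in> T \<longrightarrow>
        length b = N e \<and> Fib e x \<in> Chart e U b \<and>
        (f (sch_image e Z) \<noteq> 0 \<longrightarrow> f (Fib e x) \<noteq> 0))"
    if aff: "affine_open (Fr e) U" and xU: "x0 \<in> U" and b: "set b \<subseteq> A e U" "b \<noteq> []"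
      and basis: "basis_mod (A e U) (A e U \<inter> Z U) b"
      and f: "f \<in> hilb_functions (Fr e) U b" for U b f
  proof -
    have U: "opn U" "U \<noteq> {}" using affine_opn[OF aff] xU by auto
    have aff': "affine_open (Fr (Suc e)) U" using aff affine_open_Fr_Suc by blast
    obtain b' g i where *: "set b' \<subseteq> A (Suc e) U" "length (b @ b') = length b0"
      "Z \<in> Chart (Suc e) U (b @ b')"
      "g \<in> A (Suc e) U" "i < length (b @ b')" "Coord (Suc e) U (b @ b') g i Z \<noteq> 0"
      "sch_image e Z \<in> Chart e U b"
      and cZ: "\<forall>s\<in>A e U. \<forall>j<length b.
         Coord e U b s j (sch_image e Z) = Coord (Suc e) U (b @ b') s j Z"
      and cF: "\<forall>x. closedin (pts X) {x} \<and> Fib (Suc e) x \<in> Chart (Suc e) U (b @ b') \<and>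
         Coord (Suc e) U (b @ b') g i (Fib (Suc e) x) \<noteq> 0 \<longrightarrow>
         Fib e x \<in> Chart e U b \<and>
         (\<forall>s\<in>A e U. \<forall>j<length b. Coord e U b s j (Fib e x) =
            Coord (Suc e) U (b @ b') s j (Fib (Suc e) x))"
      by (rule sch_image_chart[OF pure x0(2) aff xU b(1) basis st0])
    have bb': "set (b @ b') \<subseteq> A (Suc e) U" using *(1) b(1) A_level_mono[OF U, of e "Suc e"] by auto
    define good where "good x \<longleftrightarrow> closedin (pts X) {x} \<and> Fib (Suc e) x \<in> Chart (Suc e) U (b @ b') \<and>
         Coord (Suc e) U (b @ b') g i (Fib (Suc e) x) \<noteq> 0" for x
    define S where "S = insert (sch_image e Z, Z) {(Fib e x, Fib (Suc e) x) | x. good x}"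
    have "Coord e U b s j I = Coord (Suc e) U (b @ b') s j I'"
      if "(I, I') \<in> S" "s \<in> A e U" "j < length b" for I I' s j
      using that cZ cF unfolding S_def good_def by blast
    then obtain f' where f': "f' \<in> hilb_functions (Fr (Suc e)) U (b @ b')" "\<forall>z\<in>S. f (fst z) = f' (snd z)"
      using hilb_functions_image[OF f U] by blast
    \<comment> \<open>The second factor keeps the fibres over \<open>D(f)\<close> for the
      \<open>f\<close> on whose unit locus the splitting exists. The first transports nonvanishing
      of the chart function \<open>f\<close>; if that vanishes at the image there is nothing to
      transport, and the factor 1 keeps \<open>h\<close> nonzero at \<open>Z\<close>.\<close>
    define h where "h I = (if f (sch_image e Z) = 0 then 1 else f' I) * Coord (Suc e) U (b @ b') g i I" for I
    have "(\<lambda>I. if f (sch_image e Z) = 0 then 1 else f' I) \<in> hilb_functions (Fr (Suc e)) U (b @ b')"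
      using f'(1) hilb_functions.const[of 1] by (cases "f (sch_image e Z) = 0") simp_all
    moreover have "Coord (Suc e) U (b @ b') g i \<in> hilb_functions (Fr (Suc e)) U (b @ b')"
      using *(4,5) U by (intro hilb_functions.coord) auto
    ultimately have h: "h \<in> hilb_functions (Fr (Suc e)) U (b @ b')"
      unfolding h_def by (rule hilb_functions.mult)
    define T where "T = {I \<in> Chart (Suc e) U (b @ b'). h I \<noteq> 0}"
    have "openin (hilb_topology (Fr (Suc e)) (N (Suc e))) T"
      unfolding T_def using *(2) U0(4) by (intro openin_hilb_basic[OF aff' U(2) bb' _ h]) simp
    moreover have "Z \<in> T"
      using *(3,6) f'(2) unfolding T_def h_def S_def by auto
    moreover have "length b = N e \<and> Fib e x \<in> Chart e U b \<and>
        (f (sch_image e Z) \<noteq> 0 \<longrightarrow> f (Fib e x) \<noteq> 0)"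
      if x: "smooth_closed_point X x" and xT: "Fib (Suc e) x \<in> T" for x
    proof (intro conjI impI)
      have cx: "closedin (pts X) {x}" using x by (simp add: smooth_closed_point_def)
      have good: "good x" using cx xT unfolding good_def T_def h_def by auto
      then show ch: "Fib e x \<in> Chart e U b" using cF unfolding good_def by blast
      have ch': "Fib (Suc e) x \<in> Chart (Suc e) U (b @ b')" using good by (simp add: good_def)
      have ne: "b @ b' \<noteq> []" using b(2) by simp
      have xU: "x \<in> U" by (rule frob_fibre_fat_point(1)[OF cx aff b ch])
      have fat: "fat_point e (Fib e x) x" by (rule frob_fibre_fat_point(2)[OF cx aff b ch])
      have fat': "fat_point (Suc e) (Fib (Suc e) x) x" by (rule frob_fibre_fat_point(2)[OF cx aff' bb' ne ch'])
      have "basis_mod (stalk e x) (fibre_stalk e x) b"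
        using fat_point_basis_iff[OF fat aff xU b(1)] ch hilb_chart_Fr_iff[OF U b(1)] ideal_stalk_frob_fibre[OF cx] by auto
      moreover have "basis_mod (stalk (Suc e) x) (fibre_stalk (Suc e) x) (b @ b')"
        using fat_point_basis_iff[OF fat' aff' xU bb'] ch' hilb_chart_Fr_iff[OF U bb'] ideal_stalk_frob_fibre[OF cx] by auto
      ultimately show "length b = N e"
        using length_frob_fibre[OF x fat_pointD(1)[OF fat] fat'] *(2) U0(4) unfolding N_def by metis
      assume "f (sch_image e Z) \<noteq> 0"
      then have "f' (Fib (Suc e) x) \<noteq> 0" using xT by (auto simp: T_def h_def)
      moreover have "(Fib e x, Fib (Suc e) x) \<in> S"
        unfolding S_def using good by blast
      then have "f (Fib e x) = f' (Fib (Suc e) x)" using f'(2) by force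
      ultimately show "f (Fib e x) \<noteq> 0" by simp
    qed
    ultimately show ?thesis using *(7) by blast
  qed
  have top: "sch_image e Z \<in> topspace (hilb_topology (Fr e) (N e))"
  proof -
    have aff: "affine_open (Fr e) U0" using U0(1) affine_open_Fr_Suc by blast
    \<comment> \<open>Extending the empty list inside \<open>A e U0\<close> produces a basis for the
      image; its length is finite because \<open>Z\<close> has finite length.\<close>
    obtain b where b: "set b \<subseteq> A e U0" "indep_mod (Z U0) ([] @ b)" "spans_mod (A e U0) (Z U0) ([] @ b)"
      using indep_mod_extend[of "A (Suc e) U0" "Z U0" b0 "[]" "A e U0"] basis0
        subspace_closed_subscheme[OF F(1) opU0 U0(2)] A_level_mono[OF opU0 U0(2), of e "Suc e"]
      by (auto simp: basis_mod_def indep_mod_def)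
    have bA: "lc cs b \<in> A e U0" for cs by (rule lc_closed[OF subspace_A[OF opU0 U0(2)] b(1)])
    then have basis: "basis_mod (A e U0) (A e U0 \<inter> Z U0) b"
      using b is_subringD(3)[OF subring_A[OF opU0 U0(2), of e]]
      unfolding basis_mod_def indep_mod_def spans_mod_def by simp
    have "b \<noteq> []"
    proof
      assume "b = []"
      then have "1 \<in> Z U0"
        using b(3) is_subringD(1)[OF subring_A[OF opU0 U0(2), of e]] by (auto simp: spans_mod_def)
      then show False using F(4) in_ideal_stalk[OF opU0 x0(1)] by blast
    qed
    then obtain T where T: "openin (hilb_topology (Fr (Suc e)) (N (Suc e))) T" "Z \<in> T"
        "sch_image e Z \<in> Chart e U0 b"
      and Tx: "\<forall>x. smooth_closed_point X x \<and> Fib (Suc e) x \<in> T \<longrightarrow> length b = N e"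
      using near[OF aff x0(1) b(1) _ basis hilb_functions.const[of 1]] by blast
    obtain x where "smooth_closed_point X x" "Fib (Suc e) x \<in> T"
      using F_blowup_fibre_near[OF Z T(1)[unfolded N_def] T(2)] by blast
    then have "length b = N e" using Tx by blast
    \<comment> \<open>With the constant function 1 the basic open set is the whole chart.\<close>
    then have "openin (hilb_topology (Fr e) (N e)) {I \<in> Chart e U0 b. (\<lambda>_. 1) I \<noteq> (0::'k)}"
      by (intro openin_hilb_basic[OF aff U0(2) b(1)] hilb_functions.const)
    then show ?thesis using T(3) openin_subset by fastforce
  qed
  have nbhd: "\<exists>T'. openin (hilb_topology (Fr (Suc e)) (N (Suc e))) T' \<and> Z \<in> T' \<and>
      (\<forall>x. smooth_closed_point X x \<and> Fib (Suc e) x \<in> T' \<longrightarrow> Fib e x \<in> T)"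
    if "openin (hilb_topology (Fr e) (N e)) T" "sch_image e Z \<in> T" for T
    using openin_topology_generated_by[OF that(1)[unfolded hilb_topology_def]] that(2)
  proof induction
    case Empty
    then show ?case by simp
  next
    case (Int a b)
    then obtain S T where "openin (hilb_topology (Fr (Suc e)) (N (Suc e))) S" "Z \<in> S"
      "\<forall>x. smooth_closed_point X x \<and> Fib (Suc e) x \<in> S \<longrightarrow> Fib e x \<in> a"
      "openin (hilb_topology (Fr (Suc e)) (N (Suc e))) T" "Z \<in> T"
      "\<forall>x. smooth_closed_point X x \<and> Fib (Suc e) x \<in> T \<longrightarrow> Fib e x \<in> b"
      by blast
    then show ?case by (intro exI[of _ "S \<inter> T"]) auto
  next
    case (UN K)
    then obtain k where k: "k \<in> K" "sch_image e Z \<in> k" by blast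
    then show ?case using UN.IH[OF k] by blast
  next
    case (Basis s)
    then obtain U b f where s: "s = {I \<in> Chart e U b. f I \<noteq> 0}" and aff: "affine_open (Fr e) U"
      and b: "set b \<subseteq> carrier (sec (Fr e) U)" "length b = N e" and f: "f \<in> hilb_functions (Fr e) U b"
      by blast
    have ch: "sch_image e Z \<in> Chart e U b" "f (sch_image e Z) \<noteq> 0" using Basis.prems s by auto
    have ne: "b \<noteq> []" using b(2) Npos[of e] by auto
    have U: "opn U" "U \<noteq> {}" by (rule affine_opn[OF aff], rule hilb_chart_nonempty[OF ch(1) ne])
    have bA: "set b \<subseteq> A e U" using b(1) U by simp
    have supp: "supported_in (Fr e) (sch_image e Z) U" and basis: "basis_mod (A e U) (A e U \<inter> Z U) b"
      using ch(1) unfolding hilb_chart_Fr_iff[OF U bA] sch_image_eq[OF U] by blast+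
    \<comment> \<open>The chart only says that the image is supported in \<open>U\<close>. If
      \<open>x0\<close> were outside, 1 would lie in the ideal of \<open>Z\<close> near
      \<open>x0\<close>, where \<open>Z\<close> is supported.\<close>
    have "x0 \<in> U"
    proof (rule ccontr)
      assume "x0 \<notin> U"
      then obtain V where V: "opn V" "x0 \<in> V" "\<one>\<^bsub>sec (Fr e) V\<^esub> \<in> sch_image e Z V"
        using supp F(2) by (auto simp: supported_in_def)
      then have "V \<noteq> {}" by auto
      then have "1 \<in> Z V" using V sch_image_eq[OF V(1)] by simp
      then show False using F(4) in_ideal_stalk[OF V(1,2)] by blast
    qed
    then obtain T where T: "openin (hilb_topology (Fr (Suc e)) (N (Suc e))) T" "Z \<in> T"
      "\<forall>x. smooth_closed_point X x \<and> Fib (Suc e) x \<in> T \<longrightarrow>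
        length b = N e \<and> Fib e x \<in> Chart e U b \<and>
        (f (sch_image e Z) \<noteq> 0 \<longrightarrow> f (Fib e x) \<noteq> 0)"
      using near[OF aff _ bA ne basis f] by blast
    then show ?case using ch(2) unfolding s by (intro exI[of _ T]) auto
  qed
  show ?thesis unfolding F_blowup_eq closure_of_def
  proof (intro CollectI conjI allI impI)
    show "sch_image e Z \<in> topspace (Hilb e)"
      using top by (simp add: N_def)
    fix T assume T: "sch_image e Z \<in> T \<and> openin (Hilb e) T"
    then obtain T' where T': "openin (hilb_topology (Fr (Suc e)) (N (Suc e))) T'" "Z \<in> T'"
      "\<forall>x. smooth_closed_point X x \<and> Fib (Suc e) x \<in> T' \<longrightarrow> Fib e x \<in> T"
      using nbhd[of T] unfolding N_def by blast
    obtain x where "smooth_closed_point X x" "Fib (Suc e) x \<in> T'"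
      using F_blowup_fibre_near[OF Z T'(1)[unfolded N_def] T'(2)] by blast
    then show "\<exists>y\<in>{Fib e x | x. smooth_closed_point X x}. y \<in> T" using T'(3) by blast
  qed
qed

end

theorem proposition4p1:
  fixes X :: "('x, 'a, 'k::alg_closed_field) kspace"
    and \<iota> :: "'x set \<Rightarrow> 'a \<Rightarrow> 'l::alg_closed_field"
    and e :: nat
    and Z :: "'x set \<Rightarrow> 'l set"
  assumes "CHAR('k) > 0"
    and "variety X"
    and "function_field_closure X \<iota>"
    and "F_pure X \<iota>"
    and "Z \<in> F_blowup X \<iota> (e + 1)"
  shows "scheme_image (frob_root X \<iota> e) (\<lambda>U s. s) Z \<in> F_blowup X \<iota> e"
proof -
  interpret frobenius_roots X \<iota> "CHAR('k)"
    using assms(1-3) by unfold_locales (auto simp: variety_def kscheme_def integral_scheme_def)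
  show ?thesis using sch_image_in_F_blowup[OF assms(4), of Z e] assms(5) by simp
qed

end
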